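(* Let $T$ be a completely nonunitary contraction with rank one defects acting on an infinite-dimensional separable Hilbert space $H$ (respectively, on a finite-dimensional Hilbert space $H$, $\dim H=N$). Then $T$ is unitarily equivalent to the operator acting on $\ell^2(\mathbb{N})$ (respectively, on $\mathbb{C}^N$) determined by the truncated CMV matrix $\mathcal{T}(\{\alpha_n\})$, where $\{\alpha_n\}$ are the Schur parameters of the characteristic function of $T$. In particular, every completely nonunitary contraction $T$ with rank one defects on $H$ is a product of a co-isometric and an isometric operator with rank one defects: there are a Hilbert space $K$, an isometry $M:H\to K$ with $\mathrm{rank}(I-MM^* )=1$ and a co-isometry $L:K\to H$ with $\mathrm{rank}(I-L^*L)=1$ such that $T=LM$.
   Context: $\mathbb{D}$ is the open unit disk, $\mathbb{T}$ the unit circle; Hilbert spaces are complex. For a contraction $T$ ($\|T\|\le1$) on $H$, put $D_T=(I-T^*T)^{1/2}$, $D_{T^*}=(I-TT^* )^{1/2}$, $\mathfrak{D}_T=\overline{\mathrm{ran}}\,D_T$, $\mathfrak{D}_{T^*}=\overline{\mathrm{ran}}\,D_{T^*}$. $T$ has rank one defects if $\dim\mathfrak{D}_T=\dim\mathfrak{D}_{T^*}=1$. $T$ is completely nonunitary if there is no nonzero subspace reducing $T$ on which $T$ is unitary. The characteristic function of $T$ is $\Theta_T(z)=\bigl(-T+zD_{T^*}(I-zT^* )^{-1}D_T\bigr)|_{\mathfrak{D}_T}:\mathfrak{D}_T\to\mathfrak{D}_{T^*}$, $z\in\mathbb{D}$. For a contraction with rank one defects it is regarded as a scalar function by identifying $\mathfrak{D}_T,\mathfrak{D}_{T^*}$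 with $\mathbb{C}$ by unitary maps; it is then determined up to a unimodular constant factor (any choice is allowed). Schur parameters. A Schur function is an analytic $f:\mathbb{D}\to\overline{\mathbb{D}}$. Put $f_0=f$, $\gamma_n=f_n(0)$, $f_{n+1}(z)=\dfrac{f_n(z)-\gamma_n}{z(1-\bar\gamma_nf_n(z))}$; the $\gamma_n$ are the Schur parameters of $f$. If $f$ is not a finite Blaschke product, the sequence is infinite with all $\gamma_n\in\mathbb{D}$; if $f$ is a finite Blaschke product of order $N$, the algorithm stops and there are parameters $\gamma_0,\dots,\gamma_{N-1}\in\mathbb{D}$, $|\gamma_N|=1$. Truncated CMV matrices. Let $\{\alpha_n\}_{n\ge0}\subset\mathbb{D}$ be infinite (semi-infinite case), or $\alpha_0,\dots,\alpha_{N-1}\in\mathbb{D}$, $|\alpha_N|=1$ ($N\times N$ case); $\rho_n=\sqrt{1-|\alpha_n|^2}$. The truncated CMV matrix $\mathcal{T}(\{\alpha_n\})=(t_{ij})$, with $i,j\in\mathbb{N}$ or $1\le i,j\le N$ respectively, has entries $t_{m,m}=-\bar\alpha_m\alpha_{m-1}$; for $m$ odd: $t_{m+1,m}=\bar\alpha_{m+1}\rho_m$, $t_{m,m+1}=-\alpha_{m-1}\rho_m$, $t_{m+2,m}=\rho_m\rho_{m+1}$, $t_{m,m+2}=0$; for $m$ even: $t_{m+1,m}=-\alpha_{m-1}\rho_m$, $t_{m,m+1}=\bar\alpha_{m+1}\rho_m$, $t_{m+2,m}=0$, $t_{m,m+2}=\rho_m\rho_{m+1}$; all other entries are $0$. (It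 is the five-diagonal CMV matrix with its first row and column deleted.) *)

theory Defs
  imports "HOL-Analysis.Analysis"
begin

section \<open>Complex inner product spaces\<close>

text \<open>The real structure (norm, topology, real inner product) is that of the library; the complex
  inner product is linear in its first argument and has the real one as its real part.\<close>

class complex_inner = real_inner +
  fixes scaleC :: "complex \<Rightarrow> 'a \<Rightarrow> 'a" (infixr \<open>*\<^sub>C\<close> 75)
    and cinner :: "'a \<Rightarrow> 'a \<Rightarrow> complex"
  assumes scaleC_add_right: "c *\<^sub>C (x + y) = c *\<^sub>C x + c *\<^sub>C y"
    and scaleC_add_left: "(c + d) *\<^sub>C x = c *\<^sub>C x + d *\<^sub>C x"
    and scaleC_scaleC: "c *\<^sub>C d *\<^sub>C x = (c * d) *\<^sub>C x"
    and scaleC_of_real: "complex_of_real r *\<^sub>C x = r *\<^sub>R x"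
    and cinner_commute: "cinner x y = cnj (cinner y x)"
    and cinner_add_left: "cinner (x + y) z = cinner x z + cinner y z"
    and cinner_scaleC_left: "cinner (c *\<^sub>C x) y = c * cinner x y"
    and Re_cinner: "Re (cinner x y) = inner x y"

class chilbert_space = complex_inner + complete_space

global_interpretation complex_vector:
  vector_space "scaleC :: complex \<Rightarrow> 'a \<Rightarrow> 'a :: complex_inner"
proof
  fix x :: 'a
  show "1 *\<^sub>C x = x"
    using scaleC_of_real[of 1 x] by simp
qed (simp_all add: scaleC_add_right scaleC_add_left scaleC_scaleC)

instantiation complex :: chilbert_space
begin

definition scaleC_complex :: "complex \<Rightarrow> complex \<Rightarrow> complex"
  where "scaleC_complex c x = c * x"

definition cinner_complex :: "complex \<Rightarrow> complex \<Rightarrow> complex"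
  where "cinner_complex x y = x * cnj y"

instance
  by standard (simp_all add: scaleC_complex_def cinner_complex_def inner_complex_def
      algebra_simps scaleR_conv_of_real)

end

instantiation prod :: (complex_inner, complex_inner) complex_inner
begin

definition scaleC_prod :: "complex \<Rightarrow> 'a \<times> 'b \<Rightarrow> 'a \<times> 'b"
  where "scaleC_prod c x = (c *\<^sub>C fst x, c *\<^sub>C snd x)"

definition cinner_prod :: "'a \<times> 'b \<Rightarrow> 'a \<times> 'b \<Rightarrow> complex"
  where "cinner_prod x y = cinner (fst x) (fst y) + cinner (snd x) (snd y)"

instance
proof
  fix x y :: "'a \<times> 'b"
  show "cinner x y = cnj (cinner y x)"
    unfolding cinner_prod_def complex_cnj_add
    by (metis cinner_commute)
qed (simp_all add: scaleC_prod_def cinner_prod_def inner_prod_def scaleC_add_right scaleC_add_left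
      scaleC_scaleC scaleC_of_real cinner_add_left cinner_scaleC_left Re_cinner
      distrib_left scaleR_prod_def)

end

instance prod :: (chilbert_space, chilbert_space) chilbert_space ..

instantiation vec :: (complex_inner, finite) complex_inner
begin

definition scaleC_vec :: "complex \<Rightarrow> 'a ^ 'b \<Rightarrow> 'a ^ 'b"
  where "scaleC_vec c x = (\<chi> i. c *\<^sub>C x $ i)"

definition cinner_vec :: "'a ^ 'b \<Rightarrow> 'a ^ 'b \<Rightarrow> complex"
  where "cinner_vec x y = (\<Sum>i\<in>UNIV. cinner (x $ i) (y $ i))"

instance
proof
  fix x y :: "'a ^ 'b"
  show "cinner x y = cnj (cinner y x)"
    unfolding cinner_vec_def cnj_sum by (rule sum.cong[OF refl], rule cinner_commute)
qed (simp_all add: scaleC_vec_def cinner_vec_def inner_vec_def vec_eq_iff scaleC_add_right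
      scaleC_add_left scaleC_scaleC scaleC_of_real cinner_add_left cinner_scaleC_left Re_cinner
      sum.distrib sum_distrib_left)

end

instance vec :: (chilbert_space, finite) chilbert_space ..


section \<open>The space of square summable sequences\<close>

typedef ell2 = "{x :: nat \<Rightarrow> complex. summable (\<lambda>n. (cmod (x n))\<^sup>2)}"
  morphisms ell2_nth Abs_ell2
  by (rule exI[of _ "\<lambda>_. 0"]) simp

lemma ell2_nth_summable: "summable (\<lambda>n. (cmod (ell2_nth x n))\<^sup>2)"
  using ell2_nth[of x] by simp

lemma ell2_eqI: "(\<And>n. ell2_nth x n = ell2_nth y n) \<Longrightarrow> x = y"
  by (metis ell2_nth_inject ext)

lemma ell2_nth_Abs: "summable (\<lambda>n. (cmod (f n))\<^sup>2) \<Longrightarrow> ell2_nth (Abs_ell2 f) = f"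
  by (simp add: Abs_ell2_inverse)

lemma summable_cmod_add_squared:
  assumes "summable (\<lambda>n. (cmod (f n))\<^sup>2)" "summable (\<lambda>n. (cmod (g n))\<^sup>2)"
  shows "summable (\<lambda>n. (cmod (f n + g n))\<^sup>2)"
proof (rule summable_comparison_test')
  show "summable (\<lambda>n. 2 * (cmod (f n))\<^sup>2 + 2 * (cmod (g n))\<^sup>2)"
    using assms by (intro summable_add summable_mult)
  fix n
  have "(cmod (f n + g n))\<^sup>2 \<le> (cmod (f n) + cmod (g n))\<^sup>2"
    by (intro power_mono norm_triangle_ineq) simp
  also have "\<dots> \<le> 2 * (cmod (f n))\<^sup>2 + 2 * (cmod (g n))\<^sup>2"
    using sum_squares_bound[of "cmod (f n)" "cmod (g n)"] by (simp add: power2_sum)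
  finally show "norm ((cmod (f n + g n))\<^sup>2) \<le> 2 * (cmod (f n))\<^sup>2 + 2 * (cmod (g n))\<^sup>2"
    by simp
qed

lemma summable_cmod_mult_squared:
  assumes "summable (\<lambda>n. (cmod (f n))\<^sup>2)"
  shows "summable (\<lambda>n. (cmod (c * f n))\<^sup>2)"
  using summable_mult[OF assms, of "(cmod c)\<^sup>2"] by (simp add: norm_mult power_mult_distrib)

lemma summable_mult_cnj:
  assumes "summable (\<lambda>n. (cmod (f n))\<^sup>2)" "summable (\<lambda>n. (cmod (g n))\<^sup>2)"
  shows "summable (\<lambda>n. f n * cnj (g n))"
proof (rule summable_comparison_test')
  show "summable (\<lambda>n. (cmod (f n))\<^sup>2 + (cmod (g n))\<^sup>2)"
    using assms by (rule summable_add)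
  show "norm (f n * cnj (g n)) \<le> (cmod (f n))\<^sup>2 + (cmod (g n))\<^sup>2" for n
  proof -
    have "2 * (cmod (f n) * cmod (g n)) \<le> (cmod (f n))\<^sup>2 + (cmod (g n))\<^sup>2"
      using sum_squares_bound[of "cmod (f n)" "cmod (g n)"] by simp
    moreover have "0 \<le> cmod (f n) * cmod (g n)"
      by simp
    ultimately show ?thesis
      unfolding norm_mult complex_mod_cnj by linarith
  qed
qed

instantiation ell2 :: real_inner
begin

definition zero_ell2 :: ell2
  where "zero_ell2 = Abs_ell2 (\<lambda>_. 0)"

definition plus_ell2 :: "ell2 \<Rightarrow> ell2 \<Rightarrow> ell2"
  where "plus_ell2 x y = Abs_ell2 (\<lambda>n. ell2_nth x n + ell2_nth y n)"

definition scaleR_ell2 :: "real \<Rightarrow> ell2 \<Rightarrow> ell2"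
  where "scaleR_ell2 r x = Abs_ell2 (\<lambda>n. complex_of_real r * ell2_nth x n)"

definition uminus_ell2 :: "ell2 \<Rightarrow> ell2"
  where "uminus_ell2 x = (-1) *\<^sub>R x"

definition minus_ell2 :: "ell2 \<Rightarrow> ell2 \<Rightarrow> ell2"
  where "minus_ell2 x y = x + - y"

definition inner_ell2 :: "ell2 \<Rightarrow> ell2 \<Rightarrow> real"
  where "inner_ell2 x y = Re (\<Sum>n. ell2_nth x n * cnj (ell2_nth y n))"

definition norm_ell2 :: "ell2 \<Rightarrow> real"
  where "norm_ell2 x = sqrt (inner x x)"

definition sgn_ell2 :: "ell2 \<Rightarrow> ell2"
  where "sgn_ell2 x = inverse (norm x) *\<^sub>R x"

definition dist_ell2 :: "ell2 \<Rightarrow> ell2 \<Rightarrow> real"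
  where "dist_ell2 x y = norm (x - y)"

definition uniformity_ell2 :: "(ell2 \<times> ell2) filter"
  where "uniformity_ell2 = (INF e\<in>{0<..}. principal {(x, y). dist x y < e})"

definition open_ell2 :: "ell2 set \<Rightarrow> bool"
  where "open_ell2 U \<longleftrightarrow> (\<forall>x\<in>U. \<forall>\<^sub>F (x', y) in uniformity. x' = x \<longrightarrow> y \<in> U)"

lemma ell2_nth_zero [simp]: "ell2_nth 0 n = 0"
  by (simp add: zero_ell2_def ell2_nth_Abs)

lemma ell2_nth_add [simp]: "ell2_nth (x + y) n = ell2_nth x n + ell2_nth y n"
  by (simp add: plus_ell2_def ell2_nth_Abs summable_cmod_add_squared ell2_nth_summable)

lemma ell2_nth_scaleR [simp]: "ell2_nth (r *\<^sub>R x) n = complex_of_real r * ell2_nth x n"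
  unfolding scaleR_ell2_def
  by (subst ell2_nth_Abs) (rule summable_cmod_mult_squared, rule ell2_nth_summable, rule refl)

lemma ell2_nth_uminus [simp]: "ell2_nth (- x) n = - ell2_nth x n"
  by (simp add: uminus_ell2_def)

lemma ell2_nth_diff [simp]: "ell2_nth (x - y) n = ell2_nth x n - ell2_nth y n"
  by (simp add: minus_ell2_def)

lemma ell2_inner_summable: "summable (\<lambda>n. ell2_nth x n * cnj (ell2_nth y n))"
  by (intro summable_mult_cnj ell2_nth_summable)

lemma inner_ell2_self: "inner x x = (\<Sum>n. (cmod (ell2_nth x n))\<^sup>2)" for x :: ell2
proof -
  have "(\<lambda>n. Re (ell2_nth x n * cnj (ell2_nth x n))) sums inner x x"
    unfolding inner_ell2_def by (intro sums_Re summable_sums ell2_inner_summable)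
  then show ?thesis
    by (simp add: sums_iff complex_mult_cnj cmod_power2)
qed

instance
proof
  fix x y z :: ell2 and r s :: real
  show "x + y + z = x + (y + z)" "x + y = y + x" "0 + x = x" "- x + x = 0" "x - y = x + - y"
    by (rule ell2_eqI; simp)+
  show "r *\<^sub>R (x + y) = r *\<^sub>R x + r *\<^sub>R y" "(r + s) *\<^sub>R x = r *\<^sub>R x + s *\<^sub>R x"
    "r *\<^sub>R s *\<^sub>R x = (r * s) *\<^sub>R x" "1 *\<^sub>R x = x"
    by (rule ell2_eqI; simp add: algebra_simps)+
  show "sgn x = inverse (norm x) *\<^sub>R x" "dist x y = norm (x - y)" "norm x = sqrt (inner x x)"
    by (simp_all add: sgn_ell2_def dist_ell2_def norm_ell2_def)
  show "uniformity = (INF e\<in>{0<..}. principal {(x :: ell2, y). dist x y < e})"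
    by (rule uniformity_ell2_def)
  show "open U = (\<forall>x\<in>U. \<forall>\<^sub>F (x', y) in uniformity. x' = x \<longrightarrow> y \<in> U)" for U :: "ell2 set"
    by (rule open_ell2_def)
  have "(\<Sum>n. ell2_nth y n * cnj (ell2_nth x n))
      = cnj (\<Sum>n. ell2_nth x n * cnj (ell2_nth y n))"
    using sums_cnj[THEN iffD2, OF summable_sums[OF ell2_inner_summable[of x y]]]
    by (simp add: sums_iff mult.commute)
  then show "inner x y = inner y x"
    by (simp add: inner_ell2_def)
  show "inner (x + y) z = inner x z + inner y z"
    by (simp add: inner_ell2_def distrib_right suminf_add[symmetric] ell2_inner_summable)
  show "inner (r *\<^sub>R x) y = r * inner x y"
    by (simp add: inner_ell2_def mult.assoc suminf_mult ell2_inner_summable)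
  show "0 \<le> inner x x"
    unfolding inner_ell2_self by (intro suminf_nonneg ell2_nth_summable) simp
  show "inner x x = 0 \<longleftrightarrow> x = 0"
    unfolding inner_ell2_self
    by (subst suminf_eq_zero_iff[OF ell2_nth_summable]) (auto intro: ell2_eqI)
qed

end

instantiation ell2 :: complex_inner
begin

definition scaleC_ell2 :: "complex \<Rightarrow> ell2 \<Rightarrow> ell2"
  where "scaleC_ell2 c x = Abs_ell2 (\<lambda>n. c * ell2_nth x n)"

definition cinner_ell2 :: "ell2 \<Rightarrow> ell2 \<Rightarrow> complex"
  where "cinner_ell2 x y = (\<Sum>n. ell2_nth x n * cnj (ell2_nth y n))"

lemma ell2_nth_scaleC [simp]: "ell2_nth (c *\<^sub>C x) n = c * ell2_nth x n"
  by (simp add: scaleC_ell2_def ell2_nth_Abs summable_cmod_mult_squared ell2_nth_summable)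

instance
proof
  fix x y z :: ell2 and c d :: complex and r :: real
  show "c *\<^sub>C (x + y) = c *\<^sub>C x + c *\<^sub>C y" "(c + d) *\<^sub>C x = c *\<^sub>C x + d *\<^sub>C x"
    "c *\<^sub>C d *\<^sub>C x = (c * d) *\<^sub>C x" "complex_of_real r *\<^sub>C x = r *\<^sub>R x"
    by (rule ell2_eqI; simp add: algebra_simps)+
  show "cinner x y = cnj (cinner y x)"
    using sums_cnj[THEN iffD2, OF summable_sums[OF ell2_inner_summable[of y x]]]
    by (simp add: cinner_ell2_def sums_iff mult.commute)
  show "cinner (x + y) z = cinner x z + cinner y z"
    by (simp add: cinner_ell2_def distrib_right suminf_add[symmetric] ell2_inner_summable)
  show "cinner (c *\<^sub>C x) y = c * cinner x y"
    by (simp add: cinner_ell2_def mult.assoc suminf_mult ell2_inner_summable)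
  show "Re (cinner x y) = inner x y"
    by (simp add: cinner_ell2_def inner_ell2_def)
qed

end

lemma ell2_norm_squared: "(norm x)\<^sup>2 = (\<Sum>n. (cmod (ell2_nth x n))\<^sup>2)"
  by (simp add: power2_norm_eq_inner inner_ell2_self)

lemma ell2_partial_sum_le: "(\<Sum>n<p. (cmod (ell2_nth x n))\<^sup>2) \<le> (norm x)\<^sup>2"
  unfolding ell2_norm_squared by (intro sum_le_suminf ell2_nth_summable) auto

lemma ell2_nth_le_norm: "cmod (ell2_nth x n) \<le> norm x"
proof -
  have "(cmod (ell2_nth x n))\<^sup>2 \<le> (\<Sum>i<Suc n. (cmod (ell2_nth x i))\<^sup>2)"
    by (simp add: sum_nonneg)
  also have "\<dots> \<le> (norm x)\<^sup>2"
    by (rule ell2_partial_sum_le)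
  finally show ?thesis
    by (simp add: power2_le_iff_abs_le)
qed

instance ell2 :: chilbert_space
proof
  fix X :: "nat \<Rightarrow> ell2"
  assume X: "Cauchy X"
  have "Cauchy (\<lambda>k. ell2_nth (X k) n)" for n
  proof (rule CauchyI)
    fix e :: real assume "0 < e"
    then obtain M where "\<forall>j\<ge>M. \<forall>k\<ge>M. norm (X j - X k) < e"
      using CauchyD[OF X] by blast
    then show "\<exists>M. \<forall>j\<ge>M. \<forall>k\<ge>M. norm (ell2_nth (X j) n - ell2_nth (X k) n) < e"
      by (metis ell2_nth_diff ell2_nth_le_norm le_less_trans)
  qed
  then have "\<exists>l. (\<lambda>k. ell2_nth (X k) n) \<longlonglongrightarrow> l" for n
    using Cauchy_convergent_iff convergent_def by blast
  then obtain l where l: "\<And>n. (\<lambda>k. ell2_nth (X k) n) \<longlonglongrightarrow> l n"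
    by metis
  have tail: "\<exists>M. \<forall>j\<ge>M. \<forall>p. (\<Sum>n<p. (cmod (ell2_nth (X j) n - l n))\<^sup>2) \<le> e\<^sup>2"
    if "0 < e" for e :: real
  proof -
    obtain M where M: "\<And>j k. j \<ge> M \<Longrightarrow> k \<ge> M \<Longrightarrow> norm (X j - X k) < e"
      using CauchyD[OF X \<open>0 < e\<close>] by blast
    have "(\<Sum>n<p. (cmod (ell2_nth (X j) n - l n))\<^sup>2) \<le> e\<^sup>2" if "j \<ge> M" for j p
    proof (rule LIMSEQ_le_const2)
      show "(\<lambda>k. \<Sum>n<p. (cmod (ell2_nth (X j) n - ell2_nth (X k) n))\<^sup>2)
          \<longlonglongrightarrow> (\<Sum>n<p. (cmod (ell2_nth (X j) n - l n))\<^sup>2)"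
        by (intro tendsto_intros l)
      have "(\<Sum>n<p. (cmod (ell2_nth (X j) n - ell2_nth (X k) n))\<^sup>2) \<le> e\<^sup>2" if "k \<ge> M" for k
      proof -
        have "(\<Sum>n<p. (cmod (ell2_nth (X j) n - ell2_nth (X k) n))\<^sup>2) \<le> (norm (X j - X k))\<^sup>2"
          using ell2_partial_sum_le[of "X j - X k" p] by simp
        also have "\<dots> \<le> e\<^sup>2"
          using M[OF \<open>j \<ge> M\<close> that] by (intro power_mono) auto
        finally show ?thesis .
      qed
      then show "\<exists>N. \<forall>k\<ge>N. (\<Sum>n<p. (cmod (ell2_nth (X j) n - ell2_nth (X k) n))\<^sup>2) \<le> e\<^sup>2"
        by blast
    qed
    then show ?thesis by blast
  qed
  have diff: "summable (\<lambda>n. (cmod (ell2_nth (X j) n - l n))\<^sup>2)"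
    if "\<forall>p. (\<Sum>n<p. (cmod (ell2_nth (X j) n - l n))\<^sup>2) \<le> e" for j e
    using that by (intro summableI_nonneg_bounded[of _ e]) auto
  obtain M where "\<forall>j\<ge>M. \<forall>p. (\<Sum>n<p. (cmod (ell2_nth (X j) n - l n))\<^sup>2) \<le> 1\<^sup>2"
    using tail[of 1] by auto
  then have "summable (\<lambda>n. (cmod (ell2_nth (X M) n - l n))\<^sup>2)"
    by (intro diff[of _ "1\<^sup>2"]) blast
  then have "summable (\<lambda>n. (cmod ((- 1) * (ell2_nth (X M) n - l n) + ell2_nth (X M) n))\<^sup>2)"
    by (intro summable_cmod_add_squared summable_cmod_mult_squared ell2_nth_summable)
  then have L: "ell2_nth (Abs_ell2 l) = l"
    by (intro ell2_nth_Abs) simp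
  have "X \<longlonglongrightarrow> Abs_ell2 l"
  proof (rule LIMSEQ_I)
    fix r :: real assume "0 < r"
    then obtain M where M: "\<forall>j\<ge>M. \<forall>p. (\<Sum>n<p. (cmod (ell2_nth (X j) n - l n))\<^sup>2) \<le> (r / 2)\<^sup>2"
      using tail[of "r / 2"] by auto
    have "norm (X j - Abs_ell2 l) < r" if "j \<ge> M" for j
    proof -
      have "(norm (X j - Abs_ell2 l))\<^sup>2 \<le> (r / 2)\<^sup>2"
        unfolding ell2_norm_squared ell2_nth_diff L
        using M that by (intro suminf_le_const diff[of _ "(r / 2)\<^sup>2"]) auto
      then have "norm (X j - Abs_ell2 l) \<le> r / 2"
        using \<open>0 < r\<close> by (simp add: power2_le_iff_abs_le)
      then show ?thesis
        using \<open>0 < r\<close> by simp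
    qed
    then show "\<exists>M. \<forall>j\<ge>M. norm (X j - Abs_ell2 l) < r"
      by blast
  qed
  then show "convergent X"
    by (rule convergentI)
qed

definition ell2_unit :: "nat \<Rightarrow> ell2"
  where "ell2_unit k = Abs_ell2 (\<lambda>n. if n = k then 1 else 0)"


section \<open>Operators\<close>

definition bounded_clinear :: "('a::complex_inner \<Rightarrow> 'b::complex_inner) \<Rightarrow> bool"
  where "bounded_clinear T \<longleftrightarrow> bounded_linear T \<and> (\<forall>c x. T (c *\<^sub>C x) = c *\<^sub>C T x)"

definition cadjoint :: "('a::complex_inner \<Rightarrow> 'b::complex_inner) \<Rightarrow> 'b \<Rightarrow> 'a"
  where "cadjoint T = (THE S. \<forall>x y. cinner (T x) y = cinner x (S y))"

definition positive_op :: "('a::complex_inner \<Rightarrow> 'a) \<Rightarrow> bool"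
  where "positive_op A \<longleftrightarrow> bounded_clinear A \<and> (\<forall>x. cinner (A x) x \<in> \<real>\<^sub>\<ge>\<^sub>0)"

definition op_sqrt :: "('a::complex_inner \<Rightarrow> 'a) \<Rightarrow> 'a \<Rightarrow> 'a"
  where "op_sqrt A = (THE B. positive_op B \<and> B \<circ> B = A)"

text \<open>\<open>complex_vector.dim\<close> is 0 on infinite-dimensional spaces, so rank 1 means exactly
  one-dimensional range.\<close>

definition op_rank :: "('a::complex_inner \<Rightarrow> 'b::complex_inner) \<Rightarrow> nat"
  where "op_rank A = complex_vector.dim (range A)"

definition unitary_between ::
    "'a::complex_inner set \<Rightarrow> 'b::complex_inner set \<Rightarrow> ('a \<Rightarrow> 'b) \<Rightarrow> bool"
  where "unitary_between V W U \<longleftrightarrow>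
    (\<forall>x\<in>V. \<forall>y\<in>V. U (x + y) = U x + U y) \<and> (\<forall>c. \<forall>x\<in>V. U (c *\<^sub>C x) = c *\<^sub>C U x) \<and>
    (\<forall>x\<in>V. \<forall>y\<in>V. cinner (U x) (U y) = cinner x y) \<and> U ` V = W"

definition unitarily_equivalent ::
    "('a::complex_inner \<Rightarrow> 'a) \<Rightarrow> ('b::complex_inner \<Rightarrow> 'b) \<Rightarrow> bool"
  where "unitarily_equivalent S T \<longleftrightarrow> (\<exists>U. unitary_between UNIV UNIV U \<and> U \<circ> S = T \<circ> U)"

definition isometry_op :: "('a::complex_inner \<Rightarrow> 'b::complex_inner) \<Rightarrow> bool"
  where "isometry_op M \<longleftrightarrow> bounded_clinear M \<and> cadjoint M \<circ> M = id"

definition coisometry_op :: "('a::complex_inner \<Rightarrow> 'b::complex_inner) \<Rightarrow> bool"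
  where "coisometry_op L \<longleftrightarrow> bounded_clinear L \<and> L \<circ> cadjoint L = id"

definition finite_dimensional :: "'a::complex_inner itself \<Rightarrow> bool"
  where "finite_dimensional _ \<longleftrightarrow> (\<exists>B :: 'a set. finite B \<and> complex_vector.span B = UNIV)"


section \<open>Contractions, defects and characteristic functions\<close>

definition contraction :: "('a::complex_inner \<Rightarrow> 'a) \<Rightarrow> bool"
  where "contraction T \<longleftrightarrow> bounded_clinear T \<and> onorm T \<le> 1"

definition defect_op :: "('a::complex_inner \<Rightarrow> 'a) \<Rightarrow> 'a \<Rightarrow> 'a"
  where "defect_op T = op_sqrt (\<lambda>x. x - cadjoint T (T x))"

text \<open>The defect operator and the defect space of the adjoint are obtained by applying these
  definitions to \<open>cadjoint T\<close>.\<close>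

definition defect_space :: "('a::complex_inner \<Rightarrow> 'a) \<Rightarrow> 'a set"
  where "defect_space T = closure (range (defect_op T))"

definition rank_one_defects :: "('a::complex_inner \<Rightarrow> 'a) \<Rightarrow> bool"
  where "rank_one_defects T \<longleftrightarrow> complex_vector.dim (defect_space T) = 1 \<and>
    complex_vector.dim (defect_space (cadjoint T)) = 1"

definition reducing_subspace :: "('a::complex_inner \<Rightarrow> 'a) \<Rightarrow> 'a set \<Rightarrow> bool"
  where "reducing_subspace T V \<longleftrightarrow>
    complex_vector.subspace V \<and> closed V \<and> T ` V \<subseteq> V \<and> cadjoint T ` V \<subseteq> V"

definition completely_nonunitary :: "('a::complex_inner \<Rightarrow> 'a) \<Rightarrow> bool"
  where "completely_nonunitary T \<longleftrightarrow>
    \<not> (\<exists>V. reducing_subspace T V \<and> V \<noteq> {0} \<and> unitary_between V V T)"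

definition char_function :: "('a::complex_inner \<Rightarrow> 'a) \<Rightarrow> complex \<Rightarrow> 'a \<Rightarrow> 'a"
  where "char_function T z x =
    - T x + z *\<^sub>C defect_op (cadjoint T) (inv (\<lambda>y. y - z *\<^sub>C cadjoint T y) (defect_op T x))"

text \<open>For unitary identifications \<open>u\<close>, \<open>v\<close> of the one-dimensional spaces \<open>defect_space T\<close>,
  \<open>defect_space (cadjoint T)\<close> with the complex numbers, the scalar function is \<open>v \<circ> \<Theta>(z) \<circ> u\<inverse>\<close>,
  a multiplication operator identified with its value at 1.\<close>

definition scalar_char_function ::
    "('a::complex_inner \<Rightarrow> 'a) \<Rightarrow> ('a \<Rightarrow> complex) \<Rightarrow> ('a \<Rightarrow> complex) \<Rightarrow> complex \<Rightarrow> complex"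
  where "scalar_char_function T u v z = v (char_function T z (inv_into (defect_space T) u 1))"


section \<open>Schur parameters\<close>

definition schur_function :: "(complex \<Rightarrow> complex) \<Rightarrow> bool"
  where "schur_function f \<longleftrightarrow> f holomorphic_on ball 0 1 \<and> f ` ball 0 1 \<subseteq> cball 0 1"

text \<open>The quotient has a removable singularity at 0, where division by zero would yield 0.\<close>

definition schur_step :: "(complex \<Rightarrow> complex) \<Rightarrow> complex \<Rightarrow> complex"
  where "schur_step f =
    (let g = (\<lambda>z. (f z - f 0) / (z * (1 - cnj (f 0) * f z)))
     in (\<lambda>z. if z = 0 then Lim (at 0) g else g z))"

definition schur_parameter :: "(complex \<Rightarrow> complex) \<Rightarrow> nat \<Rightarrow> complex"
  where "schur_parameter f n = (schur_step ^^ n) f 0"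

definition infinite_schur_parameters :: "(complex \<Rightarrow> complex) \<Rightarrow> (nat \<Rightarrow> complex) \<Rightarrow> bool"
  where "infinite_schur_parameters f \<alpha> \<longleftrightarrow>
    schur_function f \<and> (\<forall>n. \<alpha> n = schur_parameter f n \<and> cmod (\<alpha> n) < 1)"

text \<open>The algorithm stops at step \<open>N\<close>; the values of \<open>\<alpha>\<close> beyond \<open>N\<close> are irrelevant.\<close>

definition finite_schur_parameters ::
    "(complex \<Rightarrow> complex) \<Rightarrow> nat \<Rightarrow> (nat \<Rightarrow> complex) \<Rightarrow> bool"
  where "finite_schur_parameters f N \<alpha> \<longleftrightarrow>
    schur_function f \<and> (\<forall>n<N. \<alpha> n = schur_parameter f n \<and> cmod (\<alpha> n) < 1) \<and>
    \<alpha> N = schur_parameter f N \<and> cmod (\<alpha> N) = 1"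


section \<open>Truncated CMV matrices\<close>

definition cmv_rho :: "(nat \<Rightarrow> complex) \<Rightarrow> nat \<Rightarrow> complex"
  where "cmv_rho \<alpha> n = complex_of_real (sqrt (1 - (cmod (\<alpha> n))\<^sup>2))"

text \<open>Row and column indices start at 1.\<close>

definition truncated_cmv :: "(nat \<Rightarrow> complex) \<Rightarrow> nat \<Rightarrow> nat \<Rightarrow> complex"
  where "truncated_cmv \<alpha> i j =
    (if i = j then - cnj (\<alpha> i) * \<alpha> (i - 1)
     else if i = j + 1 then
       (if odd j then cnj (\<alpha> (j + 1)) * cmv_rho \<alpha> j else - \<alpha> (j - 1) * cmv_rho \<alpha> j)
     else if j = i + 1 then
       (if odd i then - \<alpha> (i - 1) * cmv_rho \<alpha> i else cnj (\<alpha> (i + 1)) * cmv_rho \<alpha> i)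
     else if i = j + 2 \<and> odd j then cmv_rho \<alpha> j * cmv_rho \<alpha> (j + 1)
     else if j = i + 2 \<and> even i then cmv_rho \<alpha> i * cmv_rho \<alpha> (i + 1)
     else 0)"

text \<open>The coordinate \<open>n\<close> of an element of \<open>ell2\<close> is the one of mathematical index \<open>n + 1\<close>.\<close>

definition cmv_operator_ell2 :: "(nat \<Rightarrow> complex) \<Rightarrow> (ell2 \<Rightarrow> ell2) \<Rightarrow> bool"
  where "cmv_operator_ell2 \<alpha> A \<longleftrightarrow> bounded_clinear A \<and>
    (\<forall>i j. cinner (A (ell2_unit j)) (ell2_unit i) = truncated_cmv \<alpha> (i + 1) (j + 1))"

text \<open>Here \<open>e\<close> enumerates the index type of the vectors as 1, 2, ..., N.\<close>

definition cmv_operator_vec ::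
    "(nat \<Rightarrow> complex) \<Rightarrow> ('n::finite \<Rightarrow> nat) \<Rightarrow> complex ^ 'n \<Rightarrow> complex ^ 'n"
  where "cmv_operator_vec \<alpha> e x = (\<chi> i j. truncated_cmv \<alpha> (e i) (e j)) *v x"

end

theory Submission
  imports Defs "HOL-Complex_Analysis.Cauchy_Integral_Formula"
begin

text \<open>
  A contraction \<open>T\<close> on \<open>H\<close> with rank one defects is the corner of a unitary operator \<open>U\<close> on
  \<open>H \<oplus> \<complex>\<close>, its Julia operator, whose other entries are multiples of unit vectors \<open>p\<close>, \<open>q\<close> spanning the defect
  spaces (\<open>rank_one_contraction_normal_form\<close>, \<open>unitary_U\<close>). The restriction of \<open>U\<close> to \<open>H\<close> is an
  isometry \<open>M\<close>, the projection onto \<open>H\<close> is a co-isometry \<open>L\<close>, and \<open>T = L M\<close>. This is the product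
  decomposition of the theorem.

  For the matrix model, consider any unitary \<open>V\<close> and unit vector \<open>e\<close>, and put \<open>a = \<langle>V\<^sup>* e, e\<rangle>\<close>. If
  \<open>\<bar>a\<bar> < 1\<close>, then \<open>V\<close> factors as \<open>V' \<Theta>\<close>, where \<open>V'\<close> fixes \<open>e\<close> and \<open>\<Theta>\<close> is a rotation in the plane spanned by
  \<open>e\<close> and a unit vector \<open>e'\<close> orthogonal to it; for another choice of \<open>e'\<close> it factors as \<open>\<Theta> V'\<close>
  (\<open>split_off_left_rotation\<close>, \<open>split_off_right_rotation\<close>). Starting with \<open>U\<close> and \<open>(0, 1)\<close> and splitting
  off rotations alternately on the left and on the right gives orthonormal vectors
  \<open>e\<^sub>0, e\<^sub>1, \<dots>\<close> and parameters \<open>\<alpha>\<^sub>0, \<alpha>\<^sub>1, \<dots>\<close> with \<open>U = (\<Theta>\<^sub>0 \<Theta>\<^sub>2 \<dots>) (\<dots> \<Theta>\<^sub>3 \<Theta>\<^sub>1)\<close> on their span, which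
  is the factorization of a CMV matrix. Its entries other than those in the first row and column are the
  matrix elements of \<open>T\<close> (\<open>matrix_entries\<close>).

  The parameters \<open>\<alpha>\<^sub>n\<close> are Schur parameters for the following reason. To a unitary operator and a unit
  vector belongs a Schur function, a quotient of matrix elements of the resolvent. For \<open>U\<close> and
  \<open>(0, 1)\<close> it is the characteristic function of \<open>T\<close> (\<open>scalar_char_function_eq\<close>), its value at 0 is the
  parameter \<open>a\<close>, and replacing \<open>(V, e)\<close> by \<open>(V', e')\<close> is one step of the Schur algorithm
  (\<open>schur_fun_rotate_left\<close>, \<open>schur_fun_rotate_right\<close>).

  Finally, the orthogonal complement of all \<open>e\<^sub>n\<close> lies in \<open>H\<close> and reduces \<open>U\<close>, so that \<open>T\<close> is unitary on
  it. Complete nonunitarity makes it trivial (\<open>h_total\<close>), and \<open>e\<^sub>1, e\<^sub>2, \<dots>\<close> is an orthonormal basis of \<open>H\<close>.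
  It is finite precisely if the Schur algorithm stops, and then the step at which it stops is the dimension
  of \<open>H\<close> (\<open>dim_eq\<close>, \<open>finite_dimensional_iff\<close>).

  The defect operators are square roots given by a definite description, whence the existence and
  uniqueness of positive square roots and of adjoints enter as well (\<open>op_sqrt_one_minus\<close>,
  \<open>adjoint_pair_cadjoint\<close>).
\<close>

section \<open>Complex inner products and adjoint pairs\<close>

instance chilbert_space \<subseteq> banach ..

lemma cinner_add_right: "cinner x (y + z) = cinner x y + cinner x z"
  by (metis cinner_add_left cinner_commute complex_cnj_add)

lemma cinner_scaleC_right: "cinner x (c *\<^sub>C y) = cnj c * cinner x y"
  by (metis cinner_scaleC_left cinner_commute complex_cnj_mult)

lemma cinner_zero_left [simp]: "cinner 0 x = 0"
  using cinner_add_left[of 0 0 x] by simp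

lemma cinner_zero_right [simp]: "cinner x 0 = 0"
  using cinner_add_right[of x 0 0] by simp

lemma cinner_uminus_left: "cinner (- x) y = - cinner x y"
  using cinner_add_left[of x "- x" y] by (simp add: eq_neg_iff_add_eq_0 add.commute)

lemma cinner_uminus_right: "cinner x (- y) = - cinner x y"
  by (metis cinner_uminus_left cinner_commute complex_cnj_minus)

lemma cinner_diff_left: "cinner (x - y) z = cinner x z - cinner y z"
  using cinner_add_left[of x "- y" z] by (simp add: cinner_uminus_left)

lemma cinner_diff_right: "cinner x (y - z) = cinner x y - cinner x z"
  using cinner_add_right[of x y "- z"] by (simp add: cinner_uminus_right)

lemma cinner_scaleR_left: "cinner (r *\<^sub>R x) y = complex_of_real r * cinner x y"
  by (metis scaleC_of_real cinner_scaleC_left)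

lemma cinner_scaleR_right: "cinner x (r *\<^sub>R y) = complex_of_real r * cinner x y"
  by (metis scaleC_of_real cinner_scaleC_right complex_cnj_complex_of_real)

lemmas cinner_simps = cinner_add_left cinner_add_right cinner_scaleC_left cinner_scaleC_right
  cinner_uminus_left cinner_uminus_right cinner_diff_left cinner_diff_right
  cinner_scaleR_left cinner_scaleR_right

lemma cinner_sum_left: "cinner (\<Sum>i\<in>A. f i) y = (\<Sum>i\<in>A. cinner (f i) y)"
  by (induction A rule: infinite_finite_induct) (auto simp: cinner_add_left)

lemma cinner_self: "cinner x x = complex_of_real ((norm x)\<^sup>2)"
proof -
  have "Im (cinner x x) = 0"
    by (metis cinner_commute cnj.simps(2) eq_neg_iff_add_eq_0 mult_2 mult_eq_0_iff zero_neq_numeral)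
  then show ?thesis
    by (simp add: complex_eq_iff Re_cinner power2_norm_eq_inner)
qed

lemma cinner_self_eq_0_iff: "cinner x x = 0 \<longleftrightarrow> x = 0"
  by (simp add: cinner_self)

lemma cinner_self_unit: "norm x = 1 \<Longrightarrow> cinner x x = 1"
  by (simp add: cinner_self)

lemma norm_scaleC [simp]: "norm (c *\<^sub>C x) = cmod c * norm x"
proof -
  have "complex_of_real ((norm (c *\<^sub>C x))\<^sup>2) = complex_of_real ((cmod c * norm x)\<^sup>2)"
    by (simp only: cinner_self[symmetric] cinner_simps power_mult_distrib of_real_mult)
      (simp add: cinner_self complex_norm_square[unfolded of_real_power])
  then have "(norm (c *\<^sub>C x))\<^sup>2 = (cmod c * norm x)\<^sup>2"
    by (simp only: of_real_eq_iff)
  then show ?thesis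
    by (simp add: power2_eq_iff_nonneg)
qed

lemma norm_diff_projection:
  assumes "norm e = 1"
  shows "(norm (x - cinner x e *\<^sub>C e))\<^sup>2 = (norm x)\<^sup>2 - (cmod (cinner x e))\<^sup>2"
proof -
  have "complex_of_real ((norm (x - cinner x e *\<^sub>C e))\<^sup>2)
      = complex_of_real ((norm x)\<^sup>2) - cinner x e * cnj (cinner x e)"
    unfolding cinner_self[symmetric] cinner_simps cinner_self_unit[OF assms]
    using cinner_commute[of e x] by simp
  also have "cinner x e * cnj (cinner x e) = complex_of_real ((cmod (cinner x e))\<^sup>2)"
    by (simp only: complex_norm_square)
  finally show ?thesis
    by (simp only: of_real_diff[symmetric] of_real_eq_iff)
qed

lemma cinner_bound: "cmod (cinner x y) \<le> norm x * norm y"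
proof (cases "y = 0")
  case False
  define e where "e = (1 / complex_of_real (norm y)) *\<^sub>C y"
  have e: "norm e = 1" and y: "y = complex_of_real (norm y) *\<^sub>C e"
    using False by (auto simp: e_def norm_divide scaleC_scaleC)
  have "0 \<le> (norm x)\<^sup>2 - (cmod (cinner x e))\<^sup>2"
    unfolding norm_diff_projection[OF e, symmetric] by simp
  then have "cmod (cinner x e) \<le> norm x"
    by (simp add: abs_le_square_iff[symmetric])
  then have "cmod (cinner x (complex_of_real (norm y) *\<^sub>C e)) \<le> norm x * norm y"
    by (simp add: cinner_simps norm_mult mult.commute[of _ "norm y"] mult_left_mono)
  then show ?thesis
    by (simp only: y[symmetric])
qed simp

lemma bounded_linear_cinner_left: "bounded_linear (\<lambda>x. cinner x y)"
  by (rule bounded_linear_intro[of _ "norm y"])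
    (auto simp: cinner_simps cinner_bound scaleR_conv_of_real)

lemma bounded_linear_scaleC: "bounded_linear (\<lambda>x. c *\<^sub>C x)"
  by (rule bounded_linear_intro[of _ "cmod c"])
    (auto simp: scaleC_add_right mult.commute scaleC_of_real[symmetric] scaleC_scaleC)

lemma cinner_extensionality:
  assumes "\<And>z. cinner x z = cinner y z"
  shows "x = y"
proof -
  have "cinner (x - y) (x - y) = 0"
    using assms[of "x - y"] by (simp add: cinner_diff_left)
  then show ?thesis
    by (simp add: cinner_self_eq_0_iff)
qed

lemma cinner_extensionality_right: "(\<And>z. cinner z x = cinner z y) \<Longrightarrow> x = y"
  by (metis cinner_commute cinner_extensionality)

text \<open>Carrying an operator together with its adjoint avoids the definite description in \<open>cadjoint\<close>
  and makes algebraic identities for adjoints provable in any complex inner product space; both members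
  of a pair are linear, because the inner product separates points.\<close>

definition adjoint_pair :: "('a::complex_inner \<Rightarrow> 'b::complex_inner) \<Rightarrow> ('b \<Rightarrow> 'a) \<Rightarrow> bool"
  where "adjoint_pair T S \<longleftrightarrow> (\<forall>x y. cinner (T x) y = cinner x (S y))"

lemma adjoint_pairD: "adjoint_pair T S \<Longrightarrow> cinner (T x) y = cinner x (S y)"
  by (simp add: adjoint_pair_def)

lemma adjoint_pair_sym: "adjoint_pair T S \<Longrightarrow> adjoint_pair S T"
  unfolding adjoint_pair_def by (intro allI) (subst (1 2) cinner_commute, simp)

lemma cadjoint_eqI:
  assumes "adjoint_pair T S"
  shows "cadjoint T = S"
  unfolding cadjoint_def
proof (rule the_equality)
  show "\<forall>x y. cinner (T x) y = cinner x (S y)"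
    using assms by (simp add: adjoint_pair_def)
  fix S' assume S': "\<forall>x y. cinner (T x) y = cinner x (S' y)"
  have "cinner z (S' y) = cinner z (S y)" for z y
    using S' assms by (simp add: adjoint_pair_def)
  then show "S' = S"
    by (intro ext) (rule cinner_extensionality_right)
qed

lemma adjoint_pair_add: "adjoint_pair T S \<Longrightarrow> T (x + y) = T x + T y"
  by (rule cinner_extensionality) (simp add: adjoint_pairD cinner_simps)

lemma adjoint_pair_scaleC: "adjoint_pair T S \<Longrightarrow> T (c *\<^sub>C x) = c *\<^sub>C T x"
  by (rule cinner_extensionality) (simp add: adjoint_pairD cinner_simps)

lemma adjoint_pair_diff: "adjoint_pair T S \<Longrightarrow> T (x - y) = T x - T y"
  by (rule cinner_extensionality) (simp add: adjoint_pairD cinner_simps)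

lemma adjoint_pair_zero: "adjoint_pair T S \<Longrightarrow> T 0 = 0"
  by (rule cinner_extensionality) (simp add: adjoint_pairD)

lemma adjoint_pair_uminus: "adjoint_pair T S \<Longrightarrow> T (- x) = - T x"
  by (rule cinner_extensionality) (simp add: adjoint_pairD cinner_simps)

lemmas adjoint_pair_linear = adjoint_pair_add adjoint_pair_scaleC adjoint_pair_diff
  adjoint_pair_zero adjoint_pair_uminus

lemma bounded_clinearI:
  assumes "\<And>x y. T (x + y) = T x + T y" "\<And>c x. T (c *\<^sub>C x) = c *\<^sub>C T x"
    and "\<And>x. norm (T x) \<le> K * norm x"
  shows "bounded_clinear T"
  unfolding bounded_clinear_def
proof (intro conjI allI assms)
  show "bounded_linear T"
  proof (rule bounded_linear_intro[of _ K])
    show "norm (T x) \<le> norm x * K" for x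
      using assms(3)[of x] by (simp add: mult.commute)
    show "T (r *\<^sub>R x) = r *\<^sub>R T x" for r x
      using assms(2)[of "complex_of_real r" x] by (simp add: scaleC_of_real)
  qed (rule assms)
qed

lemma bounded_clinear_linear:
  assumes "bounded_clinear T"
  shows "T (x + y) = T x + T y" "T (c *\<^sub>C x) = c *\<^sub>C T x" "T (x - y) = T x - T y" "T 0 = 0"
    "T (- x) = - T x" "bounded_linear T"
proof -
  interpret bounded_linear T
    using assms by (simp add: bounded_clinear_def)
  show "T (x + y) = T x + T y" "T (x - y) = T x - T y" "T 0 = 0" "T (- x) = - T x" "bounded_linear T"
    by (simp_all add: add diff zero neg bounded_linear_axioms)
  show "T (c *\<^sub>C x) = c *\<^sub>C T x"
    using assms by (simp add: bounded_clinear_def)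
qed

section \<open>Existence of adjoints\<close>

text \<open>The convex functional \<open>F x = \<parallel>x\<parallel>\<^sup>2 / 2 - \<phi> x\<close> attains its infimum, because the parallelogram law makes minimizing
  sequences Cauchy, and the vanishing of its derivative at the minimum says that the minimizer
  represents \<open>\<phi>\<close>.\<close>

lemma riesz_representation_real:
  fixes \<phi> :: "'a::chilbert_space \<Rightarrow> real"
  assumes "bounded_linear \<phi>"
  shows "\<exists>y. \<forall>x. \<phi> x = inner x y"
proof -
  interpret bounded_linear \<phi> by fact
  obtain K where K: "\<And>x. \<bar>\<phi> x\<bar> \<le> norm x * K"
    using bounded by auto
  define F where "F x = (norm x)\<^sup>2 / 2 - \<phi> x" for x
  have lower: "- (K\<^sup>2 / 2) \<le> F x" for x
  proof -
    have "\<phi> x \<le> norm x * K"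
      using K[of x] by linarith
    moreover have "0 \<le> (norm x - K)\<^sup>2"
      by simp
    ultimately show ?thesis
      by (simp add: F_def power2_diff)
  qed
  define m where "m = Inf (range F)"
  have bdd: "bdd_below (range F)"
    using lower by (intro bdd_belowI[of _ "- (K\<^sup>2 / 2)"]) auto
  have m_le: "m \<le> F x" for x
    unfolding m_def by (rule cInf_lower[OF _ bdd]) simp
  have "\<exists>x. F x < m + e" if "0 < e" for e
    using cInf_lessD[of "range F" "m + e"] that by (auto simp: m_def)
  then have "\<exists>x. \<forall>n. F (x n) < m + 1 / real (Suc n)"
    by (intro choice allI) simp
  then obtain x where x: "\<And>n. F (x n) < m + 1 / real (Suc n)"
    by blast
  have para: "(norm (a - b))\<^sup>2 = 4 * F a + 4 * F b - 8 * F ((1/2) *\<^sub>R (a + b))" for a b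
    unfolding F_def by (simp add: power2_norm_eq_inner inner_simps scaleR add inner_commute field_simps)
  have "Cauchy x"
  proof (rule metric_CauchyI)
    fix e :: real assume e: "0 < e"
    obtain N where N: "8 / e\<^sup>2 < real N"
      using reals_Archimedean2 by blast
    have small: "1 / real (Suc n) < e\<^sup>2 / 8" if "N \<le> n" for n
    proof -
      have "8 / e\<^sup>2 < real (Suc n)"
        using N that by simp
      then show ?thesis
        using e by (simp add: field_simps)
    qed
    have "dist (x j) (x k) < e" if "N \<le> j" "N \<le> k" for j k
    proof -
      have "(norm (x j - x k))\<^sup>2 < e\<^sup>2"
        using para[of "x j" "x k"] m_le[of "(1/2) *\<^sub>R (x j + x k)"] x[of j] x[of k]
          small[OF that(1)] small[OF that(2)] by linarith
      then show ?thesis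
        using e using power_less_imp_less_base[of "norm (x j - x k)" 2 e] by (simp add: dist_norm)
    qed
    then show "\<exists>M. \<forall>j\<ge>M. \<forall>k\<ge>M. dist (x j) (x k) < e"
      by blast
  qed
  then obtain y where y: "x \<longlonglongrightarrow> y"
    using Cauchy_convergent_iff convergent_def by blast
  have "(\<lambda>n. F (x n)) \<longlonglongrightarrow> F y"
    unfolding F_def by (intro tendsto_intros y tendsto) simp
  moreover have "(\<lambda>n. m + 1 / real (Suc n)) \<longlonglongrightarrow> m + 0"
    by (intro tendsto_intros lim_1_over_n[THEN LIMSEQ_Suc])
  ultimately have Fy: "F y \<le> m"
    using x by (intro LIMSEQ_le[of "\<lambda>n. F (x n)" _ "\<lambda>n. m + 1 / real (Suc n)"]) (auto intro: less_imp_le)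
  have "\<phi> h = inner h y" for h
  proof (rule ccontr)
    define s where "s = inner h y - \<phi> h"
    assume "\<phi> h \<noteq> inner h y"
    then have "s \<noteq> 0" "h \<noteq> 0"
      by (auto simp: s_def zero)
    \<comment> \<open>the step that minimizes \<open>F\<close> on the line through \<open>y\<close> in direction \<open>h\<close>\<close>
    define t where "t = - s / (norm h)\<^sup>2"
    have "(norm (y + t *\<^sub>R h))\<^sup>2 = (norm y)\<^sup>2 + 2 * t * inner h y + t\<^sup>2 * (norm h)\<^sup>2"
      by (simp only: power2_norm_eq_inner inner_simps inner_commute[of y h])
        (simp add: power2_eq_square algebra_simps)
    then have "F (y + t *\<^sub>R h) = F y + t * s + t\<^sup>2 * (norm h)\<^sup>2 / 2"
      unfolding F_def s_def by (simp add: scaleR add field_simps)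
    also have "\<dots> = F y - s\<^sup>2 / (norm h)\<^sup>2 / 2"
      using \<open>h \<noteq> 0\<close> by (simp add: t_def field_simps power2_eq_square)
    also have "\<dots> < F y"
      using \<open>s \<noteq> 0\<close> \<open>h \<noteq> 0\<close> by simp
    finally show False
      using Fy m_le[of "y + t *\<^sub>R h"] by linarith
  qed
  then show ?thesis
    by blast
qed

lemma cinner_Im: "Im (cinner x y) = - Re (cinner (\<i> *\<^sub>C x) y)"
  by (simp add: cinner_simps)

text \<open>The real representation theorem, applied to \<open>x \<mapsto> Re \<langle>T x, y\<rangle>\<close>, gives the adjoint for the real inner
  product. Complex linearity recovers the imaginary part, as \<open>Im \<langle>x, y\<rangle> = - Re \<langle>\<i> x, y\<rangle>\<close>.\<close>

theorem adjoint_pair_cadjoint: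
  fixes T :: "'a::chilbert_space \<Rightarrow> 'b::complex_inner"
  assumes T: "bounded_clinear T"
  shows "adjoint_pair T (cadjoint T)"
proof -
  have "\<exists>s. \<forall>x. inner (T x) y = inner x s" for y
    by (intro riesz_representation_real bounded_linear_compose[OF bounded_linear_inner_left]
        bounded_clinear_linear T)
  then obtain S where S: "\<And>x y. inner (T x) y = inner x (S y)"
    by metis
  have "cinner (T x) y = cinner x (S y)" for x y
    by (rule complex_eqI)
      (simp_all add: cinner_Im bounded_clinear_linear(2)[OF T, symmetric] Re_cinner S)
  then have "adjoint_pair T S"
    by (simp add: adjoint_pair_def)
  then show ?thesis
    using cadjoint_eqI by metis
qed

lemma adjoint_pair_norm_le:
  assumes TS: "adjoint_pair T S" and T: "\<And>x. norm (T x) \<le> norm x"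
  shows "norm (S y) \<le> norm y"
proof (cases "S y = 0")
  case False
  have "(norm (S y))\<^sup>2 = cmod (cinner (S y) (S y))"
    by (simp only: cinner_self norm_of_real) simp
  also have "\<dots> = cmod (cinner (T (S y)) y)"
    by (simp add: adjoint_pairD[OF TS])
  also have "\<dots> \<le> norm (T (S y)) * norm y"
    by (rule cinner_bound)
  also have "\<dots> \<le> norm (S y) * norm y"
    by (intro mult_right_mono T) simp
  finally show ?thesis
    using False by (simp add: power2_eq_square)
qed simp

section \<open>Square roots of positive operators\<close>

text \<open>These operators \<open>Y\<^sub>n\<close> approximate \<open>1 - sqrt (1 - A)\<close>: a limit satisfies \<open>Y = (A + Y\<^sup>2) / 2\<close>, that
  is, \<open>(1 - Y)\<^sup>2 = 1 - A\<close>. The numbers that follow are the same iteration for \<open>A = 1\<close>; they dominate the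
  norms for every contraction \<open>A\<close>.\<close>

primrec sqrt_approx :: "('a::complex_inner \<Rightarrow> 'a) \<Rightarrow> nat \<Rightarrow> 'a \<Rightarrow> 'a"
  where "sqrt_approx A 0 = (\<lambda>x. 0)"
  | "sqrt_approx A (Suc n) = (\<lambda>x. (1/2) *\<^sub>R (A x + sqrt_approx A n (sqrt_approx A n x)))"

primrec sqrt_bound :: "nat \<Rightarrow> real"
  where "sqrt_bound 0 = 0"
  | "sqrt_bound (Suc n) = (1 + (sqrt_bound n)\<^sup>2) / 2"

lemma sqrt_bound_range: "0 \<le> sqrt_bound n \<and> sqrt_bound n \<le> 1"
proof (induction n)
  case (Suc n)
  then have "(sqrt_bound n)\<^sup>2 \<le> 1"
    by (simp add: power_le_one)
  then show ?case
    by simp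
qed simp

lemma sqrt_bound_mono: "sqrt_bound n \<le> sqrt_bound (Suc n)"
  using zero_le_power2[of "sqrt_bound n - 1"] by (simp add: power2_diff)

lemma summable_sqrt_bound: "summable (\<lambda>n. sqrt_bound (Suc n) - sqrt_bound n)"
proof (rule telescope_summable)
  have "convergent sqrt_bound"
    by (intro Bseq_monoseq_convergent BseqI'[of _ 1] incseq_imp_monoseq incseq_SucI sqrt_bound_mono)
      (use sqrt_bound_range in auto)
  then show "sqrt_bound \<longlonglongrightarrow> lim sqrt_bound"
    by (simp add: convergent_LIMSEQ_iff)
qed

lemma adjoint_pair_sqrt_approx:
  assumes "adjoint_pair A A"
  shows "adjoint_pair (sqrt_approx A n) (sqrt_approx A n)"
proof (induction n)
  case 0
  then show ?case by (simp add: adjoint_pair_def)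
next
  case (Suc n)
  then show ?case
    using assms by (simp add: adjoint_pair_def cinner_simps)
qed

lemma sqrt_approx_commute:
  assumes A: "adjoint_pair A A" and C: "adjoint_pair C C" and CA: "\<And>x. C (A x) = A (C x)"
  shows "C (sqrt_approx A n x) = sqrt_approx A n (C x)"
proof (induction n arbitrary: x)
  case 0
  then show ?case by (simp add: adjoint_pair_zero[OF C])
next
  case (Suc n)
  then show ?case
    by (simp add: adjoint_pair_linear[OF C] CA scaleC_of_real[symmetric])
qed

lemma sqrt_approx_norm_le:
  assumes "\<And>x. norm (A x) \<le> norm x"
  shows "norm (sqrt_approx A n x) \<le> sqrt_bound n * norm x"
proof (induction n arbitrary: x)
  case (Suc n)
  have "norm (sqrt_approx A n (sqrt_approx A n x)) \<le> sqrt_bound n * norm (sqrt_approx A n x)"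
    by (rule Suc)
  also have "\<dots> \<le> sqrt_bound n * (sqrt_bound n * norm x)"
    by (intro mult_left_mono Suc) (use sqrt_bound_range in auto)
  finally have "norm (sqrt_approx A n (sqrt_approx A n x)) \<le> (sqrt_bound n)\<^sup>2 * norm x"
    by (simp add: power2_eq_square)
  then have "norm (A x + sqrt_approx A n (sqrt_approx A n x)) \<le> norm x + (sqrt_bound n)\<^sup>2 * norm x"
    by (intro norm_triangle_mono assms)
  then show ?case
    by (simp only: sqrt_approx.simps norm_scaleR sqrt_bound.simps) (simp add: algebra_simps)
qed simp

text \<open>All \<open>Y\<^sub>n\<close> commute, so that the difference of two successive squares factors as a difference times a
  sum. The scalar iteration satisfies the same recursion with equality, and its steps form a convergent
  telescoping series.\<close>

lemma sqrt_approx_step_le: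
  assumes A: "adjoint_pair A A" and le: "\<And>x. norm (A x) \<le> norm x"
  shows "norm (sqrt_approx A (Suc n) x - sqrt_approx A n x)
    \<le> (sqrt_bound (Suc n) - sqrt_bound n) * norm x"
proof (induction n arbitrary: x)
  case 0
  then show ?case using le[of x] by simp
next
  case (Suc n)
  let ?p = "sqrt_approx A (Suc n)" and ?q = "sqrt_approx A n"
  let ?s = "sqrt_bound (Suc n)" and ?t = "sqrt_bound n"
  note p = adjoint_pair_linear[OF adjoint_pair_sqrt_approx[OF A, of "Suc n"]]
  note q = adjoint_pair_linear[OF adjoint_pair_sqrt_approx[OF A, of n]]
  have "?p (A z) = A (?p z)" for z
    by (rule sqrt_approx_commute[OF A A refl, symmetric])
  then have pq: "?p (?q z) = ?q (?p z)" for z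
    by (intro sqrt_approx_commute adjoint_pair_sqrt_approx A)
  have step: "sqrt_approx A (Suc m) x
      = (1/2) *\<^sub>R (A x + sqrt_approx A m (sqrt_approx A m x))" for m
    by simp
  have "sqrt_approx A (Suc (Suc n)) x - ?p x
      = (1/2) *\<^sub>R (A x + ?p (?p x)) - (1/2) *\<^sub>R (A x + ?q (?q x))"
    by (rule arg_cong2[OF step[of "Suc n"] step[of n], of minus])
  also have "\<dots> = (1/2) *\<^sub>R (?p (?p x) - ?q (?q x))"
    by (simp only: scaleR_diff_right[symmetric] add_diff_cancel_left)
  also have "?p (?p x) - ?q (?q x) = ?p (?p x + ?q x) - ?q (?p x + ?q x)"
    by (simp only: p q pq) simp
  also have "norm ((1/2) *\<^sub>R \<dots>) \<le> ((?s - ?t) * norm (?p x + ?q x)) / 2"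
    using Suc[of "?p x + ?q x"] by simp
  also have "\<dots> \<le> ((?s - ?t) * (?s * norm x + ?t * norm x)) / 2"
    using sqrt_bound_mono[of n]
    by (intro divide_right_mono mult_left_mono norm_triangle_mono sqrt_approx_norm_le le)
      (auto simp del: sqrt_bound.simps)
  also have "\<dots> = (sqrt_bound (Suc (Suc n)) - ?s) * norm x"
  proof -
    have "sqrt_bound (Suc (Suc n)) - ?s = (1 + ?s\<^sup>2) / 2 - (1 + ?t\<^sup>2) / 2"
      by (rule arg_cong2[OF sqrt_bound.simps(2) sqrt_bound.simps(2), of minus])
    also have "\<dots> = (?s - ?t) * (?s + ?t) / 2"
      by (simp add: power2_eq_square field_simps del: sqrt_bound.simps)
    finally show ?thesis
      by (simp only:) (simp add: distrib_left algebra_simps del: sqrt_bound.simps)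
  qed
  finally show ?case .
qed

lemma sqrt_approx_LIMSEQ:
  fixes A :: "'a::chilbert_space \<Rightarrow> 'a"
  assumes "adjoint_pair A A" and "\<And>x. norm (A x) \<le> norm x"
  shows "\<exists>l. (\<lambda>n. sqrt_approx A n x) \<longlonglongrightarrow> l"
proof -
  have "summable (\<lambda>n. sqrt_approx A (Suc n) x - sqrt_approx A n x)"
    by (rule summable_comparison_test'[where N = 0 and
        g = "\<lambda>n. (sqrt_bound (Suc n) - sqrt_bound n) * norm x"])
      (intro summable_mult2 summable_sqrt_bound sqrt_approx_step_le assms)+
  from summable_LIMSEQ[OF this] show ?thesis
    unfolding sum_lessThan_telescope[of "\<lambda>n. sqrt_approx A n x"] by auto
qed

lemma positive_opD:
  assumes "positive_op P"
  shows "Im (cinner (P x) x) = 0" "0 \<le> Re (cinner (P x) x)"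
  using assms unfolding positive_op_def by (auto simp: complex_nonneg_Reals_iff)

text \<open>Polarization: the quadratic form of \<open>P\<close> is real at \<open>x + y\<close> and at \<open>x + \<i> y\<close>.\<close>

lemma positive_op_self_adjoint:
  assumes P: "positive_op P"
  shows "adjoint_pair P P"
  unfolding adjoint_pair_def
proof (intro allI)
  fix x y
  note lin = bounded_clinear_linear[of P]
  have bP: "bounded_clinear P"
    using P by (simp add: positive_op_def)
  have "Im (cinner (P x) y) + Im (cinner (P y) x) = 0"
    using positive_opD(1)[OF P, of "x + y"] positive_opD(1)[OF P, of x] positive_opD(1)[OF P, of y]
    by (simp add: lin[OF bP] cinner_simps)
  moreover have "Re (cinner (P y) x) = Re (cinner (P x) y)"
    using positive_opD(1)[OF P, of "x + \<i> *\<^sub>C y"] positive_opD(1)[OF P, of x] positive_opD(1)[OF P, of y]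
    by (simp add: lin[OF bP] cinner_simps)
  ultimately have "cinner (P x) y = cnj (cinner (P y) x)"
    by (simp add: complex_eq_iff)
  then show "cinner (P x) y = cinner x (P y)"
    by (metis cinner_commute)
qed

text \<open>Existence and uniqueness of the positive root of \<open>1 - A\<close>. The root \<open>B = 1 - Z\<close> obtained
  as a limit commutes with every bounded self-adjoint operator commuting with \<open>A\<close>, hence with every other positive root
  \<open>P\<close>. On a vector \<open>y = (B - P) x\<close> then \<open>(B + P) y = 0\<close>, so that both positive forms vanish at \<open>y\<close>,
  and \<open>\<parallel>y\<parallel>\<^sup>2 = \<langle>x, (B - P) y\<rangle> = 0\<close>.\<close>

theorem op_sqrt_one_minus:
  fixes A :: "'a::chilbert_space \<Rightarrow> 'a"
  assumes A: "adjoint_pair A A" and le: "\<And>x. norm (A x) \<le> norm x"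
  defines "B \<equiv> op_sqrt (\<lambda>x. x - A x)"
  shows "positive_op B" "B (B x) = x - A x"
proof -
  let ?Y = "sqrt_approx A"
  obtain Z where Z: "\<And>x. (\<lambda>n. ?Y n x) \<longlonglongrightarrow> Z x"
    using sqrt_approx_LIMSEQ[OF A le] by metis
  have Y_le: "norm (?Y n x) \<le> norm x" for n x
    using sqrt_approx_norm_le[OF le, of n x] sqrt_bound_range[of n]
    by (meson mult_left_le_one_le norm_ge_zero order_trans)
  have Z_le: "norm (Z x) \<le> norm x" for x
    by (rule LIMSEQ_le_const2[OF tendsto_norm[OF Z]]) (use Y_le in blast)
  note lim_cinner = bounded_linear.tendsto[OF bounded_linear_cinner_left]
  have ZZ: "adjoint_pair Z Z"
    unfolding adjoint_pair_def
  proof (intro allI)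
    fix x y
    have "(\<lambda>n. cinner (?Y n x) y) \<longlonglongrightarrow> cnj (cinner (Z y) x)"
      using tendsto_cnj[OF lim_cinner[OF Z[of y], of x]]
      by (simp add: cinner_commute[symmetric] adjoint_pairD[OF adjoint_pair_sqrt_approx[OF A]])
    then show "cinner (Z x) y = cinner x (Z y)"
      using LIMSEQ_unique[OF lim_cinner[OF Z[of x], of y]] by (metis cinner_commute)
  qed
  note Zlin = adjoint_pair_linear[OF ZZ]
  have YY: "(\<lambda>n. ?Y n (?Y n x)) \<longlonglongrightarrow> Z (Z x)" for x
  proof -
    have "(\<lambda>n. ?Y n (?Y n x - Z x)) \<longlonglongrightarrow> 0"
    proof (rule Lim_null_comparison)
      show "\<forall>\<^sub>F n in sequentially. norm (?Y n (?Y n x - Z x)) \<le> norm (?Y n x - Z x)"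
        using Y_le by simp
      show "(\<lambda>n. norm (?Y n x - Z x)) \<longlonglongrightarrow> 0"
        using LIM_zero[OF Z[of x]] by (rule tendsto_norm_zero)
    qed
    from tendsto_add[OF this Z[of "Z x"]] show ?thesis
      by (simp add: adjoint_pair_diff[OF adjoint_pair_sqrt_approx[OF A]])
  qed
  have "Z x = (1/2) *\<^sub>R (A x + Z (Z x))" for x
  proof (rule LIMSEQ_unique)
    show "(\<lambda>n. ?Y (Suc n) x) \<longlonglongrightarrow> Z x"
      using Z by (rule LIMSEQ_Suc)
    show "(\<lambda>n. ?Y (Suc n) x) \<longlonglongrightarrow> (1/2) *\<^sub>R (A x + Z (Z x))"
      unfolding sqrt_approx.simps by (intro tendsto_intros YY)
  qed
  then have Zeq: "2 *\<^sub>R Z x = A x + Z (Z x)" for x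
    by (metis (no_types) scaleR_scaleR scaleR_one mult.commute nonzero_mult_div_cancel_left
        times_divide_eq_right zero_neq_numeral mult.right_neutral)
  define R where "R x = x - Z x" for x
  have RR: "R (R x) = x - A x" for x
    using Zeq[of x] by (simp add: R_def Zlin scaleR_2 algebra_simps)
  have Rpos: "positive_op R"
    unfolding positive_op_def
  proof (intro conjI allI)
    show "bounded_clinear R"
    proof (rule bounded_clinearI)
      show "norm (R x) \<le> 2 * norm x" for x
        using norm_triangle_ineq4[of x "Z x"] Z_le[of x] by (simp add: R_def)
    qed (simp_all add: R_def Zlin complex_vector.scale_right_diff_distrib)
    fix x
    have "Im (cinner (Z x) x) = 0"
      using adjoint_pairD[OF ZZ, of x x] cinner_commute[of x "Z x"]
      by (simp add: complex_eq_iff)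
    moreover have "Re (cinner (Z x) x) \<le> (norm x)\<^sup>2"
    proof -
      have "Re (cinner (Z x) x) \<le> norm (Z x) * norm x"
        using cinner_bound[of "Z x" x] complex_Re_le_cmod order_trans by blast
      also have "\<dots> \<le> norm x * norm x"
        by (intro mult_right_mono Z_le) simp
      finally show ?thesis
        by (simp add: power2_eq_square)
    qed
    ultimately show "cinner (R x) x \<in> \<real>\<^sub>\<ge>\<^sub>0"
      by (simp add: R_def cinner_simps cinner_self complex_nonneg_Reals_iff)
  qed
  have "B = R"
    unfolding B_def op_sqrt_def
  proof (rule the_equality)
    show "positive_op R \<and> R \<circ> R = (\<lambda>x. x - A x)"
      using Rpos RR by auto
    fix P assume P: "positive_op P \<and> P \<circ> P = (\<lambda>x. x - A x)"
    then have PP: "P (P x) = x - A x" for x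
      by (metis comp_apply)
    have Padj: "adjoint_pair P P"
      using P positive_op_self_adjoint by blast
    have blP: "bounded_linear P"
      using P by (auto simp: positive_op_def intro: bounded_clinear_linear)
    note Plin = adjoint_pair_linear[OF Padj]
    have PA: "P (A x) = A (P x)" for x
      using PP[of "P x"] arg_cong[OF PP[of x], of P] by (simp add: Plin)
    have PZ: "P (Z x) = Z (P x)" for x
    proof (rule LIMSEQ_unique)
      show "(\<lambda>n. P (?Y n x)) \<longlonglongrightarrow> P (Z x)"
        by (rule bounded_linear.tendsto[OF blP Z])
      show "(\<lambda>n. P (?Y n x)) \<longlonglongrightarrow> Z (P x)"
        unfolding sqrt_approx_commute[OF A Padj PA] by (rule Z)
    qed
    have "R x = P x" for x
    proof -
      define y where "y = R x - P x"
      have sum0: "R y + P y = 0"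
        using RR[of x] PP[of x] by (simp add: y_def R_def Plin Zlin PZ)
      have "cinner (R y) y + cinner (P y) y = 0"
        unfolding cinner_add_left[symmetric] sum0 by simp
      then have "Re (cinner (R y) y) + Re (cinner (P y) y) = 0"
        by (metis plus_complex.simps(1) zero_complex.simps(1))
      then have "Re (cinner (R y) y) = 0"
        using positive_opD(2)[OF Rpos, of y] positive_opD(2)[of P y] P by linarith
      then have ZyRe: "inner (Z y) y = (norm y)\<^sup>2"
        by (simp add: R_def cinner_simps cinner_self Re_cinner)
      have "(norm (y - Z y))\<^sup>2 = (norm y)\<^sup>2 - 2 * inner (Z y) y + (norm (Z y))\<^sup>2"
        by (simp add: power2_norm_eq_inner inner_simps inner_commute)
      also have "\<dots> \<le> 0"
        using Z_le[of y] by (simp add: ZyRe)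
      finally have "R y = 0"
        by (simp add: R_def)
      then have "R y - P y = 0"
        using sum0 by simp
      moreover have "cinner y y = cinner x (R y - P y)"
        by (subst y_def) (simp add: R_def cinner_simps adjoint_pairD[OF Padj] adjoint_pairD[OF ZZ])
      ultimately show ?thesis
        by (simp add: cinner_self_eq_0_iff y_def)
    qed
    then show "P = R"
      by (intro ext) simp
  qed
  then show "positive_op B" "B (B x) = x - A x"
    using Rpos RR by auto
qed

section \<open>Resolvents of contractions\<close>

text \<open>The same inverse occurs in the characteristic function of \<open>T\<close>, for \<open>W = T\<^sup>*\<close>; \<open>inv\<close> is a two-sided
  inverse if \<open>\<bar>z\<bar> < 1\<close> and \<open>W\<close> is a contraction.\<close>

definition resolvent :: "('a::complex_inner \<Rightarrow> 'a) \<Rightarrow> complex \<Rightarrow> 'a \<Rightarrow> 'a"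
  where "resolvent W z = inv (\<lambda>y. y - z *\<^sub>C W y)"

locale linear_contraction =
  fixes W :: "'a::chilbert_space \<Rightarrow> 'a"
  assumes add: "W (x + y) = W x + W y"
    and scaleC: "W (c *\<^sub>C x) = c *\<^sub>C W x"
    and norm_le: "norm (W x) \<le> norm x"
begin

lemma clinear: "bounded_clinear W"
  by (rule bounded_clinearI[of _ 1]) (simp_all add: add scaleC norm_le)

lemma diff: "W (x - y) = W x - W y"
  by (rule bounded_clinear_linear(3)[OF clinear])

lemma power_norm_le: "norm ((W ^^ k) x) \<le> norm x"
  by (induction k) (auto intro: order_trans[OF norm_le])

lemma neumann_summable:
  assumes "cmod z < 1"
  shows "summable (\<lambda>k. z ^ k *\<^sub>C (W ^^ k) x)"
proof (rule summable_comparison_test')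
  show "summable (\<lambda>k. cmod z ^ k * norm x)"
    using assms by (intro summable_mult2 summable_geometric) simp
  show "norm (z ^ k *\<^sub>C (W ^^ k) x) \<le> cmod z ^ k * norm x" for k
    by (simp add: norm_power power_norm_le mult_left_mono)
qed

text \<open>Applying \<open>z W\<close> shifts the Neumann series by one term.\<close>

lemma neumann_series_solves:
  fixes x
  assumes z: "cmod z < 1"
  defines "y \<equiv> (\<Sum>k. z ^ k *\<^sub>C (W ^^ k) x)"
  shows "y - z *\<^sub>C W y = x"
proof -
  note s = neumann_summable[OF z, of x]
  have "bounded_linear (\<lambda>y. z *\<^sub>C W y)"
    by (intro bounded_linear_compose[OF bounded_linear_scaleC] bounded_clinear_linear(6) clinear)
  then have "z *\<^sub>C W y = (\<Sum>k. z *\<^sub>C W (z ^ k *\<^sub>C (W ^^ k) x))"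
    unfolding y_def by (rule bounded_linear.suminf[OF _ s])
  also have "\<dots> = (\<Sum>k. z ^ Suc k *\<^sub>C (W ^^ Suc k) x)"
    by (simp add: scaleC scaleC_scaleC)
  also have "\<dots> = y - x"
    using suminf_split_head[OF s] by (simp add: y_def)
  finally show ?thesis
    by simp
qed

lemma resolvent_inj:
  assumes z: "cmod z < 1" and eq: "x - z *\<^sub>C W x = y - z *\<^sub>C W y"
  shows "x = y"
proof (rule ccontr)
  assume "x \<noteq> y"
  have "x - y = z *\<^sub>C W (x - y)"
    using eq by (simp add: diff complex_vector.scale_right_diff_distrib algebra_simps)
  then have "norm (x - y) = cmod z * norm (W (x - y))"
    by (metis norm_scaleC)
  also have "\<dots> \<le> cmod z * norm (x - y)"
    by (intro mult_left_mono norm_le) simp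
  also have "\<dots> < 1 * norm (x - y)"
    using z \<open>x \<noteq> y\<close> by (intro mult_strict_right_mono) auto
  finally show False
    by simp
qed

lemma resolvent_eqI:
  assumes "cmod z < 1" "y - z *\<^sub>C W y = x"
  shows "resolvent W z x = y"
  unfolding resolvent_def using assms
  by (intro inv_f_eq injI) (auto intro: resolvent_inj)

lemma resolvent_neumann:
  "cmod z < 1 \<Longrightarrow> resolvent W z x = (\<Sum>k. z ^ k *\<^sub>C (W ^^ k) x)"
  by (intro resolvent_eqI neumann_series_solves)

lemma resolvent_solves: "cmod z < 1 \<Longrightarrow> resolvent W z x - z *\<^sub>C W (resolvent W z x) = x"
  by (simp only: resolvent_neumann neumann_series_solves)

lemma resolvent_scaleC: "cmod z < 1 \<Longrightarrow> resolvent W z (c *\<^sub>C x) = c *\<^sub>C resolvent W z x"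
proof (rule resolvent_eqI)
  assume z: "cmod z < 1"
  have "c *\<^sub>C resolvent W z x - z *\<^sub>C W (c *\<^sub>C resolvent W z x)
      = c *\<^sub>C (resolvent W z x - z *\<^sub>C W (resolvent W z x))"
    by (simp add: scaleC complex_vector.scale_right_diff_distrib scaleC_scaleC mult.commute)
  then show "c *\<^sub>C resolvent W z x - z *\<^sub>C W (c *\<^sub>C resolvent W z x) = c *\<^sub>C x"
    by (simp only: resolvent_solves[OF z])
qed

lemma cinner_resolvent_holomorphic: "(\<lambda>z. cinner (resolvent W z x) y) holomorphic_on ball 0 1"
proof (rule power_series_holomorphic)
  fix z :: complex assume "z \<in> ball 0 1"
  then have z: "cmod z < 1"
    by simp
  have "(\<lambda>k. cinner (z ^ k *\<^sub>C (W ^^ k) x) y) sums cinner (resolvent W z x) y"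
    unfolding resolvent_neumann[OF z]
    by (intro bounded_linear.sums[OF bounded_linear_cinner_left] summable_sums neumann_summable z)
  then show "(\<lambda>k. cinner ((W ^^ k) x) y * (z - 0) ^ k) sums cinner (resolvent W z x) y"
    by (simp add: cinner_simps mult.commute)
qed

end

section \<open>Unitary operators and two-dimensional rotations\<close>

definition unitary_pair :: "('a::complex_inner \<Rightarrow> 'a) \<Rightarrow> ('a \<Rightarrow> 'a) \<Rightarrow> bool"
  where "unitary_pair V W \<longleftrightarrow> adjoint_pair V W \<and> (\<forall>x. V (W x) = x) \<and> (\<forall>x. W (V x) = x)"

lemma unitary_pairD:
  assumes "unitary_pair V W"
  shows "adjoint_pair V W" "adjoint_pair W V" "V (W x) = x" "W (V x) = x"
  using assms adjoint_pair_sym unfolding unitary_pair_def by blast+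

lemma unitary_pair_sym: "unitary_pair V W \<Longrightarrow> unitary_pair W V"
  unfolding unitary_pair_def using adjoint_pair_sym by blast

lemma unitary_pair_cinner: "unitary_pair V W \<Longrightarrow> cinner (V x) (V y) = cinner x y"
  by (simp add: adjoint_pairD[OF unitary_pairD(1)] unitary_pairD(4))

lemma unitary_pair_norm: "unitary_pair V W \<Longrightarrow> norm (V x) = norm x"
  using unitary_pair_cinner[of V W x x]
  by (simp add: cinner_self of_real_power[symmetric] del: of_real_power)

lemma unitary_pair_fixed: "unitary_pair V W \<Longrightarrow> V x = x \<Longrightarrow> W x = x"
  by (metis unitary_pairD(4))

lemma unitary_pair_compose:
  assumes "unitary_pair V W" "unitary_pair V' W'"
  shows "unitary_pair (\<lambda>x. V (V' x)) (\<lambda>x. W' (W x))"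
  using assms by (simp add: unitary_pair_def adjoint_pair_def)

lemma unitary_pair_linear_contraction:
  fixes V :: "'a::chilbert_space \<Rightarrow> 'a"
  assumes "unitary_pair V W"
  shows "linear_contraction V"
  by standard (simp_all add: unitary_pair_norm[OF assms] adjoint_pair_linear[OF unitary_pairD(1)[OF assms]])

definition schur_rho :: "complex \<Rightarrow> complex"
  where "schur_rho a = complex_of_real (sqrt (1 - (cmod a)\<^sup>2))"

lemma cmv_rho_eq: "cmv_rho \<alpha> n = schur_rho (\<alpha> n)"
  by (simp add: cmv_rho_def schur_rho_def)

lemma cnj_schur_rho [simp]: "cnj (schur_rho a) = schur_rho a"
  by (simp add: schur_rho_def)

lemma schur_rho_cnj [simp]: "schur_rho (cnj a) = schur_rho a"
  by (simp add: schur_rho_def)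

lemma schur_rho_squared:
  assumes "cmod a \<le> 1"
  shows "schur_rho a * schur_rho a = 1 - a * cnj a"
proof -
  have "(cmod a)\<^sup>2 \<le> 1"
    using assms by (simp add: power_le_one)
  then have "schur_rho a * schur_rho a = complex_of_real (1 - (cmod a)\<^sup>2)"
    by (simp add: schur_rho_def of_real_mult[symmetric] del: of_real_mult)
  then show ?thesis
    by (simp add: complex_norm_square[unfolded of_real_power])
qed

lemma schur_rho_eq_0_iff: "cmod a \<le> 1 \<Longrightarrow> schur_rho a = 0 \<longleftrightarrow> cmod a = 1"
  by (simp add: schur_rho_def power2_eq_1_iff) (smt (verit) norm_ge_zero)

text \<open>On the span of an orthonormal pair \<open>e\<close>, \<open>e'\<close> this is the two-dimensional unitary block of the
  theory of CMV matrices, with rows \<open>cnj a\<close>, \<open>\<rho>\<close> and \<open>\<rho>\<close>, \<open>- a\<close>; on the orthogonal complement of the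
  pair it is the identity.\<close>

definition schur_rotation :: "complex \<Rightarrow> 'a::complex_inner \<Rightarrow> 'a \<Rightarrow> 'a \<Rightarrow> 'a"
  where "schur_rotation a e e' x =
    x + (cinner x e * (cnj a - 1) + cinner x e' * schur_rho a) *\<^sub>C e
      + (cinner x e * schur_rho a - cinner x e' * (1 + a)) *\<^sub>C e'"

text \<open>The last two alternatives extend the notion past the end of a terminating Schur algorithm: a
  parameter of modulus one has no successor vector, and from then on all vectors are zero. The rotation
  remains unitary in these cases, so that a chain is an infinite sequence whether or not the algorithm
  stops.\<close>

definition coupled :: "complex \<Rightarrow> 'a::complex_inner \<Rightarrow> 'a \<Rightarrow> bool"
  where "coupled a e e' \<longleftrightarrow> cinner e e' = 0 \<and>
    (cmod a < 1 \<and> norm e = 1 \<and> norm e' = 1 \<or> cmod a = 1 \<and> norm e = 1 \<and> e' = 0 \<or>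
     a = 0 \<and> e = 0 \<and> e' = 0)"

lemma coupled_cnj: "coupled (cnj a) e e' \<longleftrightarrow> coupled a e e'"
  by (simp add: coupled_def)

lemma coupled_le: "coupled a e e' \<Longrightarrow> cmod a \<le> 1"
  by (auto simp: coupled_def)

lemma coupled_orthogonal: "coupled a e e' \<Longrightarrow> cinner e e' = 0 \<and> cinner e' e = 0"
  unfolding coupled_def by (metis cinner_commute complex_cnj_zero)

text \<open>The block is a symmetric matrix, whence conjugating the parameter gives the adjoint.\<close>

lemma schur_rotation_adjoint:
  "adjoint_pair (schur_rotation a e e') (schur_rotation (cnj a) e e')"
  unfolding adjoint_pair_def schur_rotation_def
  by (simp add: cinner_simps cinner_commute[symmetric] algebra_simps)

lemma schur_rotation_first:
  assumes "coupled a e e'"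
  shows "schur_rotation a e e' e = schur_rho a *\<^sub>C e' + cnj a *\<^sub>C e"
proof -
  have "cinner e e = 1 \<or> e = 0 \<and> e' = 0"
    using assms by (auto simp: coupled_def cinner_self)
  then show ?thesis
    using coupled_orthogonal[OF assms]
    by (auto simp: schur_rotation_def complex_vector.scale_left_diff_distrib)
qed

lemma schur_rotation_second:
  assumes "coupled a e e'"
  shows "schur_rotation a e e' e' = schur_rho a *\<^sub>C e - a *\<^sub>C e'"
proof -
  have "cinner e' e' = 1 \<or> e' = 0 \<and> schur_rho a *\<^sub>C e = 0"
    using assms by (auto simp: coupled_def cinner_self schur_rho_def)
  then show ?thesis
    using coupled_orthogonal[OF assms]
    by (auto simp: schur_rotation_def complex_vector.scale_left_diff_distrib scaleC_add_left)
qed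

lemma schur_rotation_orthogonal:
  "cinner x e = 0 \<Longrightarrow> cinner x e' = 0 \<Longrightarrow> schur_rotation a e e' x = x"
  by (simp add: schur_rotation_def)

lemma schur_rotation_inverse:
  assumes c: "coupled a e e'"
  shows "schur_rotation (cnj a) e e' (schur_rotation a e e' x) = x"
proof -
  let ?R = "schur_rotation (cnj a) e e'" and ?r = "schur_rho a"
  have c': "coupled (cnj a) e e'"
    using c by (simp add: coupled_cnj)
  note lin = adjoint_pair_linear[OF schur_rotation_adjoint, of "cnj a" e e']
  have r2: "?r * ?r = 1 - a * cnj a"
    by (rule schur_rho_squared[OF coupled_le[OF c]])
  let ?A = "cinner x e * (cnj a - 1) + cinner x e' * ?r"
  let ?B = "cinner x e * ?r - cinner x e' * (1 + a)"
  have "?R (schur_rotation a e e' x) = ?R x + ?A *\<^sub>C ?R e + ?B *\<^sub>C ?R e'"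
    unfolding schur_rotation_def[of a] by (simp only: lin)
  also have "\<dots> = x + (cinner x e * (a - 1) + cinner x e' * ?r + ?A * a + ?B * ?r) *\<^sub>C e
      + (cinner x e * ?r - cinner x e' * (1 + cnj a) + ?A * ?r - ?B * cnj a) *\<^sub>C e'"
    unfolding schur_rotation_first[OF c'] schur_rotation_second[OF c']
    unfolding schur_rotation_def[of "cnj a" e e' x]
    by (simp add: scaleC_add_left scaleC_add_right scaleC_scaleC complex_vector.scale_left_diff_distrib
        complex_vector.scale_right_diff_distrib)
  also have "cinner x e * (a - 1) + cinner x e' * ?r + ?A * a + ?B * ?r
      = cinner x e * (a * cnj a + ?r * ?r - 1)"
    by (simp add: algebra_simps)
  also have "cinner x e * ?r - cinner x e' * (1 + cnj a) + ?A * ?r - ?B * cnj a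
      = cinner x e' * (a * cnj a + ?r * ?r - 1)"
    by (simp add: algebra_simps)
  finally show ?thesis
    by (simp add: r2)
qed

lemma schur_rotation_unitary:
  assumes "coupled a e e'"
  shows "unitary_pair (schur_rotation a e e') (schur_rotation (cnj a) e e')"
  unfolding unitary_pair_def
  using schur_rotation_adjoint schur_rotation_inverse[OF assms]
    schur_rotation_inverse[of "cnj a" e e'] assms
  by (auto simp: coupled_cnj)

text \<open>The vector \<open>V e\<close> has component \<open>cnj a\<close> along \<open>e\<close>, hence a component of length \<open>\<rho>\<close> orthogonal to it,
  whose direction is taken as \<open>e'\<close> unless \<open>\<rho> = 0\<close>. Then the rotation takes \<open>e\<close> to \<open>V e\<close>, and removing it from \<open>V\<close>
  leaves an operator that fixes \<open>e\<close>.\<close>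

lemma split_off_left_rotation:
  assumes V: "unitary_pair V W" and e: "norm e = 1 \<or> e = 0"
  defines "a \<equiv> cinner (W e) e"
  shows "\<exists>V' W' e'. unitary_pair V' W' \<and> coupled a e e' \<and> V' e = e \<and>
    (\<forall>x. V x = schur_rotation a e e' (V' x))"
proof -
  obtain e' where c: "coupled a e e'" and Ve: "V e = schur_rho a *\<^sub>C e' + cnj a *\<^sub>C e"
  proof (cases "e = 0")
    case True
    then show ?thesis
      by (intro that[of 0]) (simp_all add: coupled_def a_def adjoint_pair_zero[OF unitary_pairD(1)[OF V]])
  next
    case False
    then have e1: "norm e = 1"
      using e by simp
    have Vee: "cinner (V e) e = cnj a"
      unfolding a_def by (metis adjoint_pairD unitary_pairD(1)[OF V] cinner_commute)
    define d where "d = V e - cnj a *\<^sub>C e"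
    have dn: "(norm d)\<^sup>2 = 1 - (cmod a)\<^sup>2"
      using norm_diff_projection[OF e1, of "V e"]
      by (simp add: Vee d_def unitary_pair_norm[OF V] e1)
    have a1: "cmod a \<le> 1"
      using cinner_bound[of "W e" e] unitary_pair_norm[OF unitary_pair_sym[OF V], of e] e1
      by (simp add: a_def)
    have de: "cinner d e = 0"
      by (simp add: d_def cinner_simps Vee cinner_self_unit[OF e1])
    show ?thesis
    proof (cases "cmod a = 1")
      case True
      then have "d = 0" "schur_rho a = 0"
        using dn by (simp_all add: schur_rho_def)
      then show ?thesis
        using True e1 by (intro that[of 0]) (simp_all add: coupled_def d_def)
    next
      case False
      then have lt: "cmod a < 1" and r0: "schur_rho a \<noteq> 0"
        using a1 schur_rho_eq_0_iff by auto
      have "sqrt (1 - (cmod a)\<^sup>2) = norm d"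
        using dn by (metis norm_ge_zero real_sqrt_unique)
      then have r: "schur_rho a = complex_of_real (norm d)"
        by (simp add: schur_rho_def)
      define e' where "e' = (1 / schur_rho a) *\<^sub>C d"
      have "norm e' = 1"
        using r0 unfolding e'_def r by (simp add: norm_divide)
      moreover have "cinner e e' = 0"
        using de cinner_commute[of e d] by (simp add: e'_def cinner_simps)
      moreover have "schur_rho a *\<^sub>C e' = d"
        using r0 by (simp add: e'_def scaleC_scaleC)
      ultimately show ?thesis
        using lt e1 by (intro that[of e']) (simp_all add: coupled_def d_def)
    qed
  qed
  let ?V' = "\<lambda>x. schur_rotation (cnj a) e e' (V x)"
  have R: "unitary_pair (schur_rotation a e e') (schur_rotation (cnj a) e e')"
    by (rule schur_rotation_unitary[OF c])
  have "?V' e = e"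
    unfolding Ve schur_rotation_first[OF c, symmetric] by (rule unitary_pairD(4)[OF R])
  then show ?thesis
    using unitary_pair_compose[OF unitary_pair_sym[OF R] V] c unitary_pairD(3)[OF R] by metis
qed

text \<open>This is the preceding factorization for the inverse of \<open>V\<close>; the parameter of the inverse is the
  conjugate one.\<close>

lemma split_off_right_rotation:
  assumes V: "unitary_pair V W" and e: "norm e = 1 \<or> e = 0"
  defines "a \<equiv> cinner (W e) e"
  shows "\<exists>V' W' e'. unitary_pair V' W' \<and> coupled a e e' \<and> V' e = e \<and>
    (\<forall>x. V x = V' (schur_rotation a e e' x))"
proof -
  have "cinner (V e) e = cnj a"
    unfolding a_def by (metis adjoint_pairD unitary_pairD(1)[OF V] cinner_commute)
  then obtain V' W' e' where V': "unitary_pair V' W'" and c: "coupled a e e'" and fx: "V' e = e"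
    and W: "\<And>x. W x = schur_rotation (cnj a) e e' (V' x)"
    using split_off_left_rotation[OF unitary_pair_sym[OF V] e] by (auto simp: coupled_cnj)
  have "V x = W' (schur_rotation a e e' x)" for x
    using W[of "W' (schur_rotation a e e' x)"]
    by (simp add: unitary_pairD(3)[OF V'] schur_rotation_inverse[OF c]) (metis unitary_pairD(3)[OF V])
  then show ?thesis
    using unitary_pair_sym[OF V'] unitary_pair_fixed[OF V' fx] c by blast
qed

section \<open>The Schur function of a unitary operator at a unit vector\<close>

text \<open>With \<open>G(z) = \<langle>(1 - z W)\<^sup>-\<^sup>1 e, e\<rangle>\<close> this is \<open>(G(z) - 1) / (z G(z))\<close>, written without the division by
  \<open>z\<close>; for a unitary \<open>W\<close> it is the Schur function of the spectral measure of \<open>W\<^sup>-\<^sup>1\<close> at \<open>e\<close>.\<close>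

definition schur_fun :: "('a::complex_inner \<Rightarrow> 'a) \<Rightarrow> 'a \<Rightarrow> complex \<Rightarrow> complex"
  where "schur_fun W e z = cinner (W (resolvent W z e)) e / cinner (resolvent W z e) e"

text \<open>The defining quotient is homogeneous, and by uniqueness every \<open>x\<close> of this kind is a multiple of
  the resolvent vector.\<close>

lemma (in linear_contraction) schur_fun_eqI:
  assumes z: "cmod z < 1" and x: "x - z *\<^sub>C W x = c *\<^sub>C e" and xe: "cinner x e \<noteq> 0"
  shows "schur_fun W e z = cinner (W x) e / cinner x e"
proof -
  have "x = c *\<^sub>C resolvent W z e"
    using resolvent_eqI[OF z x] resolvent_scaleC[OF z] by simp
  moreover from this have "c \<noteq> 0"
    using xe by auto
  ultimately show ?thesis
    by (simp add: schur_fun_def scaleC cinner_simps)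
qed

context
  fixes V W :: "'a::chilbert_space \<Rightarrow> 'a" and e :: 'a and z :: complex
  assumes V: "unitary_pair V W" and e: "norm e = 1" and z: "cmod z < 1"
begin

interpretation linear_contraction W
  by (rule unitary_pair_linear_contraction[OF unitary_pair_sym[OF V]])

text \<open>Write \<open>y\<close> for the resolvent vector. Since \<open>y = e + z W y\<close>, the component of \<open>y\<close>
  orthogonal to \<open>e\<close> is at most as long as that of \<open>W y\<close>, while \<open>\<parallel>W y\<parallel> = \<parallel>y\<parallel>\<close>; the components
  along \<open>e\<close> compare the other way.\<close>

lemma resolvent_component_le:
  "cmod (cinner (W (resolvent W z e)) e) \<le> cmod (cinner (resolvent W z e) e)"
proof -
  define y where "y = resolvent W z e"
  have y: "y = e + z *\<^sub>C W y"
    using resolvent_solves[OF z, of e] unfolding y_def by (metis diff_add_cancel)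
  have ye: "cinner y e = 1 + z * cinner (W y) e"
    using arg_cong[OF y, of "\<lambda>x. cinner x e"] by (simp add: cinner_simps cinner_self_unit[OF e])
  have "y - cinner y e *\<^sub>C e = z *\<^sub>C (W y - cinner (W y) e *\<^sub>C e)"
    unfolding ye by (subst (1) y)
      (simp add: scaleC_add_left scaleC_scaleC complex_vector.scale_right_diff_distrib)
  then have "norm (y - cinner y e *\<^sub>C e) = cmod z * norm (W y - cinner (W y) e *\<^sub>C e)"
    by simp
  also have "\<dots> \<le> norm (W y - cinner (W y) e *\<^sub>C e)"
    using z by (intro mult_left_le_one_le) auto
  finally have "(norm (y - cinner y e *\<^sub>C e))\<^sup>2 \<le> (norm (W y - cinner (W y) e *\<^sub>C e))\<^sup>2"
    by (intro power_mono) auto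
  then have "(cmod (cinner (W y) e))\<^sup>2 \<le> (cmod (cinner y e))\<^sup>2"
    unfolding norm_diff_projection[OF e] unitary_pair_norm[OF unitary_pair_sym[OF V]] by simp
  then show ?thesis
    unfolding y_def by (simp add: abs_le_square_iff[symmetric])
qed

lemma resolvent_component_nonzero: "cinner (resolvent W z e) e \<noteq> 0"
proof
  assume "cinner (resolvent W z e) e = 0"
  moreover from this have "cinner (W (resolvent W z e)) e = 0"
    using resolvent_component_le by simp
  ultimately have "cinner (resolvent W z e - z *\<^sub>C W (resolvent W z e)) e = 0"
    by (simp add: cinner_simps)
  then show False
    unfolding resolvent_solves[OF z] by (simp add: cinner_self_unit[OF e])
qed

lemma schur_fun_bound: "cmod (schur_fun W e z) \<le> 1"
  using resolvent_component_le resolvent_component_nonzero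
  by (simp add: schur_fun_def norm_divide divide_le_eq_1)

end

text \<open>Moving \<open>W\<close> to the other side of the inner product turns numerator and denominator into matrix
  elements of the resolvent, which are power series.\<close>

lemma schur_function_schur_fun:
  fixes V :: "'a::chilbert_space \<Rightarrow> 'a"
  assumes V: "unitary_pair V W" and e: "norm e = 1"
  shows "schur_function (schur_fun W e)"
  unfolding schur_function_def
proof
  interpret linear_contraction W
    by (rule unitary_pair_linear_contraction[OF unitary_pair_sym[OF V]])
  have "(\<lambda>z. cinner (resolvent W z e) (V e) / cinner (resolvent W z e) e) holomorphic_on ball 0 1"
    by (intro holomorphic_intros cinner_resolvent_holomorphic)
      (simp add: resolvent_component_nonzero[OF V e])
  then show "schur_fun W e holomorphic_on ball 0 1"
    unfolding schur_fun_def by (simp add: adjoint_pairD[OF unitary_pairD(2)[OF V]])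
  show "schur_fun W e ` ball 0 1 \<subseteq> cball 0 1"
    using schur_fun_bound[OF V e] by auto
qed

lemma schur_fun_0:
  fixes V :: "'a::chilbert_space \<Rightarrow> 'a"
  assumes V: "unitary_pair V W" and e: "norm e = 1"
  shows "schur_fun W e 0 = cinner (W e) e"
proof -
  interpret linear_contraction W
    by (rule unitary_pair_linear_contraction[OF unitary_pair_sym[OF V]])
  have "resolvent W 0 e = e"
    by (rule resolvent_eqI) simp_all
  then show ?thesis
    by (simp add: schur_fun_def cinner_self_unit[OF e])
qed

text \<open>This is the inverse Schur step on the level of operators. If \<open>y\<close> is the resolvent vector of \<open>W'\<close> at
  \<open>e'\<close>, a suitable combination of \<open>e\<close> and \<open>y\<close> solves the resolvent equation of the rotated operator at
  \<open>e\<close> up to a factor, which does not change the quotient that defines the Schur function.\<close>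

lemma schur_fun_rotate_left:
  fixes V' :: "'a::chilbert_space \<Rightarrow> 'a"
  assumes V': "unitary_pair V' W'" and fx: "V' e = e" and c: "coupled a e e'"
    and a: "cmod a < 1" and e: "norm e = 1" and z: "cmod z < 1"
  defines "g \<equiv> schur_fun W' e' z"
  shows "schur_fun (\<lambda>x. schur_rotation (cnj a) e e' (W' x)) e z
    = (a + z * g) / (1 + cnj a * (z * g))"
proof -
  have e': "norm e' = 1"
    using c a e by (auto simp: coupled_def)
  have c': "coupled (cnj a) e e'"
    using c by (simp add: coupled_cnj)
  interpret W': linear_contraction W'
    by (rule unitary_pair_linear_contraction[OF unitary_pair_sym[OF V']])
  let ?R = "schur_rotation (cnj a) e e'" and ?r = "schur_rho a"
  note R = schur_rotation_unitary[OF c]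
  note lin = adjoint_pair_linear[OF schur_rotation_adjoint, of "cnj a" e e']
  interpret W: linear_contraction "\<lambda>x. ?R (W' x)"
    by (rule unitary_pair_linear_contraction[OF unitary_pair_compose[OF unitary_pair_sym[OF R] unitary_pair_sym[OF V']]])
  define y where "y = resolvent W' z e'"
  define \<omega> where "\<omega> = cinner (W' y) e'"
  define \<eta> where "\<eta> = cinner y e'"
  have y: "y - z *\<^sub>C W' y = e'"
    unfolding y_def by (rule W'.resolvent_solves[OF z])
  have \<eta>: "\<eta> = 1 + z * \<omega>"
    using arg_cong[OF y, of "\<lambda>x. cinner x e'"]
    by (simp add: \<eta>_def \<omega>_def cinner_simps cinner_self_unit[OF e'] algebra_simps)
  have \<eta>0: "\<eta> \<noteq> 0" and le: "cmod \<omega> \<le> cmod \<eta>"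
    unfolding \<eta>_def \<omega>_def y_def
    by (rule resolvent_component_nonzero[OF V' e' z], rule resolvent_component_le[OF V' e' z])
  have W'e: "W' e = e"
    by (rule unitary_pair_fixed[OF V' fx])
  have W'ye: "cinner (W' y) e = cinner y e"
    by (metis adjoint_pairD[OF unitary_pairD(2)[OF V']] fx)
  have "(1 - z) * cinner y e = 0"
    using arg_cong[OF y, of "\<lambda>x. cinner x e"] coupled_orthogonal[OF c]
    by (simp add: cinner_simps W'ye algebra_simps)
  then have ye: "cinner y e = 0"
    using z by auto
  \<comment> \<open>With this \<open>b\<close> the component of the equation along \<open>e'\<close> vanishes for \<open>x = b e + z \<rho> y\<close>.\<close>
  define b where "b = \<eta> + cnj a * z * \<omega>"
  have b0: "b \<noteq> 0"
  proof
    assume "b = 0"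
    then have "cmod \<eta> = cmod (cnj a * z * \<omega>)"
      unfolding b_def by (metis add_eq_0_iff norm_minus_cancel)
    also have "\<dots> = cmod a * (cmod z * cmod \<omega>)"
      by (simp add: norm_mult)
    also have "\<dots> \<le> cmod a * (1 * cmod \<eta>)"
      using z le by (intro mult_left_mono mult_mono) auto
    also have "\<dots> < 1 * cmod \<eta>"
      using a \<eta>0 by simp
    finally show False
      by simp
  qed
  define x where "x = b *\<^sub>C e + (z * ?r) *\<^sub>C y"
  have r2: "?r * ?r = 1 - a * cnj a"
    using a by (intro schur_rho_squared) simp
  have RW'y: "?R (W' y) = W' y + (\<omega> * ?r) *\<^sub>C e - (\<omega> * (1 + cnj a)) *\<^sub>C e'"
    unfolding schur_rotation_def W'ye ye
    by (simp add: \<omega>_def complex_vector.scale_left_diff_distrib)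
  have Wx: "?R (W' x) = (b * a + z * ?r * \<omega> * ?r) *\<^sub>C e + (z * ?r) *\<^sub>C W' y
      + (b * ?r - z * ?r * \<omega> * (1 + cnj a)) *\<^sub>C e'"
  proof -
    have "?R (W' x) = b *\<^sub>C ?R e + (z * ?r) *\<^sub>C ?R (W' y)"
      by (simp add: x_def W'.add W'.scaleC W'e lin)
    then show ?thesis
      unfolding schur_rotation_first[OF c'] RW'y
      by (simp add: scaleC_add_right scaleC_add_left scaleC_scaleC complex_vector.scale_left_diff_distrib
          complex_vector.scale_right_diff_distrib algebra_simps)
  qed
  have "x - z *\<^sub>C ?R (W' x) = (b - z * (b * a + z * ?r * \<omega> * ?r)) *\<^sub>C e
      + (z * ?r) *\<^sub>C (y - z *\<^sub>C W' y) - (z * (b * ?r - z * ?r * \<omega> * (1 + cnj a))) *\<^sub>C e'"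
    unfolding Wx unfolding x_def
    by (simp add: scaleC_add_right scaleC_add_left scaleC_scaleC complex_vector.scale_left_diff_distrib
          complex_vector.scale_right_diff_distrib algebra_simps)
  also have "\<dots> = (b - z * (b * a + z * ?r * \<omega> * ?r)) *\<^sub>C e
      + (z * ?r - z * (b * ?r - z * ?r * \<omega> * (1 + cnj a))) *\<^sub>C e'"
    unfolding y by (simp add: complex_vector.scale_left_diff_distrib)
  also have "z * ?r - z * (b * ?r - z * ?r * \<omega> * (1 + cnj a)) = 0"
    by (simp add: b_def \<eta> algebra_simps)
  finally have eq: "x - z *\<^sub>C ?R (W' x) = (b - z * (b * a + z * ?r * \<omega> * ?r)) *\<^sub>C e"
    by simp
  have xe: "cinner x e = b"
    by (simp add: x_def cinner_simps ye cinner_self_unit[OF e])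
  have Wxe: "cinner (?R (W' x)) e = b * a + z * ?r * \<omega> * ?r"
    using coupled_orthogonal[OF c] by (simp add: Wx cinner_simps W'ye ye cinner_self_unit[OF e])
  have "schur_fun (\<lambda>x. ?R (W' x)) e z = (b * a + z * \<omega> * (?r * ?r)) / b"
    using W.schur_fun_eqI[OF z eq] b0 unfolding xe Wxe by (simp add: mult_ac)
  also have "\<dots> = (a * \<eta> + z * \<omega>) / (\<eta> + cnj a * z * \<omega>)"
    unfolding r2 by (simp add: b_def algebra_simps)
  also have "\<dots> = (a + z * g) / (1 + cnj a * (z * g))"
  proof -
    have "\<omega> = g * \<eta>"
      using \<eta>0 by (simp add: g_def schur_fun_def \<omega>_def \<eta>_def y_def)
    then have "(a * \<eta> + z * \<omega>) / (\<eta> + cnj a * z * \<omega>)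
        = ((a + z * g) * \<eta>) / ((1 + cnj a * (z * g)) * \<eta>)"
      by (simp add: algebra_simps)
    then show ?thesis
      using \<eta>0 by simp
  qed
  finally show ?thesis .
qed

text \<open>Since \<open>W'\<close> fixes \<open>e\<close>, conjugation by \<open>W'\<close> exchanges the two orders of the factors
  without changing the Schur function at \<open>e\<close>.\<close>

lemma schur_fun_rotate_right:
  fixes V' :: "'a::chilbert_space \<Rightarrow> 'a"
  assumes V': "unitary_pair V' W'" and fx: "V' e = e" and c: "coupled a e e'"
    and e: "norm e = 1" and z: "cmod z < 1"
  shows "schur_fun (\<lambda>x. W' (schur_rotation (cnj a) e e' x)) e z
    = schur_fun (\<lambda>x. schur_rotation (cnj a) e e' (W' x)) e z"
proof -
  let ?R = "schur_rotation (cnj a) e e'"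
  note R = unitary_pair_sym[OF schur_rotation_unitary[OF c]]
  note W' = unitary_pair_sym[OF V']
  note RW' = unitary_pair_compose[OF R W'] and W'R = unitary_pair_compose[OF W' R]
  interpret RW': linear_contraction "\<lambda>x. ?R (W' x)"
    by (rule unitary_pair_linear_contraction[OF RW'])
  interpret W'R: linear_contraction "\<lambda>x. W' (?R x)"
    by (rule unitary_pair_linear_contraction[OF W'R])
  note lin = adjoint_pair_linear[OF unitary_pairD(1)[OF W']]
  have to_e: "cinner (W' x) e = cinner x e" for x
    by (metis adjoint_pairD[OF unitary_pairD(1)[OF W']] fx)
  define y where "y = resolvent (\<lambda>x. ?R (W' x)) z e"
  have "W' y - z *\<^sub>C W' (?R (W' y)) = W' (y - z *\<^sub>C ?R (W' y))"
    by (simp add: lin)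
  also have "\<dots> = e"
    unfolding y_def RW'.resolvent_solves[OF z] by (rule unitary_pair_fixed[OF V' fx])
  finally have "W' y - z *\<^sub>C W' (?R (W' y)) = 1 *\<^sub>C e"
    by simp
  moreover have "cinner (W' y) e \<noteq> 0"
    unfolding to_e y_def by (rule resolvent_component_nonzero[OF unitary_pair_sym[OF RW'] e z])
  ultimately have "schur_fun (\<lambda>x. W' (?R x)) e z = cinner (W' (?R (W' y))) e / cinner (W' y) e"
    by (rule W'R.schur_fun_eqI[OF z])
  then show ?thesis
    unfolding to_e by (simp add: schur_fun_def y_def)
qed

text \<open>Solving the fractional linear relation for \<open>g\<close> gives the quotient in the Schur algorithm away from
  0. At 0 the value is a limit there, which continuity of \<open>g\<close> identifies.\<close>

lemma schur_step_eq:
  assumes F: "\<And>z. cmod z < 1 \<Longrightarrow> F z = (a + z * g z) / (1 + cnj a * (z * g z))"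
    and g: "schur_function g" and a: "cmod a < 1" and z: "cmod z < 1"
  shows "schur_step F z = g z"
proof -
  define q where "q = (\<lambda>z. (F z - F 0) / (z * (1 - cnj (F 0) * F z)))"
  have F0: "F 0 = a"
    using F[of 0] by simp
  have bound: "cmod (g w) \<le> 1" if "cmod w < 1" for w
    using g that by (auto simp: schur_function_def image_subset_iff)
  have q: "q w = g w" if w: "cmod w < 1" "w \<noteq> 0" for w
  proof -
    have small: "cmod (cnj a * (w * g w)) < 1"
    proof -
      have "cmod w * cmod (g w) \<le> 1 * 1"
        using w bound[OF w(1)] by (intro mult_mono) auto
      then have "cmod a * (cmod w * cmod (g w)) \<le> cmod a * 1"
        by (intro mult_left_mono) auto
      then show ?thesis
        using a by (simp add: norm_mult)
    qed
    define D where "D = 1 + cnj a * (w * g w)"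
    have D: "D \<noteq> 0"
    proof
      assume "D = 0"
      then have "cnj a * (w * g w) = - 1"
        unfolding D_def by (simp add: add_eq_0_iff)
      then show False
        using small by simp
    qed
    have a0: "1 - cnj a * a \<noteq> 0"
    proof
      assume "1 - cnj a * a = 0"
      then have "cmod (cnj a * a) = 1"
        by simp
      then have "cmod a * cmod a = 1"
        by (simp add: norm_mult)
      then show False
        using a mult_strict_mono'[of "cmod a" 1 "cmod a" 1] by simp
    qed
    have FD: "F w * D = a + w * g w"
      unfolding F[OF w(1)] D_def[symmetric] using D by simp
    have "(F w - a) * D = w * g w * (1 - cnj a * a)"
      unfolding left_diff_distrib FD unfolding D_def by (simp add: algebra_simps)
    moreover have XD: "(1 - cnj a * F w) * D = 1 - cnj a * a"
    proof -
      have "(1 - cnj a * F w) * D = D - cnj a * (F w * D)"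
        by (simp add: algebra_simps)
      then show ?thesis
        unfolding FD unfolding D_def by (simp add: algebra_simps)
    qed
    ultimately have "(F w - a) * D = (w * g w * (1 - cnj a * F w)) * D"
      by (simp only: mult.assoc)
    then have "F w - a = w * g w * (1 - cnj a * F w)"
      using D by simp
    moreover have "1 - cnj a * F w \<noteq> 0"
      using XD a0 by auto
    ultimately show ?thesis
      using w(2) by (simp add: q_def F0)
  qed
  show ?thesis
  proof (cases "z = 0")
    case True
    have "continuous_on (ball 0 1) g"
      using g by (auto simp: schur_function_def intro: holomorphic_on_imp_continuous_on)
    then have "isCont g 0"
      by (simp add: continuous_on_eq_continuous_at)
    then have "g \<midarrow>0\<rightarrow> g 0"
      by (simp add: isCont_def)
    moreover have "\<forall>\<^sub>F w in at 0. g w = q w"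
      unfolding eventually_at by (rule exI[of _ 1]) (auto simp: q)
    ultimately have "q \<midarrow>0\<rightarrow> g 0"
      using tendsto_cong by fast
    then have "Lim (at 0) q = g 0"
      by (intro tendsto_Lim) simp
    then show ?thesis
      using True by (simp add: schur_step_def q_def Let_def)
  next
    case False
    then show ?thesis
      using q[OF z False] by (simp add: schur_step_def q_def Let_def)
  qed
qed

section \<open>The CMV chain of a unitary operator and a unit vector\<close>

text \<open>The operator \<open>V (n + 1)\<close> arises from \<open>V n\<close> by splitting off the rotation in the plane of \<open>e n\<close> and
  \<open>e (n + 1)\<close>: on the left for even \<open>n\<close>, on the right for odd \<open>n\<close>. Alternating the sides yields a
  five-diagonal matrix; splitting off on one side only would yield a Hessenberg matrix. Since \<open>V n\<close>
  fixes \<open>e 0, \<dots>, e (n - 1)\<close>, it is in effect an operator on the complement of these vectors, but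
  regarding it as an operator on the whole space avoids a sequence of subspaces.\<close>

locale cmv_chain =
  fixes V W :: "nat \<Rightarrow> 'a::chilbert_space \<Rightarrow> 'a" and e :: "nat \<Rightarrow> 'a"
  assumes norm_e_0: "norm (e 0) = 1"
    and unitary: "unitary_pair (V n) (W n)"
    and coupled: "coupled (cinner (W n (e n)) (e n)) (e n) (e (Suc n))"
    and fixed: "V (Suc n) (e n) = e n"
    and V_even: "even n \<Longrightarrow>
      V n x = schur_rotation (cinner (W n (e n)) (e n)) (e n) (e (Suc n)) (V (Suc n) x)"
    and V_odd: "odd n \<Longrightarrow>
      V n x = V (Suc n) (schur_rotation (cinner (W n (e n)) (e n)) (e n) (e (Suc n)) x)"

theorem cmv_chain_exists:
  fixes U :: "'a::chilbert_space \<Rightarrow> 'a"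
  assumes U: "unitary_pair U U'" and e0: "norm e0 = 1"
  shows "\<exists>V W e. cmv_chain V W e \<and> V 0 = U \<and> W 0 = U' \<and> e 0 = e0"
proof -
  define P where "P n = (\<lambda>(V, W, e). unitary_pair V W \<and> (norm e = 1 \<or> e = 0) \<and>
    (n = (0::nat) \<longrightarrow> V = U \<and> W = U' \<and> e = e0))" for n
  define Q where "Q n = (\<lambda>(V, W, e :: 'a) (V', W' :: 'a \<Rightarrow> 'a, e'). coupled (cinner (W e) e) e e' \<and> V' e = e \<and>
    (if even n then \<forall>x. V x = schur_rotation (cinner (W e) e) e e' (V' x)
     else \<forall>x. V x = V' (schur_rotation (cinner (W e) e) e e' x)))" for n :: nat
  have "\<exists>f. \<forall>n. P n (f n) \<and> Q n (f n) (f (Suc n))"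
  proof (rule dependent_nat_choice)
    show "\<exists>x. P 0 x"
      using assms by (intro exI[of _ "(U, U', e0)"]) (simp add: P_def)
    fix x n assume "P n x"
    then obtain V W e where x: "x = (V, W, e)" and V: "unitary_pair V W" and e: "norm e = 1 \<or> e = 0"
      by (auto simp: P_def split: prod.splits)
    have "\<exists>V' W' e'. unitary_pair V' W' \<and> coupled (cinner (W e) e) e e' \<and> V' e = e \<and>
      (if even n then \<forall>x. V x = schur_rotation (cinner (W e) e) e e' (V' x)
       else \<forall>x. V x = V' (schur_rotation (cinner (W e) e) e e' x))"
      using split_off_left_rotation[OF V e] split_off_right_rotation[OF V e] by (cases "even n") simp_all
    then obtain V' W' e' where V': "unitary_pair V' W'" and c: "coupled (cinner (W e) e) e e'"
      and Q: "Q n x (V', W', e')"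
      by (auto simp: Q_def x)
    have "P (Suc n) (V', W', e')"
      using V' c by (auto simp: P_def coupled_def)
    then show "\<exists>y. P (Suc n) y \<and> Q n x y"
      using Q by blast
  qed
  then obtain f where f: "\<And>n. P n (f n)" "\<And>n. Q n (f n) (f (Suc n))"
    by blast
  define V where "V n = fst (f n)" for n
  define W where "W n = fst (snd (f n))" for n
  define e where "e n = snd (snd (f n))" for n
  have fn: "f n = (V n, W n, e n)" for n
    by (simp add: V_def W_def e_def)
  have start: "V 0 = U" "W 0 = U'" "e 0 = e0"
    using f(1)[of 0] by (simp_all add: fn P_def)
  have "cmv_chain V W e"
  proof
    fix n x
    show "norm (e 0) = 1"
      by (simp add: start e0)
    show "unitary_pair (V n) (W n)"
      using f(1)[of n] by (simp add: fn P_def)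
    show "coupled (cinner (W n (e n)) (e n)) (e n) (e (Suc n))" "V (Suc n) (e n) = e n"
      using f(2)[of n] by (simp_all add: fn Q_def)
    show "V n x = schur_rotation (cinner (W n (e n)) (e n)) (e n) (e (Suc n)) (V (Suc n) x)" if "even n"
      using f(2)[of n] that by (simp add: fn Q_def)
    show "V n x = V (Suc n) (schur_rotation (cinner (W n (e n)) (e n)) (e n) (e (Suc n)) x)" if "odd n"
      using f(2)[of n] that by (simp add: fn Q_def)
  qed
  then show ?thesis
    using start by blast
qed

context cmv_chain
begin

definition \<alpha> :: "nat \<Rightarrow> complex"
  where "\<alpha> n = cinner (W n (e n)) (e n)"

abbreviation \<rho> :: "nat \<Rightarrow> complex"
  where "\<rho> n \<equiv> schur_rho (\<alpha> n)"

abbreviation \<Theta> :: "nat \<Rightarrow> 'a \<Rightarrow> 'a"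
  where "\<Theta> n \<equiv> schur_rotation (\<alpha> n) (e n) (e (Suc n))"

abbreviation \<Theta>' :: "nat \<Rightarrow> 'a \<Rightarrow> 'a"
  where "\<Theta>' n \<equiv> schur_rotation (cnj (\<alpha> n)) (e n) (e (Suc n))"

lemma coupled_\<alpha>: "coupled (\<alpha> n) (e n) (e (Suc n))"
  using coupled by (simp add: \<alpha>_def)

lemma V_even_\<alpha>: "even n \<Longrightarrow> V n x = \<Theta> n (V (Suc n) x)"
  using V_even by (simp add: \<alpha>_def)

lemma V_odd_\<alpha>: "odd n \<Longrightarrow> V n x = V (Suc n) (\<Theta> n x)"
  using V_odd by (simp add: \<alpha>_def)

lemma rotation_unitary: "unitary_pair (\<Theta> n) (\<Theta>' n)"
  by (rule schur_rotation_unitary[OF coupled_\<alpha>])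

lemma W_even: "even n \<Longrightarrow> W n x = W (Suc n) (\<Theta>' n x)"
  using V_even_\<alpha>[of n "W (Suc n) (\<Theta>' n x)"]
  by (simp add: unitary_pairD(3)[OF unitary] unitary_pairD(3)[OF rotation_unitary])
    (metis unitary_pairD(4)[OF unitary])

lemma W_odd: "odd n \<Longrightarrow> W n x = \<Theta>' n (W (Suc n) x)"
  using V_odd_\<alpha>[of n "\<Theta>' n (W (Suc n) x)"]
  by (simp add: unitary_pairD(3)[OF unitary] unitary_pairD(3)[OF rotation_unitary])
    (metis unitary_pairD(4)[OF unitary])

lemma \<alpha>_le: "cmod (\<alpha> n) \<le> 1"
  by (rule coupled_le[OF coupled_\<alpha>])

lemma e_unit_or_zero: "norm (e n) = 1 \<or> e n = 0"
  using coupled_\<alpha>[of n] by (auto simp: coupled_def)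

lemma e_unit_Suc_iff: "norm (e (Suc n)) = 1 \<longleftrightarrow> norm (e n) = 1 \<and> cmod (\<alpha> n) < 1"
  using coupled_\<alpha>[of n] by (auto simp: coupled_def)

lemma e_unit_iff: "norm (e n) = 1 \<longleftrightarrow> (\<forall>m<n. cmod (\<alpha> m) < 1)"
  by (induction n) (auto simp: norm_e_0 e_unit_Suc_iff less_Suc_eq)

text \<open>Both assertions are proved together: as \<open>V n\<close> fixes the earlier vectors, it preserves orthogonality
  to them, and the new vector \<open>e (n + 1)\<close> is a combination of \<open>e n\<close> with \<open>V n (e n)\<close> for even \<open>n\<close> and with
  \<open>W n (e n)\<close> for odd \<open>n\<close>.\<close>

lemma V_fixes_and_orthogonal: "m < n \<Longrightarrow> V n (e m) = e m \<and> cinner (e n) (e m) = 0"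
proof (induction n arbitrary: m)
  case (Suc n)
  show ?case
  proof (cases "m = n")
    case True
    then show ?thesis
      using fixed coupled_orthogonal[OF coupled_\<alpha>] by blast
  next
    case False
    then have Vm: "V n (e m) = e m" and nm: "cinner (e n) (e m) = 0"
      using Suc by auto
    have Wm: "W n (e m) = e m"
      by (rule unitary_pair_fixed[OF unitary Vm])
    have c': "coupled (cnj (\<alpha> n)) (e n) (e (Suc n))"
      using coupled_\<alpha> by (simp add: coupled_cnj)
    have "\<rho> n * cinner (e (Suc n)) (e m) = 0"
    proof (cases "even n")
      case True
      have "cinner (V n (e n)) (e m) = 0"
        by (simp add: adjoint_pairD[OF unitary_pairD(1)[OF unitary]] Wm nm)
      moreover have "V n (e n) = \<rho> n *\<^sub>C e (Suc n) + cnj (\<alpha> n) *\<^sub>C e n"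
        by (simp add: V_even_\<alpha>[OF True] fixed schur_rotation_first[OF coupled_\<alpha>])
      ultimately show ?thesis
        by (simp add: cinner_simps nm)
    next
      case False
      have "cinner (W n (e n)) (e m) = 0"
        by (simp add: adjoint_pairD[OF unitary_pairD(2)[OF unitary]] Vm nm)
      moreover have "W n (e n) = \<rho> n *\<^sub>C e (Suc n) + \<alpha> n *\<^sub>C e n"
        by (simp add: W_odd[OF False] unitary_pair_fixed[OF unitary fixed] schur_rotation_first[OF c'])
      ultimately show ?thesis
        by (simp add: cinner_simps nm)
    qed
    moreover have "e (Suc n) = 0 \<or> \<rho> n \<noteq> 0"
      using coupled_\<alpha>[of n] by (auto simp: coupled_def schur_rho_eq_0_iff)
    ultimately have orth: "cinner (e (Suc n)) (e m) = 0"
      by auto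
    have "cinner (e m) (e n) = 0" "cinner (e m) (e (Suc n)) = 0"
      using nm orth by (metis cinner_commute complex_cnj_zero)+
    then have \<Theta>m: "schur_rotation a (e n) (e (Suc n)) (e m) = e m" for a
      by (rule schur_rotation_orthogonal)
    have "V (Suc n) (e m) = e m"
    proof (cases "even n")
      case True
      show ?thesis
        using V_even_\<alpha>[OF True, of "e m"] unitary_pairD(4)[OF rotation_unitary]
        by (metis Vm \<Theta>m)
    next
      case False
      show ?thesis
        using V_odd_\<alpha>[OF False, of "e m"] by (simp add: Vm \<Theta>m)
    qed
    then show ?thesis
      using orth by simp
  qed
qed simp

lemma e_orthogonal: "m \<noteq> n \<Longrightarrow> cinner (e n) (e m) = 0"
  using V_fixes_and_orthogonal by (metis cinner_commute complex_cnj_zero linorder_neqE_nat)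

lemma cinner_e: "norm (e i) = 1 \<Longrightarrow> cinner (e k) (e i) = (if k = i then 1 else 0)"
  by (simp add: e_orthogonal cinner_self_unit)

lemma V_fixes: "m < n \<Longrightarrow> V n (e m) = e m"
  using V_fixes_and_orthogonal by blast

lemma W_fixes: "m < n \<Longrightarrow> W n (e m) = e m"
  by (rule unitary_pair_fixed[OF unitary V_fixes])

lemma cinner_V_e: "m < n \<Longrightarrow> cinner (V n x) (e m) = cinner x (e m)"
  by (simp add: adjoint_pairD[OF unitary_pairD(1)[OF unitary]] W_fixes)

lemma cinner_W_e: "m < n \<Longrightarrow> cinner (W n x) (e m) = cinner x (e m)"
  by (simp add: adjoint_pairD[OF unitary_pairD(2)[OF unitary]] V_fixes)

section \<open>The orthogonal complement of a chain\<close>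

text \<open>Two steps remove a left rotation and a right one. The right one acts trivially on \<open>x\<close>; the left one
  acts trivially on \<open>V (n + 2) x\<close>, because \<open>V (n + 2)\<close> fixes the two vectors of its plane.\<close>

lemma V_skip:
  assumes n: "even n" and x: "\<And>k. n \<le> k \<Longrightarrow> k \<le> n + 2 \<Longrightarrow> cinner x (e k) = 0"
  shows "V n x = V (n + 2) x"
proof -
  have "\<Theta> (Suc n) x = x"
    using x by (intro schur_rotation_orthogonal) simp_all
  moreover have "\<Theta> n (V (n + 2) x) = V (n + 2) x"
    using x by (intro schur_rotation_orthogonal) (simp_all add: cinner_V_e)
  ultimately show ?thesis
    using V_even_\<alpha>[OF n, of x] V_odd_\<alpha>[of "Suc n" x] n by simp
qed

lemma W_skip:
  assumes n: "odd n" and x: "\<And>k. n \<le> k \<Longrightarrow> k \<le> n + 2 \<Longrightarrow> cinner x (e k) = 0"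
  shows "W n x = W (n + 2) x"
proof -
  have "\<Theta>' (Suc n) x = x"
    using x by (intro schur_rotation_orthogonal) simp_all
  moreover have "\<Theta>' n (W (n + 2) x) = W (n + 2) x"
    using x by (intro schur_rotation_orthogonal) (simp_all add: cinner_W_e)
  ultimately show ?thesis
    using W_odd[OF n, of x] W_even[of "Suc n" x] n by simp
qed

text \<open>On the orthogonal complement of the chain all rotations act trivially, so that \<open>V 0\<close> agrees
  there with every \<open>V n\<close> of even index; and \<open>V n\<close> fixes the first \<open>n\<close> vectors of the chain.\<close>

lemma V_complement:
  assumes x: "\<And>k. cinner x (e k) = 0"
  shows "cinner (V 0 x) (e m) = 0"
proof -
  have "V 0 x = V (2 * k) x" for k
  proof (induction k)
    case (Suc k)
    then show ?case
      using V_skip[of "2 * k" x] x by simp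
  qed simp
  from this[of "Suc m"] show ?thesis
    by (simp add: cinner_V_e x)
qed

lemma W_complement:
  assumes x: "\<And>k. cinner x (e k) = 0"
  shows "cinner (W 0 x) (e m) = 0"
proof -
  have "W 0 x = W 1 x"
    using W_even[of 0 x] by (simp add: schur_rotation_orthogonal x)
  moreover have "W 1 x = W (2 * k + 1) x" for k
  proof (induction k)
    case (Suc k)
    then show ?case
      using W_skip[of "2 * k + 1" x] x by simp
  qed simp
  ultimately have "W 0 x = W (2 * m + 1) x"
    by metis
  then show ?thesis
    by (simp add: cinner_W_e x)
qed

section \<open>Matrix entries with respect to a chain\<close>

text \<open>Only the rotations with indices \<open>n\<close>, \<open>n + 1\<close> and \<open>n + 2\<close> contribute, since \<open>V (n + 3)\<close> fixes
  \<open>e (n + 2)\<close>.\<close>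

lemma V_e_Suc: "even n \<Longrightarrow> V n (e (n + 1)) = (cnj (\<alpha> (n + 1)) * \<rho> n) *\<^sub>C e n
    - (cnj (\<alpha> (n + 1)) * \<alpha> n) *\<^sub>C e (n + 1)
    + (\<rho> (n + 1) * cnj (\<alpha> (n + 2))) *\<^sub>C e (n + 2) + (\<rho> (n + 1) * \<rho> (n + 2)) *\<^sub>C e (n + 3)"
  and V_e_Suc_Suc: "even n \<Longrightarrow> V n (e (n + 2)) = (\<rho> (n + 1) * \<rho> n) *\<^sub>C e n
    - (\<rho> (n + 1) * \<alpha> n) *\<^sub>C e (n + 1)
    - (\<alpha> (n + 1) * cnj (\<alpha> (n + 2))) *\<^sub>C e (n + 2) - (\<alpha> (n + 1) * \<rho> (n + 2)) *\<^sub>C e (n + 3)"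
proof -
  assume n: "even n"
  note lin\<Theta> = adjoint_pair_linear[OF schur_rotation_adjoint]
  note linV = adjoint_pair_linear[OF unitary_pairD(1)[OF unitary]]
  note arith = scaleC_scaleC complex_vector.scale_right_diff_distrib scaleC_add_right numeral_2_eq_2
    numeral_3_eq_3 algebra_simps
  have \<Theta>_far: "\<Theta> n (e (n + 2)) = e (n + 2)" "\<Theta> n (e (n + 3)) = e (n + 3)"
    by (simp_all add: schur_rotation_orthogonal e_orthogonal)
  have \<Theta>_n: "\<Theta> n (e (n + 1)) = \<rho> n *\<^sub>C e n - \<alpha> n *\<^sub>C e (n + 1)"
    using schur_rotation_second[OF coupled_\<alpha>[of n]] by simp
  have V2_1: "V (n + 2) (e (n + 1)) = e (n + 1)"
    by (rule V_fixes) simp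
  have V2_2: "V (n + 2) (e (n + 2)) = \<rho> (n + 2) *\<^sub>C e (n + 3) + cnj (\<alpha> (n + 2)) *\<^sub>C e (n + 2)"
    using n V_even_\<alpha>[of "n + 2" "e (n + 2)"] fixed[of "n + 2"] schur_rotation_first[OF coupled_\<alpha>[of "n + 2"]]
    by (simp add: numeral_3_eq_3)
  have factor: "V n x = \<Theta> n (V (n + 2) (\<Theta> (n + 1) x))" for x
    using V_even_\<alpha>[OF n, of x] V_odd_\<alpha>[of "Suc n" x] n by simp
  have \<Theta>1_1: "\<Theta> (n + 1) (e (n + 1)) = \<rho> (n + 1) *\<^sub>C e (n + 2) + cnj (\<alpha> (n + 1)) *\<^sub>C e (n + 1)"
    using schur_rotation_first[OF coupled_\<alpha>[of "n + 1"]] by simp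
  have \<Theta>1_2: "\<Theta> (n + 1) (e (n + 2)) = \<rho> (n + 1) *\<^sub>C e (n + 1) - \<alpha> (n + 1) *\<^sub>C e (n + 2)"
    using schur_rotation_second[OF coupled_\<alpha>[of "n + 1"]] by simp
  show "V n (e (n + 1)) = (cnj (\<alpha> (n + 1)) * \<rho> n) *\<^sub>C e n
    - (cnj (\<alpha> (n + 1)) * \<alpha> n) *\<^sub>C e (n + 1)
    + (\<rho> (n + 1) * cnj (\<alpha> (n + 2))) *\<^sub>C e (n + 2) + (\<rho> (n + 1) * \<rho> (n + 2)) *\<^sub>C e (n + 3)"
    unfolding factor \<Theta>1_1 linV V2_1 V2_2 lin\<Theta> \<Theta>_far \<Theta>_n
    by (simp only: scaleC_scaleC complex_vector.scale_right_diff_distrib scaleC_add_right) simp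
  show "V n (e (n + 2)) = (\<rho> (n + 1) * \<rho> n) *\<^sub>C e n
    - (\<rho> (n + 1) * \<alpha> n) *\<^sub>C e (n + 1)
    - (\<alpha> (n + 1) * cnj (\<alpha> (n + 2))) *\<^sub>C e (n + 2) - (\<alpha> (n + 1) * \<rho> (n + 2)) *\<^sub>C e (n + 3)"
    unfolding factor \<Theta>1_2 linV V2_1 V2_2 lin\<Theta> \<Theta>_far \<Theta>_n
    by (simp only: scaleC_scaleC complex_vector.scale_right_diff_distrib scaleC_add_right) simp
qed

lemma V_0_eq: "2 * k + 1 \<le> m \<Longrightarrow> V 0 (e m) = V (2 * k) (e m)"
proof (induction k)
  case (Suc k)
  then have "V (2 * k) (e m) = V (2 * k + 2) (e m)"
    by (intro V_skip) (auto simp: e_orthogonal)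
  then show ?case
    using Suc by simp
qed simp

text \<open>By skipping, the column of index \<open>j\<close> of \<open>V 0\<close> is the one of \<open>V n\<close> for the largest even \<open>n < j\<close>, which the
  two expansions describe.\<close>

theorem matrix_entries:
  assumes i: "1 \<le> i" "norm (e i) = 1" and j: "1 \<le> j"
  shows "cinner (V 0 (e j)) (e i) = truncated_cmv \<alpha> i j"
proof (cases "odd j")
  case True
  then obtain k where j_eq: "j = 2 * k + 1"
    by (auto elim: oddE)
  define n where "n = 2 * k"
  have n: "even n" "j = n + 1"
    by (simp_all add: n_def j_eq)
  have "V 0 (e j) = V n (e (n + 1))"
    using V_0_eq[of k j] by (simp add: j_eq n_def)
  then have "cinner (V 0 (e j)) (e i) =
      cnj (\<alpha> (n + 1)) * \<rho> n * (if n = i then 1 else 0)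
      - cnj (\<alpha> (n + 1)) * \<alpha> n * (if n + 1 = i then 1 else 0)
      + \<rho> (n + 1) * cnj (\<alpha> (n + 2)) * (if n + 2 = i then 1 else 0)
      + \<rho> (n + 1) * \<rho> (n + 2) * (if n + 3 = i then 1 else 0)"
    by (simp only: V_e_Suc[OF n(1)] cinner_simps cinner_e[OF i(2)])
  moreover have "i = n \<or> i = n + 1 \<or> i = n + 2 \<or> i = n + 3 \<or>
      (i \<noteq> n \<and> i \<noteq> n + 1 \<and> i \<noteq> n + 2 \<and> i \<noteq> n + 3)"
    by blast
  ultimately show ?thesis
    using n i(1) by (auto simp: truncated_cmv_def cmv_rho_eq)
next
  case False
  then have "odd (j - 1)" "1 \<le> j - 1"
    using j by (auto elim!: evenE)
  then obtain k where "j - 1 = 2 * k + 1"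
    using oddE by blast
  then have j_eq: "j = 2 * k + 2"
    by simp
  define n where "n = 2 * k"
  have n: "even n" "j = n + 2"
    by (simp_all add: n_def j_eq)
  have "V 0 (e j) = V n (e (n + 2))"
    using V_0_eq[of k j] by (simp add: j_eq n_def)
  then have "cinner (V 0 (e j)) (e i) =
      \<rho> (n + 1) * \<rho> n * (if n = i then 1 else 0)
      - \<rho> (n + 1) * \<alpha> n * (if n + 1 = i then 1 else 0)
      - \<alpha> (n + 1) * cnj (\<alpha> (n + 2)) * (if n + 2 = i then 1 else 0)
      - \<alpha> (n + 1) * \<rho> (n + 2) * (if n + 3 = i then 1 else 0)"
    by (simp only: V_e_Suc_Suc[OF n(1)] cinner_simps cinner_e[OF i(2)])
  moreover have "i = n \<or> i = n + 1 \<or> i = n + 2 \<or> i = n + 3 \<or>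
      (i \<noteq> n \<and> i \<noteq> n + 1 \<and> i \<noteq> n + 2 \<and> i \<noteq> n + 3)"
    by blast
  ultimately show ?thesis
    using n i(1) by (auto simp: truncated_cmv_def cmv_rho_eq)
qed

section \<open>The Schur parameters of a chain\<close>

lemma schur_fun_recursion:
  assumes e: "norm (e (Suc n)) = 1" and z: "cmod z < 1"
  defines "g \<equiv> schur_fun (W (Suc n)) (e (Suc n))"
  shows "schur_fun (W n) (e n) z = (\<alpha> n + z * g z) / (1 + cnj (\<alpha> n) * (z * g z))"
proof -
  have en: "norm (e n) = 1" and a: "cmod (\<alpha> n) < 1"
    using e e_unit_Suc_iff by blast+
  note left = schur_fun_rotate_left[OF unitary fixed coupled_\<alpha> a en z, folded g_def]
  show ?thesis
  proof (cases "even n")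
    case True
    then have "W n = (\<lambda>x. W (Suc n) (\<Theta>' n x))"
      by (intro ext W_even)
    then show ?thesis
      using schur_fun_rotate_right[OF unitary fixed coupled_\<alpha> en z] left by simp
  next
    case False
    then have "W n = (\<lambda>x. \<Theta>' n (W (Suc n) x))"
      by (intro ext W_odd)
    then show ?thesis
      using left by simp
  qed
qed

text \<open>Splitting off one rotation corresponds to one \<open>schur_step\<close>, so that the \<open>n\<close>-th iterate is the Schur function of
  the remaining operator \<open>W n\<close> at \<open>e n\<close>. The hypothesis concerns the disk only, because a characteristic
  function has no prescribed values outside of it.\<close>

lemma schur_iterates:
  assumes F: "\<And>z. cmod z < 1 \<Longrightarrow> F z = schur_fun (W 0) (e 0) z"
    and n: "norm (e n) = 1" and z: "cmod z < 1"
  shows "(schur_step ^^ n) F z = schur_fun (W n) (e n) z"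
  using n z
proof (induction n arbitrary: z)
  case 0
  then show ?case
    using F by simp
next
  case (Suc n)
  have "norm (e n) = 1" "cmod (\<alpha> n) < 1"
    using Suc.prems(1) e_unit_Suc_iff by blast+
  then have "schur_step ((schur_step ^^ n) F) z = schur_fun (W (Suc n)) (e (Suc n)) z"
    using Suc.IH Suc.prems schur_fun_recursion[OF Suc.prems(1)]
    by (intro schur_step_eq schur_function_schur_fun[OF unitary]) auto
  then show ?case
    by simp
qed

lemma schur_parameter_eq:
  assumes "\<And>z. cmod z < 1 \<Longrightarrow> F z = schur_fun (W 0) (e 0) z" and "norm (e n) = 1"
  shows "schur_parameter F n = \<alpha> n"
  using schur_iterates[OF assms, of 0] schur_fun_0[OF unitary assms(2)]
  by (simp add: schur_parameter_def \<alpha>_def)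

end

section \<open>Rank one defects\<close>

lemma cinner_Pair: "cinner (x, c) (y, d) = cinner x y + c * cnj d"
  by (simp add: cinner_prod_def cinner_complex_def)

lemma scaleC_Pair: "c *\<^sub>C (x, d) = (c *\<^sub>C x, c * d)"
  by (simp add: scaleC_prod_def scaleC_complex_def)

lemma contraction_iff:
  "contraction T \<longleftrightarrow> bounded_clinear T \<and> (\<forall>x. norm (T x) \<le> norm x)"
proof
  assume T: "contraction T"
  then have "bounded_linear T" "onorm T \<le> 1"
    by (auto simp: contraction_def intro: bounded_clinear_linear)
  then have "norm (T x) \<le> 1 * norm x" for x
    by (meson onorm mult_right_mono norm_ge_zero order_trans)
  then show "bounded_clinear T \<and> (\<forall>x. norm (T x) \<le> norm x)"
    using T by (simp add: contraction_def)
next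
  assume "bounded_clinear T \<and> (\<forall>x. norm (T x) \<le> norm x)"
  then show "contraction T"
    by (auto simp: contraction_def intro!: onorm_bound)
qed

lemma contraction_adjoint:
  fixes T :: "'a::chilbert_space \<Rightarrow> 'a"
  assumes T: "contraction T"
  shows "adjoint_pair T (cadjoint T)" "contraction (cadjoint T)" "cadjoint (cadjoint T) = T"
proof -
  show TS: "adjoint_pair T (cadjoint T)"
    using T by (simp add: contraction_iff adjoint_pair_cadjoint)
  note ST = adjoint_pair_sym[OF TS]
  have "norm (cadjoint T x) \<le> norm x" for x
    by (rule adjoint_pair_norm_le[OF TS]) (use T in \<open>simp add: contraction_iff\<close>)
  then show "contraction (cadjoint T)"
    unfolding contraction_iff
    by (intro conjI allI bounded_clinearI[of _ 1]) (simp_all add: adjoint_pair_linear[OF ST])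
  show "cadjoint (cadjoint T) = T"
    by (rule cadjoint_eqI[OF ST])
qed

lemma defect_op_squared:
  fixes T :: "'a::chilbert_space \<Rightarrow> 'a"
  assumes T: "contraction T"
  shows "positive_op (defect_op T)"
    and "defect_op T (defect_op T x) = x - cadjoint T (T x)"
proof -
  note TS = contraction_adjoint(1)[OF T]
  have adj: "adjoint_pair (\<lambda>x. cadjoint T (T x)) (\<lambda>x. cadjoint T (T x))"
    using TS adjoint_pair_sym[OF TS] by (simp add: adjoint_pair_def)
  have le: "norm (cadjoint T (T x)) \<le> norm x" for x
    using T contraction_adjoint(2)[OF T] by (auto simp: contraction_iff intro: order_trans)
  show "positive_op (defect_op T)" "defect_op T (defect_op T x) = x - cadjoint T (T x)"
    unfolding defect_op_def by (rule op_sqrt_one_minus[OF adj le])+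
qed

lemma dim_line:
  assumes "w \<noteq> 0"
  shows "complex_vector.dim (range (\<lambda>c. c *\<^sub>C w)) = 1"
proof -
  have "complex_vector.dim (complex_vector.span {w}) = card {w}"
    using assms by (intro complex_vector.dim_eq_card) (simp_all add: complex_vector.span_span complex_vector.dependent_single)
  then show ?thesis
    by (simp add: complex_vector.span_singleton)
qed

text \<open>A self-adjoint operator with range in a line maps a unit vector of the line to a multiple of itself,
  and this multiple determines the operator. The choice of the unit vector does not matter, since a
  unimodular factor cancels in \<open>\<langle>x, p\<rangle> p\<close>.\<close>

lemma positive_op_rank_one:
  fixes D :: "'a::chilbert_space \<Rightarrow> 'a"
  assumes D: "positive_op D" and dim: "complex_vector.dim (closure (range D)) = 1"
  shows "\<exists>p. norm p = 1 \<and> p \<in> closure (range D)"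
    and "\<exists>s>0. \<forall>p\<in>closure (range D). norm p = 1 \<longrightarrow>
      (\<forall>x. D x = (complex_of_real s * cinner x p) *\<^sub>C p)"
proof -
  let ?S = "closure (range D)"
  note adj = positive_op_self_adjoint[OF D]
  obtain b where b: "complex_vector.independent b" "complex_vector.span b = complex_vector.span ?S"
    using dim by (auto simp: complex_vector.dim_def split: if_splits)
  then have "card b = 1"
    using dim complex_vector.dim_eq_card by metis
  then obtain w where "b = {w}"
    by (auto simp: card_1_singleton_iff)
  with b have w0: "w \<noteq> 0" and span: "complex_vector.span ?S = range (\<lambda>c. c *\<^sub>C w)"
    by (auto simp: complex_vector.dependent_single complex_vector.span_singleton)
  define p where "p = (1 / complex_of_real (norm w)) *\<^sub>C w"
  have p: "norm p = 1"
    using w0 by (simp add: p_def norm_divide)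
  have in_S: "\<exists>c. x = c *\<^sub>C p" if x: "x \<in> ?S" for x
  proof -
    obtain c where "x = c *\<^sub>C w"
      using complex_vector.span_base[OF x] span by auto
    then have "x = (c * complex_of_real (norm w)) *\<^sub>C p"
      using w0 by (simp add: p_def scaleC_scaleC)
    then show ?thesis
      by blast
  qed
  have range_D: "D x = cinner (D x) p *\<^sub>C p" for x
  proof -
    have "D x \<in> ?S"
      by (simp add: closure_subset[THEN subsetD])
    then obtain c where "D x = c *\<^sub>C p"
      using in_S by blast
    then show ?thesis
      by (simp add: cinner_simps cinner_self_unit[OF p])
  qed
  define s where "s = Re (cinner (D p) p)"
  have s: "cinner (D p) p = complex_of_real s" "0 \<le> s"
    using positive_opD[OF D, of p] by (simp_all add: s_def complex_eq_iff)
  have Dx: "D x = (complex_of_real s * cinner x p) *\<^sub>C p" for x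
  proof -
    have "cinner (D x) p = cinner x (complex_of_real s *\<^sub>C p)"
      using adjoint_pairD[OF adj, of x p] range_D[of p] s(1) by simp
    then show ?thesis
      using range_D[of x] by (simp add: cinner_simps)
  qed
  have "s \<noteq> 0"
  proof
    assume "s = 0"
    then have "range D = {0}"
      by (auto simp: Dx)
    then have "?S = {0}"
      by (simp add: closure_closed)
    moreover have "w \<in> complex_vector.span ?S"
      unfolding span by (metis complex_vector.scale_one rangeI)
    ultimately show False
      using w0 by simp
  qed
  then have s_pos: "0 < s"
    using s(2) by simp
  have "D ((1 / complex_of_real s) *\<^sub>C p) = p"
    using \<open>s \<noteq> 0\<close> by (simp add: Dx cinner_simps cinner_self_unit[OF p])
  then have "p \<in> ?S"
    using closure_subset[of "range D"] by (metis rangeI subsetD)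
  then show "\<exists>p. norm p = 1 \<and> p \<in> closure (range D)"
    using p by blast
  have "D x = (complex_of_real s * cinner x p') *\<^sub>C p'" if p': "p' \<in> ?S" "norm p' = 1" for p' x
  proof -
    obtain c where c: "p' = c *\<^sub>C p"
      using in_S[OF p'(1)] by blast
    then have "cmod c = 1"
      using p'(2) p by simp
    then have "cnj c * c = 1"
      using complex_norm_square[of c] by (simp add: mult.commute)
    moreover have "(complex_of_real s * cinner x p') *\<^sub>C p'
        = (complex_of_real s * cinner x p * (cnj c * c)) *\<^sub>C p"
      unfolding c by (simp add: cinner_simps scaleC_scaleC mult_ac)
    ultimately show ?thesis
      using Dx[of x] by simp
  qed
  then show "\<exists>s>0. \<forall>p\<in>?S. norm p = 1 \<longrightarrow> (\<forall>x. D x = (complex_of_real s * cinner x p) *\<^sub>C p)"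
    using s_pos by blast
qed

section \<open>The unitary colligation of a contraction with rank one defects\<close>

text \<open>The adjoint pair \<open>T\<close>, \<open>S\<close> in normal form: \<open>p\<close> and \<open>q\<close> span the defect spaces of \<open>T\<close> and of \<open>S\<close>, and
  \<open>a\<close> is the value of the characteristic function at 0. The hypotheses are symmetric under exchanging
  \<open>T\<close>, \<open>p\<close> with \<open>S\<close>, \<open>q\<close> and conjugating \<open>a\<close>.\<close>

locale rank_one_contraction =
  fixes T S :: "'h::chilbert_space \<Rightarrow> 'h" and p q :: 'h and a :: complex
  assumes adj: "adjoint_pair T S"
    and norm_T: "norm (T x) \<le> norm x"
    and norm_p: "norm p = 1" and norm_q: "norm q = 1" and a: "cmod a < 1"
    and T_p: "T p = - (a *\<^sub>C q)" and S_q: "S q = - (cnj a *\<^sub>C p)"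
    and S_T: "S (T x) = x - (schur_rho a * schur_rho a * cinner x p) *\<^sub>C p"
    and T_S: "T (S x) = x - (schur_rho a * schur_rho a * cinner x q) *\<^sub>C q"

text \<open>Comparing the two evaluations of \<open>T T\<^sup>* T p\<close> shows that \<open>T\<close> maps the defect line of \<open>T\<close>
  into the one of \<open>T\<^sup>*\<close>; the same holds for \<open>T\<^sup>*\<close>. The two maps are given by conjugate numbers, which
  forces both defects to have the same size.\<close>

lemma rank_one_contraction_normal_form:
  fixes T :: "'a::chilbert_space \<Rightarrow> 'a"
  assumes T: "contraction T" and r1: "rank_one_defects T"
    and p: "p \<in> defect_space T" "norm p = 1"
    and q: "q \<in> defect_space (cadjoint T)" "norm q = 1"
  defines "a \<equiv> - cinner (T p) q"
  shows "rank_one_contraction T (cadjoint T) p q a"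
    and "defect_op T x = (schur_rho a * cinner x p) *\<^sub>C p"
    and "defect_op (cadjoint T) x = (schur_rho a * cinner x q) *\<^sub>C q"
proof -
  let ?S = "cadjoint T"
  note TS = contraction_adjoint(1)[OF T] and S = contraction_adjoint(2)[OF T]
  note linT = adjoint_pair_linear[OF TS] and linS = adjoint_pair_linear[OF adjoint_pair_sym[OF TS]]
  note cpp = cinner_self_unit[OF p(2)] and cqq = cinner_self_unit[OF q(2)]
  obtain s where s: "0 < s" and D: "\<And>x. defect_op T x = (complex_of_real s * cinner x p) *\<^sub>C p"
    using positive_op_rank_one(2)[OF defect_op_squared(1)[OF T]] r1 p
    unfolding rank_one_defects_def defect_space_def by blast
  obtain t where t: "0 < t" and D': "\<And>x. defect_op ?S x = (complex_of_real t * cinner x q) *\<^sub>C q"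
    using positive_op_rank_one(2)[OF defect_op_squared(1)[OF S]] r1 q
    unfolding rank_one_defects_def defect_space_def by blast
  have ST: "?S (T x) = x - (complex_of_real (s * s) * cinner x p) *\<^sub>C p" for x
    using defect_op_squared(2)[OF T, of x]
    by (simp add: D cinner_simps cpp mult_ac algebra_simps)
  have TS': "T (?S x) = x - (complex_of_real (t * t) * cinner x q) *\<^sub>C q" for x
    using defect_op_squared(2)[OF S, of x]
    by (simp add: D' contraction_adjoint(3)[OF T] cinner_simps cqq mult_ac algebra_simps)
  have "complex_of_real (s * s) *\<^sub>C T p = (complex_of_real (t * t) * cinner (T p) q) *\<^sub>C q"
    using TS'[of "T p"] arg_cong[OF ST[of p], of T] by (simp add: linT cpp)
  then have "T p = (complex_of_real (t * t) * cinner (T p) q / complex_of_real (s * s)) *\<^sub>C q"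
    using s by (metis (no_types, lifting) complex_vector.scale_left_imp_eq divide_eq_0_iff eq_divide_eq
        mult.commute mult_eq_0_iff of_real_eq_0_iff order_less_irrefl scaleC_scaleC)
  then obtain k where k: "T p = k *\<^sub>C q"
    by blast
  then have Tp: "T p = - (a *\<^sub>C q)"
    by (simp add: a_def cinner_simps cqq)
  have "complex_of_real (t * t) *\<^sub>C ?S q = (complex_of_real (s * s) * cinner (?S q) p) *\<^sub>C p"
    using ST[of "?S q"] arg_cong[OF TS'[of q], of ?S] by (simp add: linS cqq)
  then have "?S q = (complex_of_real (s * s) * cinner (?S q) p / complex_of_real (t * t)) *\<^sub>C p"
    using t by (metis (no_types, lifting) complex_vector.scale_left_imp_eq divide_eq_0_iff eq_divide_eq
        mult.commute mult_eq_0_iff of_real_eq_0_iff order_less_irrefl scaleC_scaleC)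
  then obtain l where l: "?S q = l *\<^sub>C p"
    by blast
  have "l = cinner (?S q) p"
    by (simp add: l cinner_simps cpp)
  also have "\<dots> = cinner q (T p)"
    by (simp add: adjoint_pairD[OF adjoint_pair_sym[OF TS]])
  also have "\<dots> = - cnj a"
    by (simp add: Tp cinner_simps cqq)
  finally have Sq: "?S q = - (cnj a *\<^sub>C p)"
    by (simp add: l)
  have aa: "a * cnj a = complex_of_real ((cmod a)\<^sup>2)"
    by (simp only: complex_norm_square)
  have "(a * cnj a) *\<^sub>C p = ?S (T p)"
    by (simp add: Tp Sq linS scaleC_scaleC)
  also have "\<dots> = (1 - complex_of_real (s * s)) *\<^sub>C p"
    by (simp add: ST cpp complex_vector.scale_left_diff_distrib)
  finally have "complex_of_real ((cmod a)\<^sup>2) = complex_of_real (1 - s * s)"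
    using p(2) unfolding aa by (auto simp: complex_vector.scale_cancel_right)
  then have s2: "(cmod a)\<^sup>2 = 1 - s * s"
    by (simp only: of_real_eq_iff)
  have "(a * cnj a) *\<^sub>C q = T (?S q)"
    by (simp add: Tp Sq linT scaleC_scaleC mult.commute)
  also have "\<dots> = (1 - complex_of_real (t * t)) *\<^sub>C q"
    by (simp add: TS' cqq complex_vector.scale_left_diff_distrib)
  finally have "complex_of_real ((cmod a)\<^sup>2) = complex_of_real (1 - t * t)"
    using q(2) unfolding aa by (auto simp: complex_vector.scale_cancel_right)
  then have t2: "(cmod a)\<^sup>2 = 1 - t * t"
    by (simp only: of_real_eq_iff)
  have rs: "schur_rho a = complex_of_real s"
    using s by (simp add: schur_rho_def s2)
  have rt: "schur_rho a = complex_of_real t"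
    using t by (simp add: schur_rho_def t2)
  have a1: "cmod a < 1"
  proof -
    have "(cmod a)\<^sup>2 < 1\<^sup>2"
      using s by (simp add: s2)
    then show ?thesis
      by (rule power2_less_imp_less) simp
  qed
  show "rank_one_contraction T ?S p q a"
  proof
    show "norm (T x) \<le> norm x" for x
      using T by (simp add: contraction_iff)
    show "?S (T x) = x - (schur_rho a * schur_rho a * cinner x p) *\<^sub>C p" for x
      by (simp add: ST rs)
    show "T (?S x) = x - (schur_rho a * schur_rho a * cinner x q) *\<^sub>C q" for x
      by (simp add: TS' rt)
  qed (fact TS p(2) q(2) a1 Tp Sq)+
  show "defect_op T x = (schur_rho a * cinner x p) *\<^sub>C p"
    by (simp add: D rs)
  show "defect_op ?S x = (schur_rho a * cinner x q) *\<^sub>C q"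
    by (simp add: D' rt)
qed

context rank_one_contraction
begin

abbreviation r :: complex
  where "r \<equiv> schur_rho a"

text \<open>This is the Julia operator of \<open>T\<close>, with the defect spaces identified with the complex numbers by means
  of \<open>p\<close> and \<open>q\<close>; \<open>T\<close> is its compression to the first summand.\<close>

definition U :: "'h \<times> complex \<Rightarrow> 'h \<times> complex"
  where "U k = (T (fst k) + (r * snd k) *\<^sub>C q, r * cinner (fst k) p + cnj a * snd k)"

definition U' :: "'h \<times> complex \<Rightarrow> 'h \<times> complex"
  where "U' k = (S (fst k) + (r * snd k) *\<^sub>C p, r * cinner (fst k) q + a * snd k)"

lemma r_squared: "r * r = 1 - a * cnj a"
  using a by (intro schur_rho_squared) simp

lemma rank_one_contraction_adjoint: "rank_one_contraction S T q p (cnj a)"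
proof
  show "adjoint_pair S T"
    by (rule adjoint_pair_sym[OF adj])
  show "norm (S x) \<le> norm x" for x
    by (rule adjoint_pair_norm_le[OF adj norm_T])
qed (simp_all add: norm_p norm_q a T_p S_q S_T T_S)

lemma U_U': "U (U' k) = k"
proof -
  obtain y c where k: "k = (y, c)"
    by (cases k)
  note lin = adjoint_pair_linear[OF adj]
  have "T (S y + (r * c) *\<^sub>C p) + (r * (r * cinner y q + a * c)) *\<^sub>C q
      = y + ((r * r * cinner y q + r * a * c) - r * r * cinner y q - r * c * a) *\<^sub>C q"
    by (simp add: lin T_S T_p complex_vector.scale_left_diff_distrib scaleC_add_left scaleC_scaleC
        complex_vector.scale_minus_right algebra_simps)
  then have 1: "fst (U (U' k)) = y"
    by (simp add: U_def U'_def k algebra_simps)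
  have "cinner (S y) p = - (cinner y q * cnj a)"
    by (simp add: adjoint_pairD[OF adjoint_pair_sym[OF adj]] T_p cinner_simps)
  then have "snd (U (U' k)) = (r * r + a * cnj a) * c"
    by (simp add: U_def U'_def k cinner_simps cinner_self_unit[OF norm_p] algebra_simps)
  then show ?thesis
    using 1 by (simp add: r_squared k prod_eq_iff)
qed

lemma unitary_U: "unitary_pair U U'"
  unfolding unitary_pair_def
proof (intro conjI allI)
  show "adjoint_pair U U'"
    unfolding adjoint_pair_def U_def U'_def
    by (auto simp: cinner_Pair cinner_simps adjoint_pairD[OF adj] cinner_commute[of p] cinner_commute[of q]
        algebra_simps)
  interpret A: rank_one_contraction S T q p "cnj a"
    by (rule rank_one_contraction_adjoint)
  show "U (U' k) = k" for k
    by (rule U_U')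
  have "A.U = U'" "A.U' = U"
    by (simp_all add: fun_eq_iff A.U_def A.U'_def U_def U'_def)
  then show "U' (U k) = k" for k
    using A.U_U'[of k] by simp
qed

text \<open>Eliminating the scalar component from the resolvent equation of the colligation leaves the
  resolvent of \<open>T\<^sup>*\<close>.\<close>

lemma schur_fun_U':
  assumes z: "cmod z < 1"
  shows "schur_fun U' (0, 1) z = a + z * r * r * cinner (resolvent S z p) q"
proof -
  interpret S: linear_contraction S
    by standard (simp_all add: adjoint_pair_linear[OF adjoint_pair_sym[OF adj]]
        adjoint_pair_norm_le[OF adj norm_T])
  interpret U': linear_contraction U'
    by (rule unitary_pair_linear_contraction[OF unitary_pair_sym[OF unitary_U]])
  define y where "y = (z * r) *\<^sub>C resolvent S z p"
  have "y - z *\<^sub>C S y = (z * r) *\<^sub>C (resolvent S z p - z *\<^sub>C S (resolvent S z p))"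
    by (simp add: y_def S.scaleC scaleC_scaleC complex_vector.scale_right_diff_distrib mult_ac)
  then have y: "y - z *\<^sub>C S y = (z * r) *\<^sub>C p"
    by (simp only: S.resolvent_solves[OF z])
  have "(y, 1) - z *\<^sub>C U' (y, 1) = (1 - z * (r * cinner y q + a)) *\<^sub>C (0, 1)"
    using y by (simp add: U'_def scaleC_Pair scaleC_add_right scaleC_scaleC algebra_simps)
  from U'.schur_fun_eqI[OF z this] show ?thesis
    by (simp add: cinner_Pair U'_def y_def cinner_simps algebra_simps)
qed

text \<open>\<open>M\<close> is the restriction of the unitary colligation to \<open>H\<close> and \<open>L\<close> the projection onto \<open>H\<close>. As
  \<open>H\<close> has codimension one, so has the range of \<open>M\<close>: its complement is the line of the image of \<open>(0, 1)\<close>.\<close>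

lemma product_of_coisometry_and_isometry:
  "\<exists>(M :: 'h \<Rightarrow> 'h \<times> complex) (L :: 'h \<times> complex \<Rightarrow> 'h).
    isometry_op M \<and> op_rank (\<lambda>k. k - M (cadjoint M k)) = 1 \<and>
    coisometry_op L \<and> op_rank (\<lambda>k. k - cadjoint L (L k)) = 1 \<and> T = L \<circ> M"
proof (intro exI conjI)
  let ?M = "\<lambda>x. U (x, 0)" and ?L = "fst :: 'h \<times> complex \<Rightarrow> 'h"
  note linU = adjoint_pair_linear[OF unitary_pairD(1)[OF unitary_U]]
  have "adjoint_pair ?M (\<lambda>k. fst (U' k))"
    unfolding adjoint_pair_def
  proof (intro allI)
    fix x k
    show "cinner (U (x, 0)) k = cinner x (fst (U' k))"
      unfolding adjoint_pairD[OF unitary_pairD(1)[OF unitary_U]]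
      by (simp add: cinner_prod_def[of "(x, 0)"])
  qed
  note M = this cadjoint_eqI[OF this]
  have "bounded_clinear ?M"
    by (rule bounded_clinearI[of _ 1])
      (simp_all add: adjoint_pair_linear[OF M(1)] unitary_pair_norm[OF unitary_U] norm_Pair)
  then show "isometry_op ?M"
    by (simp add: isometry_op_def M(2) fun_eq_iff unitary_pairD(4)[OF unitary_U])
  define w where "w = U (0, 1)"
  have "norm w = 1"
    by (simp add: w_def unitary_pair_norm[OF unitary_U] norm_Pair)
  then have w0: "w \<noteq> 0"
    by auto
  have rest: "k - ?M (fst (U' k)) = snd (U' k) *\<^sub>C w" for k
  proof -
    have "k - ?M (fst (U' k)) = U (U' k - (fst (U' k), 0))"
      by (simp add: linU unitary_pairD(3)[OF unitary_U])
    also have "U' k - (fst (U' k), 0) = snd (U' k) *\<^sub>C (0, 1)"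
      by (simp add: prod_eq_iff scaleC_Pair)
    finally show ?thesis
      by (simp add: linU w_def)
  qed
  have "range (\<lambda>k. k - ?M (fst (U' k))) = range (\<lambda>c. c *\<^sub>C w)"
  proof (intro equalityI subsetI)
    fix x assume "x \<in> range (\<lambda>c. c *\<^sub>C w)"
    then obtain c where "x = c *\<^sub>C w"
      by blast
    then have "x = snd (U' (U (0, c))) *\<^sub>C w"
      by (simp add: unitary_pairD(4)[OF unitary_U])
    then show "x \<in> range (\<lambda>k. k - ?M (fst (U' k)))"
      unfolding rest by blast
  qed (auto simp: rest)
  then show "op_rank (\<lambda>k. k - ?M (cadjoint ?M k)) = 1"
    unfolding op_rank_def M(2) using dim_line[OF w0] by simp
  have "adjoint_pair ?L (\<lambda>x. (x, 0))"
    unfolding adjoint_pair_def by (auto simp: cinner_prod_def)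
  note L = this cadjoint_eqI[OF this]
  have "bounded_clinear ?L"
  proof (rule bounded_clinearI)
    show "norm (?L k) \<le> 1 * norm k" for k
      using norm_fst_le[of "fst k" "snd k"] by simp
  qed (simp_all add: adjoint_pair_linear[OF L(1)])
  then show "coisometry_op ?L"
    by (simp add: coisometry_op_def L(2) fun_eq_iff)
  have "range (\<lambda>k. k - (?L k, 0)) = range (\<lambda>c. c *\<^sub>C (0 :: 'h, 1 :: complex))"
    by (auto simp: scaleC_Pair image_iff prod_eq_iff)
  then show "op_rank (\<lambda>k. k - cadjoint ?L (?L k)) = 1"
    unfolding op_rank_def L(2) using dim_line[of "(0 :: 'h, 1 :: complex)"] by (simp add: prod_eq_iff)
  show "T = ?L \<circ> ?M"
    by (simp add: fun_eq_iff U_def)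
qed

end

lemma unitary_identification_unit:
  assumes "unitary_between V UNIV u"
  defines "p \<equiv> inv_into V u (1 :: complex)"
  shows "p \<in> V" "u p = 1" "norm p = 1"
proof -
  have img: "(1 :: complex) \<in> u ` V"
    using assms by (simp add: unitary_between_def)
  show p: "p \<in> V" "u p = 1"
    using inv_into_into[OF img] f_inv_into_f[OF img] by (simp_all add: p_def)
  then have "cinner p p = 1"
    using assms unfolding unitary_between_def by (metis cinner_complex_def complex_cnj_one mult_1)
  then have "(norm p)\<^sup>2 = 1"
    unfolding cinner_self by (metis of_real_eq_1_iff)
  then show "norm p = 1"
    by (simp add: power2_eq_1_iff) (use norm_ge_zero[of p] in linarith)
qed

text \<open>The identifications \<open>u\<close> and \<open>v\<close> amount to the choice of unit vectors \<open>p = u\<^sup>-\<^sup>1 1\<close> and \<open>q = v\<^sup>-\<^sup>1 1\<close>. In the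
  colligation built from these, both sides equal \<open>a + z \<rho>\<^sup>2 \<langle>(1 - z T\<^sup>*)\<^sup>-\<^sup>1 p, q\<rangle>\<close>.\<close>

lemma scalar_char_function_eq:
  fixes T :: "'a::chilbert_space \<Rightarrow> 'a"
  assumes T: "contraction T" and r1: "rank_one_defects T"
    and u: "unitary_between (defect_space T) UNIV u"
    and v: "unitary_between (defect_space (cadjoint T)) UNIV v"
  shows "\<exists>p q a. rank_one_contraction T (cadjoint T) p q a \<and>
    (\<forall>z. cmod z < 1 \<longrightarrow> scalar_char_function T u v z
      = schur_fun (rank_one_contraction.U' (cadjoint T) p q a) (0, 1) z)"
proof -
  define p where "p = inv_into (defect_space T) u 1"
  define q where "q = inv_into (defect_space (cadjoint T)) v 1"
  define a where "a = - cinner (T p) q"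
  note p = unitary_identification_unit[OF u, folded p_def]
  note q = unitary_identification_unit[OF v, folded q_def]
  note form = rank_one_contraction_normal_form[OF T r1 p(1,3) q(1,3), folded a_def]
  interpret rank_one_contraction T "cadjoint T" p q a
    by (rule form)
  interpret S: linear_contraction "cadjoint T"
    by standard (simp_all add: adjoint_pair_linear[OF adjoint_pair_sym[OF adj]]
        adjoint_pair_norm_le[OF adj norm_T])
  have "scalar_char_function T u v z = schur_fun U' (0, 1) z" if z: "cmod z < 1" for z
  proof -
    have "char_function T z p
        = - T p + z *\<^sub>C defect_op (cadjoint T) (resolvent (cadjoint T) z (r *\<^sub>C p))"
      unfolding char_function_def resolvent_def form(2) by (simp add: cinner_self_unit[OF p(3)])
    also have "\<dots> = schur_fun U' (0, 1) z *\<^sub>C q"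
      unfolding form(3) S.resolvent_scaleC[OF z] schur_fun_U'[OF z] T_p
      by (simp add: cinner_simps scaleC_add_left scaleC_scaleC mult_ac)
    finally have "v (char_function T z p) = schur_fun U' (0, 1) z *\<^sub>C v q"
      using v q(1) by (simp add: unitary_between_def)
    then show ?thesis
      by (simp add: scalar_char_function_def p_def[symmetric] q(2) scaleC_complex_def)
  qed
  then show ?thesis
    using form(1) by blast
qed

section \<open>Coordinates with respect to orthonormal systems\<close>

definition orthonormal :: "'i set \<Rightarrow> ('i \<Rightarrow> 'a::complex_inner) \<Rightarrow> bool"
  where "orthonormal I h \<longleftrightarrow> (\<forall>i\<in>I. \<forall>j\<in>I. cinner (h i) (h j) = (if i = j then 1 else 0))"

lemma orthonormalD:
  "orthonormal I h \<Longrightarrow> i \<in> I \<Longrightarrow> j \<in> I \<Longrightarrow> cinner (h i) (h j) = (if i = j then 1 else 0)"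
  by (simp add: orthonormal_def)

lemma cinner_orthonormal_sum:
  assumes "orthonormal I h" "finite A" "A \<subseteq> I" "j \<in> I"
  shows "cinner (\<Sum>i\<in>A. c i *\<^sub>C h i) (h j) = (if j \<in> A then c j else 0)"
proof -
  have "cinner (\<Sum>i\<in>A. c i *\<^sub>C h i) (h j) = (\<Sum>i\<in>A. if i = j then c i else 0)"
    unfolding cinner_sum_left using assms
    by (intro sum.cong) (auto simp: cinner_simps orthonormalD subset_iff)
  then show ?thesis
    using assms(2) by simp
qed

lemma orthonormal_inj_on: "orthonormal I h \<Longrightarrow> inj_on h I"
  unfolding orthonormal_def by (intro inj_onI) (metis zero_neq_one)

lemma orthonormal_independent:
  assumes h: "orthonormal I h" and I: "finite I"
  shows "complex_vector.independent (h ` I)"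
proof
  assume "complex_vector.dependent (h ` I)"
  then obtain u i where i: "i \<in> I" "u (h i) \<noteq> 0" and sum: "(\<Sum>v\<in>h ` I. u v *\<^sub>C v) = 0"
    using complex_vector.dependent_finite[of "h ` I"] I by auto
  have "(\<Sum>i\<in>I. u (h i) *\<^sub>C h i) = 0"
    using sum by (simp add: sum.reindex[OF orthonormal_inj_on[OF h]])
  then have "u (h i) = 0"
    using cinner_orthonormal_sum[OF h I order_refl i(1), of "\<lambda>i. u (h i)"] i(1) by simp
  then show False
    using i(2) by simp
qed

lemma norm_orthonormal_sum:
  assumes h: "orthonormal I h" and A: "finite A" "A \<subseteq> I"
  shows "(norm (\<Sum>i\<in>A. c i *\<^sub>C h i))\<^sup>2 = (\<Sum>i\<in>A. (cmod (c i))\<^sup>2)"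
proof -
  let ?x = "\<Sum>i\<in>A. c i *\<^sub>C h i"
  have "cinner ?x ?x = (\<Sum>i\<in>A. c i * cinner (h i) ?x)"
    by (subst (1) cinner_sum_left) (simp add: cinner_simps)
  also have "\<dots> = (\<Sum>i\<in>A. c i * cnj (c i))"
  proof (rule sum.cong[OF refl])
    fix i assume i: "i \<in> A"
    have "cinner (h i) ?x = cnj (cinner ?x (h i))"
      by (rule cinner_commute)
    then show "c i * cinner (h i) ?x = c i * cnj (c i)"
      using cinner_orthonormal_sum[OF h A, of i c] i A(2) by auto
  qed
  also have "\<dots> = complex_of_real (\<Sum>i\<in>A. (cmod (c i))\<^sup>2)"
    by (simp add: complex_norm_square[unfolded of_real_power])
  finally show ?thesis
    unfolding cinner_self by (simp only: of_real_eq_iff)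
qed

lemma bessel_inequality:
  assumes h: "orthonormal I h" and A: "finite A" "A \<subseteq> I"
  shows "(\<Sum>i\<in>A. (cmod (cinner x (h i)))\<^sup>2) \<le> (norm x)\<^sup>2"
proof -
  define y where "y = (\<Sum>i\<in>A. cinner x (h i) *\<^sub>C h i)"
  have y: "(norm y)\<^sup>2 = (\<Sum>i\<in>A. (cmod (cinner x (h i)))\<^sup>2)"
    unfolding y_def by (rule norm_orthonormal_sum[OF h A])
  have "cinner y x = (\<Sum>i\<in>A. cinner x (h i) * cnj (cinner x (h i)))"
    unfolding y_def cinner_sum_left cinner_scaleC_left
    by (intro sum.cong refl arg_cong2[where f = times]) (rule cinner_commute)
  also have "\<dots> = complex_of_real ((norm y)\<^sup>2)"
    unfolding y by (simp add: complex_norm_square[unfolded of_real_power])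
  finally have "(norm y)\<^sup>2 = Re (cinner y x)"
    by simp
  also have "\<dots> \<le> norm y * norm x"
    using cinner_bound[of y x] complex_Re_le_cmod order_trans by blast
  finally have "norm y \<le> norm x"
    by (cases "y = 0") (simp_all add: power2_eq_square)
  then show ?thesis
    unfolding y[symmetric] by (simp add: power_mono)
qed

lemma unitary_between_bij:
  assumes "unitary_between UNIV UNIV J"
  shows "bij J"
proof (rule bijI)
  show "surj J"
    using assms by (auto simp: unitary_between_def)
  show "inj J"
  proof
    fix x y assume "J x = J y"
    have "cinner x z = cinner y z" for z
      using assms \<open>J x = J y\<close> unfolding unitary_between_def by (metis UNIV_I)
    then show "x = y"
      by (rule cinner_extensionality)
  qed
qed

lemma unitary_between_adjoint_pair:
  assumes J: "unitary_between UNIV UNIV J"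
  shows "adjoint_pair J (inv J)"
  unfolding adjoint_pair_def
  by (metis J UNIV_I bij_is_surj surj_f_inv_f unitary_between_bij unitary_between_def)

lemma ell2_nth_unit: "ell2_nth (ell2_unit k) n = (if n = k then 1 else 0)"
proof -
  have "summable (\<lambda>n. (cmod (if n = k then 1 else 0))\<^sup>2)"
    by (rule summable_finite[of "{k}"]) auto
  then show ?thesis
    by (simp add: ell2_unit_def ell2_nth_Abs)
qed

lemma cinner_ell2_unit: "cinner x (ell2_unit k) = ell2_nth x k"
proof -
  have "(\<lambda>n. ell2_nth x n * cnj (ell2_nth (ell2_unit k) n))
      = (\<lambda>n. if n = k then ell2_nth x n else 0)"
    by (auto simp: ell2_nth_unit)
  then show ?thesis
    using suminf_finite[of "{k}" "\<lambda>n. if n = k then ell2_nth x n else 0"]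
    by (simp add: cinner_ell2_def)
qed

text \<open>Bessel's inequality makes the coordinates square summable, and totality makes every vector
  the sum of its orthogonal expansion.\<close>

theorem ell2_coordinates:
  fixes h :: "nat \<Rightarrow> 'a::chilbert_space"
  assumes h: "orthonormal UNIV h" and total: "\<And>x. (\<And>n. cinner x (h n) = 0) \<Longrightarrow> x = 0"
  shows "\<exists>J. unitary_between UNIV UNIV J \<and> (\<forall>x n. ell2_nth (J x) n = cinner x (h n))"
proof -
  define J where "J x = Abs_ell2 (\<lambda>n. cinner x (h n))" for x
  have J: "ell2_nth (J x) n = cinner x (h n)" for x n
  proof -
    have "summable (\<lambda>n. (cmod (cinner x (h n)))\<^sup>2)"
      by (rule summableI_nonneg_bounded[of _ "(norm x)\<^sup>2"])
        (use bessel_inequality[OF h] in auto)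
    then show ?thesis
      by (simp add: J_def ell2_nth_Abs)
  qed
  have summable: "summable (\<lambda>n. ell2_nth y n *\<^sub>C h n)" for y
    unfolding summable_Cauchy
  proof (intro allI impI)
    fix d :: real assume d: "0 < d"
    then obtain N where N: "\<And>m n. N \<le> m \<Longrightarrow> norm (\<Sum>k\<in>{m..<n}. (cmod (ell2_nth y k))\<^sup>2) < d\<^sup>2"
      using ell2_nth_summable[of y] unfolding summable_Cauchy by (meson zero_less_power)
    have "norm (\<Sum>k\<in>{m..<n}. ell2_nth y k *\<^sub>C h k) < d" if "N \<le> m" for m n
    proof -
      have "(norm (\<Sum>k\<in>{m..<n}. ell2_nth y k *\<^sub>C h k))\<^sup>2 < d\<^sup>2"
        using N[OF that, of n] norm_orthonormal_sum[OF h, of "{m..<n}" "ell2_nth y"] by simp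
      then show ?thesis
        using d by (simp add: power_less_imp_less_base)
    qed
    then show "\<exists>N. \<forall>m\<ge>N. \<forall>n. norm (\<Sum>k\<in>{m..<n}. ell2_nth y k *\<^sub>C h k) < d"
      by blast
  qed
  define K where "K y = (\<Sum>n. ell2_nth y n *\<^sub>C h n)" for y
  have K: "(\<lambda>n. ell2_nth y n * cinner (h n) x) sums cinner (K y) x" for x y
    using bounded_linear.sums[OF bounded_linear_cinner_left summable_sums[OF summable[of y]], of x]
    by (simp add: K_def cinner_simps)
  have KJ_coord: "cinner (K y) (h n) = ell2_nth y n" for y n
  proof -
    have "(\<lambda>m. if m = n then ell2_nth y m else 0) sums cinner (K y) (h n)"
      using K[of y "h n"] orthonormalD[OF h] by (simp cong: if_cong) (simp add: if_distrib cong: if_cong)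
    then show ?thesis
      using sums_single[of n "ell2_nth y"] sums_unique2 by blast
  qed
  have JK: "J (K y) = y" for y
    by (rule ell2_eqI) (simp add: J KJ_coord)
  have KJ: "K (J x) = x" for x
  proof -
    have "K (J x) - x = 0"
      by (rule total) (simp add: cinner_simps KJ_coord J)
    then show ?thesis
      by simp
  qed
  have "cinner (J x) (J y) = cinner x y" for x y
  proof -
    have "(\<lambda>n. ell2_nth (J x) n * cnj (ell2_nth (J y) n)) sums cinner x y"
      using K[of "J x" y] unfolding KJ J by (simp add: cinner_commute[symmetric])
    then show ?thesis
      by (simp add: cinner_ell2_def sums_iff)
  qed
  moreover have "J (x + y) = J x + J y" "J (c *\<^sub>C x) = c *\<^sub>C J x" for x y c
    by (rule ell2_eqI; simp add: J cinner_simps)+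
  moreover have "surj J"
    using JK by (metis surjI)
  ultimately have "unitary_between UNIV UNIV J"
    by (simp add: unitary_between_def)
  then show ?thesis
    using J by blast
qed

theorem vec_coordinates:
  fixes g :: "'n::finite \<Rightarrow> 'a::chilbert_space"
  assumes g: "orthonormal UNIV g" and expand: "\<And>x. x = (\<Sum>i\<in>UNIV. cinner x (g i) *\<^sub>C g i)"
  shows "unitary_between UNIV UNIV (\<lambda>x. \<chi> i. cinner x (g i))"
  unfolding unitary_between_def
proof (intro conjI ballI allI)
  fix x y c
  show "(\<chi> i. cinner (x + y) (g i)) = (\<chi> i. cinner x (g i)) + (\<chi> i. cinner y (g i))"
    by (simp add: vec_eq_iff cinner_simps)
  show "(\<chi> i. cinner (c *\<^sub>C x) (g i)) = c *\<^sub>C (\<chi> i. cinner x (g i))"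
    by (simp add: vec_eq_iff cinner_simps scaleC_vec_def scaleC_complex_def)
  have "cinner x y = (\<Sum>i\<in>UNIV. cinner x (g i) * cinner (g i) y)"
    by (subst expand[of x]) (simp add: cinner_sum_left cinner_simps)
  then show "cinner (\<chi> i. cinner x (g i)) (\<chi> i. cinner y (g i)) = cinner x y"
    by (simp add: cinner_vec_def cinner_complex_def cinner_commute[symmetric])
  show "range (\<lambda>x. \<chi> i. cinner x (g i)) = UNIV"
  proof (rule surjI)
    fix y :: "complex ^ 'n"
    show "(\<chi> i. cinner (\<Sum>j\<in>UNIV. y $ j *\<^sub>C g j) (g i)) = y"
      by (simp add: vec_eq_iff cinner_orthonormal_sum[OF g])
  qed
qed

section \<open>Contractions with rank one defects are truncated CMV matrices\<close>

text \<open>The chain of the colligation starts at the unit vector of the scalar summand, whose orthogonal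
  complement is \<open>H\<close>.\<close>

locale rank_one_cmv = rank_one_contraction T S p q a + cmv_chain V W e
  for T S :: "'h::chilbert_space \<Rightarrow> 'h" and p q :: 'h and a :: complex
    and V W :: "nat \<Rightarrow> 'h \<times> complex \<Rightarrow> 'h \<times> complex" and e :: "nat \<Rightarrow> 'h \<times> complex" +
  assumes V_0: "V 0 = rank_one_contraction.U T p q a"
    and W_0: "W 0 = rank_one_contraction.U' S p q a"
    and e_0: "e 0 = (0, 1)"
    and cnu: "completely_nonunitary T"
begin

definition h :: "nat \<Rightarrow> 'h"
  where "h n = fst (e (Suc n))"

lemma e_Suc: "e (Suc n) = (h n, 0)"
proof -
  have "cinner (e (Suc n)) (e 0) = 0"
    by (simp add: e_orthogonal)
  then have "snd (e (Suc n)) = 0"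
    by (simp add: e_0 cinner_prod_def cinner_complex_def)
  then show ?thesis
    by (simp add: h_def prod_eq_iff)
qed

lemma norm_h: "norm (h n) = norm (e (Suc n))"
  by (simp add: e_Suc norm_Pair)

lemma cinner_h: "cinner x (h n) = cinner (x, c) (e (Suc n))"
  by (simp add: e_Suc cinner_Pair)

lemma orthogonal_to_chain: "(\<And>n. cinner x (h n) = 0) \<Longrightarrow> cinner (x, 0) (e k) = 0"
  by (cases k) (simp_all add: e_0 cinner_h[symmetric] cinner_Pair)

text \<open>The vectors orthogonal to the chain form a subspace that reduces the colligation. It lies in
  \<open>H\<close>, where the colligation acts as \<open>T\<close>: the restriction of \<open>T\<close> to it is unitary.\<close>

theorem h_total:
  assumes "\<And>n. cinner x (h n) = 0"
  shows "x = 0"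
proof -
  define X where "X = {x. \<forall>n. cinner x (h n) = 0}"
  have U: "U (x, 0) = (T x, 0) \<and> T x \<in> X" if "x \<in> X" for x
  proof -
    have c: "cinner (U (x, 0)) (e k) = 0" for k
      using V_complement[of "(x, 0)" k] orthogonal_to_chain[of x] that by (simp add: V_0 X_def)
    have "snd (U (x, 0)) = 0"
      using c[of 0] by (simp add: e_0 cinner_prod_def cinner_complex_def)
    then have eq: "U (x, 0) = (T x, 0)"
      by (simp add: U_def)
    then show ?thesis
      using c[of "Suc _"] by (simp add: X_def cinner_h[symmetric])
  qed
  have U': "U' (x, 0) = (S x, 0) \<and> S x \<in> X" if "x \<in> X" for x
  proof -
    have c: "cinner (U' (x, 0)) (e k) = 0" for k
      using W_complement[of "(x, 0)" k] orthogonal_to_chain[of x] that by (simp add: W_0 X_def)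
    have "snd (U' (x, 0)) = 0"
      using c[of 0] by (simp add: e_0 cinner_prod_def cinner_complex_def)
    then have eq: "U' (x, 0) = (S x, 0)"
      by (simp add: U'_def)
    then show ?thesis
      using c[of "Suc _"] by (simp add: X_def cinner_h[symmetric])
  qed
  have "closed X"
  proof -
    have "closed {x. cinner x (h n) = 0}" for n
      by (intro closed_Collect_eq linear_continuous_on bounded_linear_cinner_left continuous_intros)
    moreover have "X = (\<Inter>n. {x. cinner x (h n) = 0})"
      by (auto simp: X_def)
    ultimately show ?thesis
      by auto
  qed
  moreover have "complex_vector.subspace X"
    by (rule complex_vector.subspaceI) (simp_all add: X_def cinner_simps)
  ultimately have "reducing_subspace T X"
    using U U' by (auto simp: reducing_subspace_def cadjoint_eqI[OF adj])
  moreover have "unitary_between X X T"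
    unfolding unitary_between_def
  proof (intro conjI ballI allI)
    fix x y c assume x: "x \<in> X"
    show "T (c *\<^sub>C x) = c *\<^sub>C T x" "T (x + y) = T x + T y"
      by (simp_all add: adjoint_pair_linear[OF adj])
    assume y: "y \<in> X"
    have "cinner (T x, 0 :: complex) (T y, 0) = cinner (x, 0 :: complex) (y, 0)"
      using unitary_pair_cinner[OF unitary_U, of "(x, 0)" "(y, 0)"] U[OF x] U[OF y] by simp
    then show "cinner (T x) (T y) = cinner x y"
      by (simp add: cinner_Pair)
  next
    show "T ` X = X"
    proof
      show "T ` X \<subseteq> X"
        using U by blast
      show "X \<subseteq> T ` X"
      proof
        fix x assume x: "x \<in> X"
        then have "U (S x, 0) = (x, 0)"
          using U'[OF x] unitary_pairD(3)[OF unitary_U, of "(x, 0)"] by simp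
        then have "T (S x) = x"
          using U U'[OF x] by (metis fst_conv)
        then show "x \<in> T ` X"
          using U'[OF x] by (metis imageI)
      qed
    qed
  qed
  ultimately have "X = {0}"
    using cnu by (auto simp: completely_nonunitary_def)
  then show ?thesis
    using assms by (auto simp: X_def)
qed

lemma T_entries:
  assumes "norm (h i) = 1"
  shows "cinner (T (h j)) (h i) = truncated_cmv \<alpha> (i + 1) (j + 1)"
proof -
  have "cinner (T (h j)) (h i) = cinner (U (h j, 0)) (e (Suc i))"
    unfolding U_def by (simp add: cinner_h[symmetric])
  then show ?thesis
    using matrix_entries[of "Suc i" "Suc j"] assms by (simp add: V_0 e_Suc[symmetric] norm_h)
qed

lemma orthonormal_h:
  assumes "\<And>i. i \<in> I \<Longrightarrow> norm (h i) = 1"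
  shows "orthonormal I h"
  unfolding orthonormal_def
  using assms by (auto simp: cinner_h[where c = 0] e_Suc[symmetric] cinner_e norm_h)

lemma finite_chain:
  assumes N: "cmod (\<alpha> N) = 1"
  shows "n < N \<Longrightarrow> cmod (\<alpha> n) < 1" and "norm (e n) = 1 \<longleftrightarrow> n \<le> N"
    and "orthonormal {..<N} h"
    and "x = (\<Sum>n<N. cinner x (h n) *\<^sub>C h n)"
proof -
  have "norm (e N) = 1"
    using coupled_\<alpha>[of N] N by (auto simp: coupled_def)
  then have lt: "\<And>m. m < N \<Longrightarrow> cmod (\<alpha> m) < 1"
    by (simp add: e_unit_iff)
  then show "n < N \<Longrightarrow> cmod (\<alpha> n) < 1" .
  show unit: "norm (e n) = 1 \<longleftrightarrow> n \<le> N" for n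
    unfolding e_unit_iff using lt N by (metis less_irrefl less_le_trans not_le)
  show h: "orthonormal {..<N} h"
    by (rule orthonormal_h) (simp add: norm_h unit)
  have "x - (\<Sum>n<N. cinner x (h n) *\<^sub>C h n) = 0"
  proof (rule h_total)
    fix m
    show "cinner (x - (\<Sum>n<N. cinner x (h n) *\<^sub>C h n)) (h m) = 0"
    proof (cases "m < N")
      case True
      then show ?thesis
        by (simp add: cinner_simps cinner_orthonormal_sum[OF h])
    next
      case False
      then have "norm (e (Suc m)) \<noteq> 1"
        by (simp add: unit)
      then have "h m = 0"
        using e_unit_or_zero[of "Suc m"] by (simp add: h_def)
      then show ?thesis
        by simp
    qed
  qed
  then show "x = (\<Sum>n<N. cinner x (h n) *\<^sub>C h n)"
    by simp
qed

text \<open>If the Schur algorithm stops at step \<open>N\<close>, the vectors \<open>h 0, \<dots>, h (N - 1)\<close> form an orthonormal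
  basis.\<close>

lemma dim_eq:
  assumes N: "cmod (\<alpha> N) = 1"
  shows "complex_vector.span (h ` {..<N}) = UNIV" "complex_vector.dim (UNIV :: 'h set) = N"
proof -
  note fin = finite_chain[OF N]
  have "x \<in> complex_vector.span (h ` {..<N})" for x
    by (subst fin(4)[of x])
      (intro complex_vector.span_sum complex_vector.span_scale complex_vector.span_base imageI)
  then show span: "complex_vector.span (h ` {..<N}) = UNIV"
    by blast
  have "complex_vector.dim (UNIV :: 'h set) = card (h ` {..<N})"
    using span by (intro complex_vector.dim_eq_card orthonormal_independent[OF fin(3)]) simp_all
  then show "complex_vector.dim (UNIV :: 'h set) = N"
    by (simp add: card_image[OF orthonormal_inj_on[OF fin(3)]])
qed

text \<open>If the algorithm does not stop, the vectors \<open>h n\<close> form an infinite orthonormal system.\<close>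

lemma finite_dimensional_iff: "finite_dimensional TYPE('h) \<longleftrightarrow> (\<exists>N. cmod (\<alpha> N) = 1)"
proof
  assume "\<exists>N. cmod (\<alpha> N) = 1"
  then show "finite_dimensional TYPE('h)"
    unfolding finite_dimensional_def using dim_eq(1) by (metis finite_imageI finite_lessThan)
next
  assume "finite_dimensional TYPE('h)"
  then obtain B :: "'h set" where B: "finite B" "complex_vector.span B = UNIV"
    by (auto simp: finite_dimensional_def)
  show "\<exists>N. cmod (\<alpha> N) = 1"
  proof (rule ccontr)
    assume "\<nexists>N. cmod (\<alpha> N) = 1"
    then have "cmod (\<alpha> n) < 1" for n
      using \<alpha>_le[of n] by (metis less_eq_real_def)
    then have h: "orthonormal {..card B} h"
      by (intro orthonormal_h) (simp add: norm_h e_unit_iff)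
    have "card (h ` {..card B}) \<le> card B"
      using complex_vector.independent_span_bound[OF B(1) orthonormal_independent[OF h]] B(2) by simp
    then show False
      by (simp add: card_image[OF orthonormal_inj_on[OF h]])
  qed
qed

lemma ell2_equivalence:
  assumes "\<not> finite_dimensional TYPE('h)"
  shows "\<exists>A. cmv_operator_ell2 \<alpha> A \<and> unitarily_equivalent T A"
proof -
  have lt: "cmod (\<alpha> n) < 1" for n
    using assms \<alpha>_le[of n] finite_dimensional_iff by (metis less_eq_real_def)
  then have norm_h_1: "norm (h n) = 1" for n
    by (simp add: norm_h e_unit_iff)
  then have h: "orthonormal UNIV h"
    by (rule orthonormal_h)
  obtain J where J: "unitary_between UNIV UNIV J" and J_nth: "\<And>x n. ell2_nth (J x) n = cinner x (h n)"
    using ell2_coordinates[OF h h_total] by blast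
  have inv: "inv J (J x) = x" "J (inv J y) = y" for x y
    using unitary_between_bij[OF J] by (simp_all add: bij_is_inj bij_is_surj surj_f_inv_f)
  note JJ = unitary_between_adjoint_pair[OF J]
  have normJ: "norm (J x) = norm x" for x
  proof -
    have "cinner (J x) (J x) = cinner x x"
      using J by (simp add: unitary_between_def)
    then show ?thesis
      by (simp add: cinner_self of_real_power[symmetric] del: of_real_power)
  qed
  define A where "A = J \<circ> T \<circ> inv J"
  have "bounded_clinear A"
  proof (rule bounded_clinearI)
    show "norm (A y) \<le> 1 * norm y" for y
      using norm_T[of "inv J y"] normJ[of "inv J y"] by (simp add: A_def normJ inv)
  qed (simp_all add: A_def adjoint_pair_linear[OF JJ] adjoint_pair_linear[OF adjoint_pair_sym[OF JJ]]
      adjoint_pair_linear[OF adj])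
  moreover have "cinner (A (ell2_unit j)) (ell2_unit i) = truncated_cmv \<alpha> (i + 1) (j + 1)" for i j
  proof -
    have "J (h j) = ell2_unit j"
      by (rule ell2_eqI) (auto simp: J_nth ell2_nth_unit orthonormalD[OF h])
    then have "inv J (ell2_unit j) = h j"
      using inv(1) by metis
    then show ?thesis
      by (simp add: A_def cinner_ell2_unit J_nth T_entries[OF norm_h_1])
  qed
  moreover have "unitarily_equivalent T A"
    unfolding unitarily_equivalent_def using J by (intro exI[of _ J]) (simp add: A_def fun_eq_iff inv)
  ultimately show ?thesis
    unfolding cmv_operator_ell2_def by blast
qed

lemma vec_equivalence:
  fixes b :: "'n::finite \<Rightarrow> nat"
  assumes N: "cmod (\<alpha> N) = 1" and b: "bij_betw b UNIV {1..N}"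
  shows "unitarily_equivalent T (cmv_operator_vec \<alpha> b)"
proof -
  note fin = finite_chain[OF N]
  define g where "g i = h (b i - 1)" for i
  have b_range: "1 \<le> b i" "b i \<le> N" for i
    using bij_betw_apply[OF b, of i] by auto
  have bij: "bij_betw (\<lambda>i. b i - 1) UNIV {..<N}"
  proof (rule bij_betw_trans[OF b, unfolded comp_def])
    show "bij_betw (\<lambda>k. k - 1) {1..N} {..<N}"
      by (rule bij_betw_byWitness[where f' = Suc]) auto
  qed
  have g: "orthonormal UNIV g"
    unfolding orthonormal_def g_def
    using orthonormalD[OF fin(3)] bij_betw_apply[OF bij] inj_eq[OF bij_betw_imp_inj_on[OF bij]] by simp
  have expand: "x = (\<Sum>i\<in>UNIV. cinner x (g i) *\<^sub>C g i)" for x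
    using fin(4)[of x] sum.reindex_bij_betw[OF bij, of "\<lambda>n. cinner x (h n) *\<^sub>C h n"]
    by (simp add: g_def)
  have entries: "cinner (T (g j)) (g i) = truncated_cmv \<alpha> (b i) (b j)" for i j
  proof -
    have "norm (h (b i - 1)) = 1"
      using b_range[of i] by (simp add: norm_h fin(2))
    then show ?thesis
      using T_entries[of "b i - 1" "b j - 1"] b_range[of i] b_range[of j] by (simp add: g_def)
  qed
  have "cinner (T x) (g i) = (\<Sum>j\<in>UNIV. truncated_cmv \<alpha> (b i) (b j) * cinner x (g j))" for x i
  proof -
    have "bounded_linear T"
      by (intro bounded_clinear_linear(6) bounded_clinearI[of _ 1])
        (simp_all add: adjoint_pair_linear[OF adj] norm_T)
    then interpret T: bounded_linear T .
    have "T x = (\<Sum>j\<in>UNIV. cinner x (g j) *\<^sub>C T (g j))"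
      by (subst expand) (simp add: T.sum adjoint_pair_scaleC[OF adj])
    then show ?thesis
      by (simp add: cinner_sum_left cinner_simps entries mult.commute)
  qed
  then show ?thesis
    unfolding unitarily_equivalent_def
    by (intro exI[of _ "\<lambda>x. \<chi> i. cinner x (g i)"] conjI vec_coordinates[OF g expand])
      (simp add: fun_eq_iff cmv_operator_vec_def vec_eq_iff matrix_vector_mult_def)
qed

end

lemma schur_function_cong:
  assumes "\<And>z. cmod z < 1 \<Longrightarrow> f z = g z" "schur_function g"
  shows "schur_function f"
  using assms holomorphic_cong[of "ball 0 1" "ball 0 1" f g]
  by (auto simp: schur_function_def image_subset_iff)

lemma rank_one_cmv_exists:
  fixes T :: "'h::chilbert_space \<Rightarrow> 'h"
  assumes "contraction T" "completely_nonunitary T" "rank_one_defects T"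
    and "unitary_between (defect_space T) UNIV u"
    and "unitary_between (defect_space (cadjoint T)) UNIV v"
  shows "\<exists>p q a V W e. rank_one_cmv T (cadjoint T) p q a V W e \<and>
    (\<forall>z. cmod z < 1 \<longrightarrow> scalar_char_function T u v z = schur_fun (W 0) (e 0) z)"
proof -
  obtain p q a where loc: "rank_one_contraction T (cadjoint T) p q a"
    and char: "\<And>z. cmod z < 1 \<Longrightarrow> scalar_char_function T u v z
      = schur_fun (rank_one_contraction.U' (cadjoint T) p q a) (0, 1) z"
    using scalar_char_function_eq[OF assms(1,3-5)] by blast
  interpret rank_one_contraction T "cadjoint T" p q a
    by (rule loc)
  have "norm ((0 :: 'h), (1 :: complex)) = 1"
    by (simp add: norm_Pair)
  then obtain V W e where "cmv_chain V W e" "V 0 = U" "W 0 = U'" "e 0 = (0, 1)"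
    using cmv_chain_exists[OF unitary_U] by blast
  then have "rank_one_cmv T (cadjoint T) p q a V W e"
    using loc assms(2) by (intro rank_one_cmv.intro rank_one_cmv_axioms.intro)
  then show ?thesis
    using char \<open>W 0 = U'\<close> \<open>e 0 = (0, 1)\<close> by metis
qed

theorem theorem6p4:
  fixes T :: "'h::chilbert_space \<Rightarrow> 'h"
  assumes contr: "contraction T"
    and cnu: "completely_nonunitary T"
    and rank1: "rank_one_defects T"
    and space: "(\<not> finite_dimensional TYPE('h) \<and> separable_space (euclidean :: 'h topology))
      \<or> finite_dimensional TYPE('h)"
  shows "(\<not> finite_dimensional TYPE('h) \<longrightarrow>
      (\<forall>u v. unitary_between (defect_space T) UNIV u \<and>
             unitary_between (defect_space (cadjoint T)) UNIV v \<longrightarrow>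
        (\<exists>\<alpha> A. infinite_schur_parameters (scalar_char_function T u v) \<alpha> \<and>
          cmv_operator_ell2 \<alpha> A \<and> unitarily_equivalent T A)))
    \<and> (\<forall>N (e :: 'n::finite \<Rightarrow> nat).
        finite_dimensional TYPE('h) \<and> complex_vector.dim (UNIV :: 'h set) = N \<and>
        bij_betw e UNIV {1..N} \<longrightarrow>
      (\<forall>u v. unitary_between (defect_space T) UNIV u \<and>
             unitary_between (defect_space (cadjoint T)) UNIV v \<longrightarrow>
        (\<exists>\<alpha>. finite_schur_parameters (scalar_char_function T u v) N \<alpha> \<and>
          unitarily_equivalent T (cmv_operator_vec \<alpha> e))))
    \<and> (\<exists>(M :: 'h \<Rightarrow> 'h \<times> complex) (L :: 'h \<times> complex \<Rightarrow> 'h).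
        isometry_op M \<and> op_rank (\<lambda>k. k - M (cadjoint M k)) = 1 \<and>
        coisometry_op L \<and> op_rank (\<lambda>k. k - cadjoint L (L k)) = 1 \<and>
        T = L \<circ> M)"
proof (intro conjI impI allI)
  fix u v :: "'h \<Rightarrow> complex"
  assume infinite: "\<not> finite_dimensional TYPE('h)"
    and uv: "unitary_between (defect_space T) UNIV u \<and>
      unitary_between (defect_space (cadjoint T)) UNIV v"
  let ?f = "scalar_char_function T u v"
  obtain p q a V W e where loc: "rank_one_cmv T (cadjoint T) p q a V W e"
    and f: "\<And>z. cmod z < 1 \<Longrightarrow> ?f z = schur_fun (W 0) (e 0) z"
    using rank_one_cmv_exists[OF contr cnu rank1] uv by blast
  interpret rank_one_cmv T "cadjoint T" p q a V W e
    by (rule loc)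
  have lt: "cmod (\<alpha> n) < 1" for n
    using infinite \<alpha>_le[of n] finite_dimensional_iff by (metis less_eq_real_def)
  have "infinite_schur_parameters ?f \<alpha>"
    unfolding infinite_schur_parameters_def
    using schur_function_cong[OF f schur_function_schur_fun[OF unitary norm_e_0]] lt
      schur_parameter_eq[of ?f, OF f] e_unit_iff by simp
  then show "\<exists>\<alpha> A. infinite_schur_parameters ?f \<alpha> \<and> cmv_operator_ell2 \<alpha> A \<and> unitarily_equivalent T A"
    using ell2_equivalence[OF infinite] by blast
next
  fix N and u v :: "'h \<Rightarrow> complex" and b :: "'n \<Rightarrow> nat"
  assume N: "finite_dimensional TYPE('h) \<and> complex_vector.dim (UNIV :: 'h set) = N \<and>
      bij_betw b UNIV {1..N}"
    and uv: "unitary_between (defect_space T) UNIV u \<and>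
      unitary_between (defect_space (cadjoint T)) UNIV v"
  let ?f = "scalar_char_function T u v"
  obtain p q a V W e where loc: "rank_one_cmv T (cadjoint T) p q a V W e"
    and f: "\<And>z. cmod z < 1 \<Longrightarrow> ?f z = schur_fun (W 0) (e 0) z"
    using rank_one_cmv_exists[OF contr cnu rank1] uv by blast
  interpret rank_one_cmv T "cadjoint T" p q a V W e
    by (rule loc)
  have last: "cmod (\<alpha> N) = 1"
    using N finite_dimensional_iff dim_eq(2) by blast
  have "finite_schur_parameters ?f N \<alpha>"
    unfolding finite_schur_parameters_def
    using schur_function_cong[OF f schur_function_schur_fun[OF unitary norm_e_0]] last
      finite_chain(1,2)[OF last] schur_parameter_eq[of ?f, OF f] by simp
  then show "\<exists>\<alpha>. finite_schur_parameters ?f N \<alpha> \<and> unitarily_equivalent T (cmv_operator_vec \<alpha> b)"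
    using vec_equivalence[OF last] N by blast
next
  obtain p where p: "p \<in> defect_space T" "norm p = 1"
    using positive_op_rank_one(1)[OF defect_op_squared(1)[OF contr]] rank1
    unfolding rank_one_defects_def defect_space_def by blast
  obtain q where q: "q \<in> defect_space (cadjoint T)" "norm q = 1"
    using positive_op_rank_one(1)[OF defect_op_squared(1)[OF contraction_adjoint(2)[OF contr]]] rank1
    unfolding rank_one_defects_def defect_space_def by blast
  interpret rank_one_contraction T "cadjoint T" p q "- cinner (T p) q"
    by (rule rank_one_contraction_normal_form(1)[OF contr rank1 p q])
  show "\<exists>(M :: 'h \<Rightarrow> 'h \<times> complex) (L :: 'h \<times> complex \<Rightarrow> 'h).
        isometry_op M \<and> op_rank (\<lambda>k. k - M (cadjoint M k)) = 1 \<and>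
        coisometry_op L \<and> op_rank (\<lambda>k. k - cadjoint L (L k)) = 1 \<and> T = L \<circ> M"
    by (rule product_of_coisometry_and_isometry)
qed

end
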